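(* Let $Z$ be a covariate random field satisfying the ergodicity condition stated in the context. For $\rho_0\in\mathcal{R}\cap C^1([0,1]^d)$, consider data $(N^{(n)},Z^{(n)})\sim P^{(n)}_{\rho_0}$. Let $\Pi_n$ be a (possibly $n$-dependent) probability measure supported on $\mathcal{R}\cap C^1([0,1]^d)$, and assume that for some positive sequence $\varepsilon_n\to0$ such that $n\varepsilon_n^2\to\infty$ as $n\to\infty$, $$\Pi_n(\rho:\ \|\rho-\rho_0\|_{L^\infty}\le\varepsilon_n)\ge e^{-L_1n\varepsilon_n^2}$$ for some $L_1>0$. Further assume that for all $L_2>0$ there exist measurable sets $\mathcal{R}_n\subseteq\mathcal{R}\cap C^1([0,1]^d)$ such that $$\Pi_n(\mathcal{R}_n^c)\le e^{-L_2n\varepsilon_n^2},\qquad \ln\mathcal{N}(\varepsilon_n;\mathcal{R}_n,\|\cdot\|_{L^1})\le L_3n\varepsilon_n^2,$$ and $\|\rho\|_{C^1}\le L_4$ for all $\rho\in\mathcal{R}_n$, for some $L_3,L_4>0$. Then, for $M>0$ large enough, as $n\to\infty$, $$\mathrm{E}^{(n)}_{\rho_0}\left[\Pi_n\left(\rho:\ \|\rho-\rho_0\|_{L^1([0,1]^d,\nu_Z)}>M\varepsilon_n\ \Big|\ N^{(n)},Z^{(n)}\right)\right]\to0.$$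
   Context: Observation model. Fix $d,D\in\mathbb{N}$. Let $Z=(Z(x),\ x\in\mathbb{R}^D)$ be a jointly measurable random field with values in $[0,1]^d$. For $n\in\mathbb{N}$ let $\mathcal{W}_n=[-\tfrac12 n^{1/D},\tfrac12 n^{1/D}]^D$ (so $\mathrm{vol}(\mathcal{W}_n)=n$) and $Z^{(n)}=(Z(x),\ x\in\mathcal{W}_n)$, assumed to be a Borel random element of $L^\infty(\mathcal{W}_n;\mathbb{R}^d)$, with law $P_{Z^{(n)}}$. Let $\mathcal{R}$ be the collection of bounded functions $\rho:[0,1]^d\to[0,\infty)$. For $\rho\in\mathcal{R}$ put $\lambda^{(n)}_\rho(x)=\rho(Z(x))$, $x\in\mathcal{W}_n$. Conditionally on $Z^{(n)}$, $N^{(n)}=\{X_1,\dots,X_{K^{(n)}}\}$ is an inhomogeneous Poisson point process on $\mathcal{W}_n$ with intensity $\lambda^{(n)}_\rho$: $K^{(n)}|Z^{(n)}\sim\mathrm{Poisson}(\int_{\mathcal{W}_n}\lambda^{(n)}_\rho(x)\,dx)$ and, given $Z^{(n)},K^{(n)}$, the points $X_1,\dots,X_{K^{(n)}}$ are i.i.d. with density proportional to $\lambda^{(n)}_\rho$ on $\mathcal{W}_n$. $P^{(n)}_\rho$ denotes the joint law of $(N^{(n)},Z^{(n)})$ and $\mathrm{E}^{(n)}_\rho$ its expectation. A single realisation of $(N^{(n)},Z^{(n)})$ is observed. Likelihood and posterior. The likelihood (density of $P^{(n)}_\rho$ with respect to $P^{(n)}_1$) is $$L^{(n)}(\rho)=\exp\Big\{\sum_{k=1}^{K^{(n)}}\ln\rho(Z(X_k))-\int_{\mathcal{W}_n}(\rho(Z(x))-1)\,dx\Big\}.$$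 For a prior $\Pi_n$ on $\mathcal{R}$, the posterior is $\Pi_n(R|N^{(n)},Z^{(n)})=\int_R L^{(n)}(\rho)\,d\Pi_n(\rho)\big/\int_{\mathcal{R}}L^{(n)}(\rho)\,d\Pi_n(\rho)$ for measurable $R\subseteq\mathcal{R}$. Ergodicity condition on the covariates. $Z$ is stationary with stationary distribution $\nu_Z$ (i.e. $Z(x)\sim\nu_Z$ for all $x$); $\nu_Z$ is supported on $[0,1]^d$ and absolutely continuous with bounded probability density function; and for all $K_1>0$ there exists $K_2>0$ such that, for every $f\in W^{1,\infty}([0,1]^d)$ (Sobolev space of functions with essentially bounded weak first derivatives) with $\|f\|_{W^{1,\infty}}\le K_1$, for all $t>0$ and $n\in\mathbb{N}$, $$P_{Z^{(n)}}\left(\left|\frac{1}{\mathrm{vol}(\mathcal{W}_n)}\int_{\mathcal{W}_n}f(Z(x))\,dx-\int_{[0,1]^d}f(z)\,d\nu_Z(z)\right|>t\right)\le e^{-K_2\mathrm{vol}(\mathcal{W}_n)t^2}.$$ Covering numbers. $\mathcal{N}(\varepsilon;\mathcal{R}_n,\|\cdot\|_{L^1})$ is the smallest number of $L^1([0,1]^d)$-balls of radius $\varepsilon$ required to contain $\mathcal{R}_n$ in their union. The constants $L_3,L_4$ do not depend on $n$ (they may depend on $L_2$).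
   Formalization: The true intensity ρ_0 is additionally assumed strictly positive on [0,1]^d; if ρ_0 may vanish (e.g. ρ_0(z)=z), the claim fails, because a nearby ρ vanishing on a small set gets likelihood zero and the prior-mass condition no longer controls the evidence. *)

theory Defs
  imports "HOL-Probability.Probability"
begin

abbreviation unit_cube :: "(real ^ 'd) set" where
  "unit_cube \<equiv> cbox 0 1"

(* The cube of volume n centred at the origin. *)
definition window :: "nat \<Rightarrow> (real ^ 'm) set" where
  "window n = cbox (\<chi> i. - (1/2) * real n powr (1 / real CARD('m)))
                   (\<chi> i. (1/2) * real n powr (1 / real CARD('m)))"


text \<open>The space \<open>L\<^sup>\<infinity>(A)\<close>. Its elements are represented by Borel functions rather than by classes;
  every open set below is saturated for equality almost everywhere on \<open>A\<close>, so the
  \<open>\<sigma>\<close>-algebra is exactly that of the Borel sets of the quotient space.\<close>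

definition Linf_norm :: "'a::euclidean_space set \<Rightarrow> ('a \<Rightarrow> 'b::real_normed_vector) \<Rightarrow> ereal" where
  "Linf_norm A f = esssup (restrict_space lborel A) (\<lambda>x. ereal (norm (f x)))"

definition Linf :: "'a::euclidean_space set \<Rightarrow> ('a \<Rightarrow> 'b::euclidean_space) set" where
  "Linf A = {f \<in> borel_measurable (restrict_space lborel A). Linf_norm A f < \<infinity>}"

definition Linf_borel :: "'a::euclidean_space set \<Rightarrow> ('a \<Rightarrow> 'b::euclidean_space) measure" where
  "Linf_borel A = sigma (Linf A)
     {U. U \<subseteq> Linf A \<and>
         (\<forall>f\<in>U. \<exists>e>0. \<forall>g\<in>Linf A. Linf_norm A (\<lambda>x. g x - f x) < ereal e \<longrightarrow> g \<in> U)}"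


definition partial_deriv :: "(real ^ 'd) set \<Rightarrow> 'd \<Rightarrow> (real ^ 'd \<Rightarrow> real) \<Rightarrow> real ^ 'd \<Rightarrow> real" where
  "partial_deriv S i f z = frechet_derivative f (at z within S) (axis i 1)"

primrec C_k :: "nat \<Rightarrow> (real ^ 'd \<Rightarrow> real) \<Rightarrow> bool" where
  "C_k 0 f = continuous_on UNIV f"
| "C_k (Suc k) f = ((\<forall>z. f differentiable (at z)) \<and> (\<forall>i. C_k k (partial_deriv UNIV i f)))"

definition test_function :: "(real ^ 'd) set \<Rightarrow> (real ^ 'd \<Rightarrow> real) \<Rightarrow> bool" where
  "test_function S \<phi> \<longleftrightarrow>
     (\<forall>k. C_k k \<phi>) \<and> (\<exists>K. compact K \<and> K \<subseteq> S \<and> (\<forall>z. z \<notin> K \<longrightarrow> \<phi> z = 0))"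

(* Essentially bounded weak gradient on the interior (0,1)^d of the cube. *)
definition weak_gradient :: "(real ^ 'd \<Rightarrow> real) \<Rightarrow> ('d \<Rightarrow> real ^ 'd \<Rightarrow> real) \<Rightarrow> bool" where
  "weak_gradient f G \<longleftrightarrow> f \<in> Linf unit_cube \<and> (\<forall>i. G i \<in> Linf unit_cube) \<and>
     (\<forall>\<phi> i. test_function (box 0 1) \<phi> \<longrightarrow>
        (LINT z:box 0 1|lborel. f z * partial_deriv UNIV i \<phi> z) =
        - (LINT z:box 0 1|lborel. G i z * \<phi> z))"

(* The weak gradient is unique almost everywhere, so the infimum below is over a single value, or
   over the empty set (value infinity) if f has no essentially bounded weak derivatives. Hence f
   belongs to W^{1,infinity} iff this is finite. *)
definition W1inf_norm :: "(real ^ 'd \<Rightarrow> real) \<Rightarrow> ereal" where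
  "W1inf_norm f =
     (INF G\<in>Collect (weak_gradient f). Linf_norm unit_cube f + (\<Sum>i\<in>UNIV. Linf_norm unit_cube (G i)))"


text \<open>Intensity functions. They live on the cube only, hence the extensional function space.\<close>

definition intensities :: "(real ^ 'd \<Rightarrow> real) set" where
  "intensities = {\<rho> \<in> unit_cube \<rightarrow>\<^sub>E {0..}. bounded (\<rho> ` unit_cube)}"

(* Derivatives at boundary points are taken within the cube, where they are still unique; on the
   cube this agrees with continuous extendability of the interior partial derivatives. *)
definition C1_cube :: "(real ^ 'd \<Rightarrow> real) set" where
  "C1_cube = {\<rho>. (\<forall>z\<in>unit_cube. \<rho> differentiable (at z within unit_cube)) \<and>
                (\<forall>i. continuous_on unit_cube (partial_deriv unit_cube i \<rho>))}"

definition C1_norm :: "(real ^ 'd \<Rightarrow> real) \<Rightarrow> real" where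
  "C1_norm \<rho> = (SUP z\<in>unit_cube. \<bar>\<rho> z\<bar>) +
     (\<Sum>i\<in>UNIV. SUP z\<in>unit_cube. \<bar>partial_deriv unit_cube i \<rho> z\<bar>)"

definition C1_intensities :: "(real ^ 'd \<Rightarrow> real) set" where
  "C1_intensities = intensities \<inter> C1_cube"

(* Priors are Borel probability measures on C1_intensities. The Borel sets are those of the supremum
   distance; on this set the C^1 norm and the point evaluations generate the same sigma-algebra. *)
definition intensity_borel :: "(real ^ 'd \<Rightarrow> real) measure" where
  "intensity_borel = sigma C1_intensities
     {U. U \<subseteq> C1_intensities \<and>
         (\<forall>f\<in>U. \<exists>e>0. \<forall>g\<in>C1_intensities. (SUP z\<in>unit_cube. \<bar>g z - f z\<bar>) < e \<longrightarrow> g \<in> U)}"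

definition L1_dist :: "(real ^ 'd) measure \<Rightarrow> (real ^ 'd \<Rightarrow> real) \<Rightarrow> (real ^ 'd \<Rightarrow> real) \<Rightarrow> real" where
  "L1_dist \<mu> f g = (LINT z:unit_cube|\<mu>. \<bar>f z - g z\<bar>)"

(* Closed balls, with centres anywhere in L^1 of the cube. *)
definition covering_number :: "real \<Rightarrow> (real ^ 'd \<Rightarrow> real) set \<Rightarrow> enat" where
  "covering_number e R =
     (INF C\<in>{C. finite C \<and> (\<forall>c\<in>C. set_integrable lborel unit_cube c) \<and>
                R \<subseteq> (\<Union>c\<in>C. {f. set_integrable lborel unit_cube f \<and> L1_dist lborel f c \<le> e})}.
        enat (card C))"


text \<open>The covariate field \<open>Z\<close> is given by its sample paths \<open>Z \<omega>\<close> on a probability space \<open>M\<close>.\<close>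

definition covariate_field :: "'w measure \<Rightarrow> ('w \<Rightarrow> real ^ 'm \<Rightarrow> real ^ 'd) \<Rightarrow> bool" where
  "covariate_field M Z \<longleftrightarrow>
     prob_space M \<and>
     (\<lambda>(\<omega>, x). Z \<omega> x) \<in> borel_measurable (M \<Otimes>\<^sub>M borel) \<and>
     (\<forall>\<omega>\<in>space M. \<forall>x. Z \<omega> x \<in> unit_cube) \<and>
     (\<forall>n\<ge>1. Z \<in> measurable M (Linf_borel (window n)))"

definition covariate_law ::
    "'w measure \<Rightarrow> ('w \<Rightarrow> real ^ 'm \<Rightarrow> real ^ 'd) \<Rightarrow> nat \<Rightarrow> (real ^ 'm \<Rightarrow> real ^ 'd) measure" where
  "covariate_law M Z n = distr M (Linf_borel (window n)) Z"

(* Each class in W^{1,infinity} is represented by a Borel function f. *)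
definition ergodic_covariates ::
    "'w measure \<Rightarrow> ('w \<Rightarrow> real ^ 'm \<Rightarrow> real ^ 'd) \<Rightarrow> (real ^ 'd) measure \<Rightarrow> bool" where
  "ergodic_covariates M Z \<nu> \<longleftrightarrow>
     (\<forall>x. distr M borel (\<lambda>\<omega>. Z \<omega> x) = \<nu>) \<and>
     (AE z in \<nu>. z \<in> unit_cube) \<and>
     (\<exists>p C. p \<in> borel_measurable borel \<and> (\<forall>z. 0 \<le> p z \<and> p z \<le> C) \<and>
            \<nu> = density lborel (\<lambda>z. ennreal (p z))) \<and>
     (\<forall>K\<^sub>1>0. \<exists>K\<^sub>2>0. \<forall>f\<in>borel_measurable borel. W1inf_norm f \<le> ereal K\<^sub>1 \<longrightarrow>
        (\<forall>t>0. \<forall>n\<ge>1.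
           measure (covariate_law M Z n)
             {z \<in> Linf (window n).
                t < \<bar>(LINT x:window n|lborel. f (z x)) / measure lborel (window n :: (real ^ 'm) set)
                     - (LINT u:unit_cube|\<nu>. f u)\<bar>}
           \<le> exp (- K\<^sub>2 * measure lborel (window n :: (real ^ 'm) set) * t\<^sup>2)))"


text \<open>A realisation of the point process is a pair \<open>(k, X)\<close> standing for the points
  \<open>X 0, \<dots>, X (k - 1)\<close>; the remaining entries of the sequence \<open>X\<close> are never used. In the
  next definitions \<open>z\<close> is a covariate path.\<close>

type_synonym 'm points = "nat \<times> (nat \<Rightarrow> real ^ 'm)"

abbreviation points_space :: "('m::finite) points measure" where
  "points_space \<equiv> count_space UNIV \<Otimes>\<^sub>M (\<Pi>\<^sub>M i\<in>UNIV. borel)"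

definition total_intensity ::
    "nat \<Rightarrow> (real ^ 'd \<Rightarrow> real) \<Rightarrow> (real ^ 'm \<Rightarrow> real ^ 'd) \<Rightarrow> real" where
  "total_intensity n \<rho> z = (LINT x:window n|lborel. \<rho> (z x))"

(* poisson_pmf is only specified for a positive rate. *)
definition poisson_law :: "real \<Rightarrow> nat measure" where
  "poisson_law r = measure_pmf (if r = 0 then return_pmf 0 else poisson_pmf r)"

(* If the total intensity vanishes there are no points, and the choice made here is irrelevant. *)
definition point_law ::
    "nat \<Rightarrow> (real ^ 'd \<Rightarrow> real) \<Rightarrow> (real ^ 'm \<Rightarrow> real ^ 'd) \<Rightarrow> (real ^ 'm) measure" where
  "point_law n \<rho> z =
     (if total_intensity n \<rho> z = 0 then uniform_measure lborel (window n)
      else density lborel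
             (\<lambda>x. ennreal (indicator (window n) x * \<rho> (z x) / total_intensity n \<rho> z)))"

definition poisson_process_law ::
    "nat \<Rightarrow> (real ^ 'd \<Rightarrow> real) \<Rightarrow> (real ^ 'm \<Rightarrow> real ^ 'd) \<Rightarrow> 'm points measure" where
  "poisson_process_law n \<rho> z =
     poisson_law (total_intensity n \<rho> z) \<Otimes>\<^sub>M (\<Pi>\<^sub>M i\<in>UNIV. point_law n \<rho> z)"

(* The joint law of the points and the covariates, where the covariates are carried by omega: evaluating
   Z at the random points needs the jointly measurable paths rather than their L^infinity classes. *)
definition observation_law ::
    "'w measure \<Rightarrow> ('w \<Rightarrow> real ^ 'm \<Rightarrow> real ^ 'd) \<Rightarrow> nat \<Rightarrow> (real ^ 'd \<Rightarrow> real) \<Rightarrow>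
     ('m points \<times> 'w) measure" where
  "observation_law M Z n \<rho> =
     M \<bind> (\<lambda>\<omega>. distr (poisson_process_law n \<rho> (Z \<omega>)) (points_space \<Otimes>\<^sub>M M) (\<lambda>N. (N, \<omega>)))"

(* The product is exp of the sum of ln (rho (Z (X_k))) with ln 0 = -infinity and exp (-infinity) = 0;
   writing the sum of logarithms would use ln 0 = 0 at zeros of rho. *)
definition likelihood ::
    "nat \<Rightarrow> 'm points \<Rightarrow> (real ^ 'm \<Rightarrow> real ^ 'd) \<Rightarrow> (real ^ 'd \<Rightarrow> real) \<Rightarrow> real" where
  "likelihood n N z \<rho> =
     (\<Prod>k<fst N. \<rho> (z (snd N k))) * exp (- (LINT x:window n|lborel. (\<rho> (z x) - 1)))"

definition posterior ::
    "(real ^ 'd \<Rightarrow> real) measure \<Rightarrow> nat \<Rightarrow> 'm points \<Rightarrow> (real ^ 'm \<Rightarrow> real ^ 'd) \<Rightarrow>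
     (real ^ 'd \<Rightarrow> real) set \<Rightarrow> ennreal" where
  "posterior P n N z R =
     (\<integral>\<^sup>+\<rho>\<in>R. ennreal (likelihood n N z \<rho>) \<partial>P) / (\<integral>\<^sup>+\<rho>. ennreal (likelihood n N z \<rho>) \<partial>P)"

end

theory Submission
  imports Defs
begin

text \<open>
  The proof compares, for every intensity \<open>\<rho>\<close>, the likelihood ratio
  \<open>r(\<rho>) = L(\<rho>) / L(\<rho>\<^sub>0)\<close>, and it needs only one computation with the point process: given the
  covariates, \<open>E (\<Prod>k h(X\<^sub>k)) = exp (\<integral> \<lambda> (h - 1))\<close> for a Poisson process of intensity \<open>\<lambda>\<close>
  (\<open>poisson_process_generating_functional\<close>). The ratio, its inverse, an exponentiated test statistic
  and their products are all products over the points times a function of the covariate path, so this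
  formula bounds all their expectations (\<open>tilted_expectation_le\<close>). Write \<open>x = n \<epsilon>\<^sub>n\<^sup>2\<close>.

  \<^bold>\<open>From the posterior to expectations.\<close> The posterior mass of a set \<open>A\<close> is \<open>u / d\<close>
  with \<open>u = \<integral>\<^sub>A r d\<Pi>\<close> and \<open>d = \<integral> r d\<Pi>\<close>. As \<open>u / d \<le> 1\<close>, it is at most
  \<open>\<surd>(u / d)\<close>, hence at most \<open>(t u + 1 / (t d)) / 2\<close> for every \<open>t > 0\<close>. By Cauchy-Schwarz
  \<open>1 / d\<close> is at most \<open>\<integral>\<^sub>B 1 / r d\<Pi> / \<Pi>(B)\<^sup>2\<close> for every set \<open>B\<close> of positive
  intensities (\<open>posterior_le_weighted\<close>). Thus numerator and denominator are bounded in expectation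
  separately, without an event on which the denominator is large. For \<open>B\<close> the supremum ball of radius
  \<open>\<epsilon>\<^sub>n\<close> around \<open>\<rho>\<^sub>0 \<ge> c\<^sub>0 > 0\<close>, the expectation of \<open>1 / r\<close> is at most \<open>exp (2 x / c\<^sub>0)\<close>,
  so that the denominator contributes \<open>exp (\<kappa> x)\<close> with \<open>\<kappa> = 2 / c\<^sub>0 + L\<^sub>1\<close>.

  \<^bold>\<open>Numerator.\<close> Since \<open>E r(\<rho>) \<le> 1\<close>, the complement of the sieve contributes at most its prior
  mass. On the sieve tests are used. For a centre \<open>\<rho>'\<close> of the \<open>L\<^sup>1\<close> cover put
  \<open>s = sgn (\<rho>' - \<rho>\<^sub>0)\<close> and reject if \<open>\<Sum>k s(Z(X\<^sub>k)) - \<integral> s(Z) \<rho>\<^sub>0(Z)\<close> is large. Under \<open>\<rho>\<close> the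
  mean of this statistic is
  \<open>\<integral> s(Z) (\<rho> - \<rho>\<^sub>0)(Z) \<ge> \<integral> \<bar>\<rho> - \<rho>\<^sub>0\<bar>(Z) - 2 \<integral> \<bar>\<rho> - \<rho>'\<bar>(Z)\<close>, so one test serves a whole
  \<open>L\<^sup>1\<close> ball, and the exponential Chebyshev inequality with parameter \<open>\<epsilon>\<^sub>n\<close> makes both error
  probabilities exponentially small in \<open>x\<close>. A union over the cover costs a factor \<open>exp (L\<^sub>3 x)\<close>.

  \<^bold>\<open>Covariates.\<close> The integrals above run along the covariate path and have to be compared with
  integrals against \<open>\<nu>\<close>. The concentration hypothesis concerns one function at a time. That is enough:
  by Tonelli the expectation of \<open>r(\<rho>)\<close> times the indicator of acceptance is bounded for each
  \<open>\<rho>\<close> before integrating against the prior. The function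
  \<open>\<bar>\<rho> - \<rho>'\<bar>\<close> is replaced by the \<open>C\<^sup>1\<close> function \<open>\<surd>((\<rho> - \<rho>')\<^sup>2 + \<epsilon>\<^sub>n\<^sup>2)\<close>, which differs from it
  by at most \<open>\<epsilon>\<^sub>n\<close> and has a gradient bounded by that of \<open>\<rho> - \<rho>'\<close>
  (\<open>path_L1_dist_concentration\<close>).

  The bounds combine at fixed \<open>n\<close> in \<open>expected_posterior_le\<close>. The constants are chosen in the order
  \<open>\<kappa>\<close>, then the sieve with \<open>L\<^sub>2 = \<kappa> + 2\<close>, then the concentration constant for the resulting
  \<open>C\<^sup>1\<close> bound, and finally \<open>K\<close>.
\<close>

section \<open>Integrals over the observation window\<close>

lemma measure_window:
  assumes "n \<ge> 1"
  shows "measure lborel (window n :: (real ^ 'm) set) = real n"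
proof -
  let ?a = "real n powr (1 / real CARD('m))"
  have "?a > 0" using assms by simp
  then have ne: "(window n :: (real ^ 'm) set) \<noteq> {}"
    unfolding window_def by (simp add: interval_ne_empty_cart(1))
  have "measure lborel (window n :: (real ^ 'm) set) = ?a ^ CARD('m)"
    using ne unfolding window_def by (simp add: content_cbox_cart)
  also have "\<dots> = ?a powr real CARD('m)"
    using \<open>?a > 0\<close> by (simp add: powr_realpow)
  also have "\<dots> = real n" using assms by (simp add: powr_powr)
  finally show ?thesis .
qed

lemma window_sets [measurable]: "window n \<in> sets borel"
  unfolding window_def by simp

lemma emeasure_window_finite: "emeasure lborel (window n :: (real ^ 'm) set) < \<infinity>"
  unfolding window_def by (rule emeasure_lborel_cbox_finite)

lemma window_integrable:
  fixes f :: "real ^ 'm \<Rightarrow> real"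
  assumes [measurable]: "f \<in> borel_measurable borel" and b: "\<And>x. x \<in> window n \<Longrightarrow> \<bar>f x\<bar> \<le> B"
  shows "set_integrable lborel (window n) f"
  unfolding set_integrable_def
proof (rule Bochner_Integration.integrable_bound)
  show "integrable lborel (\<lambda>x::real^'m. indicator (window n) x * B)"
    using emeasure_window_finite[of n, where 'm='m] by (intro integrable_mult_left integrable_real_indicator) auto
  show "AE x in lborel. norm (indicator (window n) x *\<^sub>R f x) \<le> norm (indicator (window n) x * B)"
    using b by (intro AE_I2) (force simp: indicator_def)
qed simp

lemma window_integral_const:
  "n \<ge> 1 \<Longrightarrow> (LINT x:window n|lborel. c) = real n * c" for c :: real
  using measure_window[of n, where 'm='a] emeasure_window_finite[of n, where 'm='a]
  by (simp add: set_lebesgue_integral_def)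

lemma window_integral_mono:
  fixes f g :: "real ^ 'm \<Rightarrow> real"
  assumes "set_integrable lborel (window n) f" "set_integrable lborel (window n) g"
    "\<And>x. x \<in> window n \<Longrightarrow> f x \<le> g x"
  shows "(LINT x:window n|lborel. f x) \<le> (LINT x:window n|lborel. g x)"
  using assms unfolding set_lebesgue_integral_def set_integrable_def
  by (intro integral_mono) (auto simp: indicator_def)

section \<open>Generating functional of the point process\<close>

text \<open>Measurability of a kernel needs to be tested on a generator only. On a cylinder the power of
  \<open>\<kappa> \<omega>\<close> is a finite product of kernel values.\<close>

lemma measurable_PiM_kernel:
  assumes \<kappa>: "\<kappa> \<in> measurable M (prob_algebra N)"
  shows "(\<lambda>\<omega>. PiM UNIV (\<lambda>i. \<kappa> \<omega>)) \<in> measurable M (prob_algebra (PiM UNIV (\<lambda>i. N)))"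
proof (rule measurable_prob_algebra_generated)
  show "sets (PiM UNIV (\<lambda>i. N)) =
      sigma_sets (\<Pi>\<^sub>E i\<in>UNIV. space N) (prod_algebra UNIV (\<lambda>i. N))"
    by (rule sets_PiM)
  show "Int_stable (prod_algebra UNIV (\<lambda>i. N))" by (rule Int_stable_prod_algebra)
  show "prod_algebra UNIV (\<lambda>i. N) \<subseteq> Pow (\<Pi>\<^sub>E i\<in>UNIV. space N)"
    by (rule prod_algebra_sets_into_space)
next
  fix \<omega> assume \<omega>: "\<omega> \<in> space M"
  have K: "prob_space (\<kappa> \<omega>)" "sets (\<kappa> \<omega>) = sets N"
    using measurable_space[OF \<kappa> \<omega>] by (auto simp: space_prob_algebra)
  interpret prob_space "\<kappa> \<omega>" by (rule K)
  show "prob_space (PiM UNIV (\<lambda>i. \<kappa> \<omega>))" by (intro prob_space_PiM) unfold_locales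
  show "sets (PiM UNIV (\<lambda>i. \<kappa> \<omega>)) = sets (PiM UNIV (\<lambda>i. N))"
    by (intro sets_PiM_cong) (auto simp: K)
next
  fix A assume "A \<in> prod_algebra UNIV (\<lambda>i. N)"
  then obtain J E where A: "A = prod_emb UNIV (\<lambda>i. N) J (Pi\<^sub>E J E)" "finite J" "\<And>i. i \<in> J \<Longrightarrow> E i \<in> sets N"
    by (elim prod_algebraE) auto
  have "emeasure (PiM UNIV (\<lambda>i. \<kappa> \<omega>)) A = (\<Prod>i\<in>J. emeasure (\<kappa> \<omega>) (E i))" if \<omega>: "\<omega> \<in> space M" for \<omega>
  proof -
    have K: "prob_space (\<kappa> \<omega>)" "sets (\<kappa> \<omega>) = sets N"
      using measurable_space[OF \<kappa> \<omega>] by (auto simp: space_prob_algebra)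
    interpret prob_space "\<kappa> \<omega>" by (rule K)
    interpret product_prob_space "\<lambda>i. \<kappa> \<omega>" UNIV by unfold_locales
    have "A = prod_emb UNIV (\<lambda>i. \<kappa> \<omega>) J (Pi\<^sub>E J E)"
      using A(1) sets_eq_imp_space_eq[OF K(2)] by (simp add: prod_emb_def)
    then show ?thesis using A K by (simp add: emeasure_PiM_emb)
  qed
  moreover have "(\<lambda>\<omega>. \<Prod>i\<in>J. emeasure (\<kappa> \<omega>) (E i)) \<in> borel_measurable M"
    using A(3) measurable_prob_algebraD[OF \<kappa>]
    by (intro borel_measurable_prod_ennreal) (auto intro: measurable_emeasure_kernel)
  ultimately show "(\<lambda>\<omega>. emeasure (PiM UNIV (\<lambda>i. \<kappa> \<omega>)) A) \<in> borel_measurable M"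
    by (simp cong: measurable_cong)
qed

lemma poisson_law_kernel:
  assumes [measurable]: "r \<in> borel_measurable M" and r: "\<And>\<omega>. \<omega> \<in> space M \<Longrightarrow> r \<omega> > 0"
  shows "(\<lambda>\<omega>. poisson_law (r \<omega>)) \<in> measurable M (prob_algebra (count_space UNIV))"
proof (rule measurable_prob_algebra_generated)
  let ?G = "insert {} (range (\<lambda>k::nat. {k}))"
  show "sets (count_space UNIV) = sigma_sets UNIV ?G"
  proof -
    have "A \<in> sigma_sets UNIV ?G" for A :: "nat set"
    proof -
      have "(\<Union>k\<in>A. {k}) \<in> sigma_sets UNIV ?G"
        by (rule sigma_sets_UNION) (auto intro: sigma_sets.Basic)
      then show ?thesis by simp
    qed
    then show ?thesis by auto
  qed
  show "Int_stable ?G" by (auto simp: Int_stable_def)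
  show "?G \<subseteq> Pow UNIV" by simp
  show "prob_space (poisson_law (r \<omega>))" for \<omega>
    unfolding poisson_law_def by (rule measure_pmf.prob_space_axioms)
  show "sets (poisson_law (r \<omega>)) = sets (count_space UNIV)" for \<omega> by (simp add: poisson_law_def)
  fix A assume "A \<in> ?G"
  then consider "A = {}" | k where "A = {k}" by auto
  then show "(\<lambda>\<omega>. emeasure (poisson_law (r \<omega>)) A) \<in> borel_measurable M"
  proof cases
    case 2
    have "(\<lambda>\<omega>. ennreal (r \<omega> ^ k / fact k * exp (- r \<omega>))) \<in> borel_measurable M" by measurable
    moreover have "emeasure (poisson_law (r \<omega>)) A = ennreal (r \<omega> ^ k / fact k * exp (- r \<omega>))"
      if "\<omega> \<in> space M" for \<omega>
      using r[OF that] 2 by (simp add: poisson_law_def emeasure_pmf_single)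
    ultimately show ?thesis by (simp cong: measurable_cong)
  qed simp
qed

lemma point_law_eq:
  "total_intensity n \<rho> z > 0 \<Longrightarrow> point_law n \<rho> z =
    density lborel (\<lambda>x. ennreal (indicator (window n) x * \<rho> (z x) / total_intensity n \<rho> z))"
  by (simp add: point_law_def)

lemma nn_integral_window:
  fixes g :: "real ^ 'm \<Rightarrow> real"
  assumes "set_integrable lborel (window n) g" and "\<And>x. x \<in> window n \<Longrightarrow> 0 \<le> g x" "0 \<le> c"
  shows "(\<integral>\<^sup>+x. ennreal (indicator (window n) x * g x * c) \<partial>lborel) = ennreal ((LINT x:window n|lborel. g x) * c)"
proof -
  have *: "integrable lborel (\<lambda>x. indicator (window n) x * g x)"
    using assms(1) by (simp add: set_integrable_def)
  have "(\<integral>\<^sup>+x. ennreal (indicator (window n) x * g x * c) \<partial>lborel)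
      = ennreal (LINT x|lborel. indicator (window n) x * g x * c)"
    using assms by (intro nn_integral_eq_integral integrable_mult_left[OF *])
      (auto simp: indicator_def)
  then show ?thesis by (simp add: set_lebesgue_integral_def)
qed

lemma prob_space_point_law:
  assumes int: "set_integrable lborel (window n) (\<lambda>x. \<rho> (z x))" and "\<And>x. x \<in> window n \<Longrightarrow> 0 \<le> \<rho> (z x)"
    and [measurable]: "(\<lambda>x. \<rho> (z x)) \<in> borel_measurable borel"
    and pos: "total_intensity n \<rho> z > 0"
  shows "prob_space (point_law n \<rho> z)"
proof (rule prob_spaceI)
  have "emeasure (point_law n \<rho> z) (space (point_law n \<rho> z)) =
     (\<integral>\<^sup>+x. ennreal (indicator (window n) x * \<rho> (z x) / total_intensity n \<rho> z) \<partial>lborel)"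
    by (simp add: point_law_eq[OF pos] emeasure_density)
  also have "\<dots> = ennreal (total_intensity n \<rho> z * (1 / total_intensity n \<rho> z))"
    using nn_integral_window[OF int assms(2), of "1 / total_intensity n \<rho> z"] pos
    by (simp add: total_intensity_def)
  finally show "emeasure (point_law n \<rho> z) (space (point_law n \<rho> z)) = 1" using pos by simp
qed

text \<open>Only finitely many coordinates enter, so the infinite product measure may be replaced by its
  finite-dimensional marginal, for which Fubini applies.\<close>

lemma nn_integral_iid_prod:
  fixes \<mu> :: "'a measure" and h :: "'a \<Rightarrow> ennreal"
  assumes "prob_space \<mu>" and [measurable]: "h \<in> borel_measurable \<mu>"
  shows "(\<integral>\<^sup>+X. (\<Prod>k<K. h (X k)) \<partial>(\<Pi>\<^sub>M i\<in>(UNIV::nat set). \<mu>)) = (\<integral>\<^sup>+x. h x \<partial>\<mu>) ^ K"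
proof -
  interpret \<mu>: prob_space \<mu> by fact
  interpret product_prob_space "\<lambda>i. \<mu>" "UNIV :: nat set" by unfold_locales
  have "(\<integral>\<^sup>+X. (\<Prod>k<K. h (X k)) \<partial>PiM {..<K} (\<lambda>i. \<mu>)) = (\<integral>\<^sup>+x. h x \<partial>\<mu>) ^ K"
    by (subst product_nn_integral_prod) auto
  moreover have "(\<integral>\<^sup>+X. (\<Prod>k<K. h (X k)) \<partial>PiM {..<K} (\<lambda>i. \<mu>)) =
     (\<integral>\<^sup>+X. (\<Prod>k<K. h (X k)) \<partial>(\<Pi>\<^sub>M i\<in>(UNIV::nat set). \<mu>))"
    by (subst distr_PiM_restrict_finite[of "{..<K}", symmetric]) (auto simp: nn_integral_distr)
  ultimately show ?thesis by simp
qed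

text \<open>With \<open>\<Lambda>\<close> the total intensity and \<open>a = \<integral> \<rho>(z x) h(x) dx\<close>, a point has
  \<open>E h(X) = a / \<Lambda>\<close>, and averaging \<open>(a / \<Lambda>)^k\<close> over a Poisson variable of mean \<open>\<Lambda>\<close> gives
  \<open>exp (a - \<Lambda>)\<close>.\<close>

lemma poisson_process_generating_functional:
  fixes h :: "real ^ 'm \<Rightarrow> real" and z :: "real ^ 'm \<Rightarrow> real ^ 'd"
  assumes \<rho>[measurable]: "(\<lambda>x. \<rho> (z x)) \<in> borel_measurable borel"
    and \<rho>0: "\<And>x. 0 \<le> \<rho> (z x)" and \<rho>B: "\<And>x. \<rho> (z x) \<le> B"
    and pos: "total_intensity n \<rho> z > 0"
    and [measurable]: "h \<in> borel_measurable borel" and h0: "\<And>x. 0 \<le> h x" and hB: "\<And>x. h x \<le> H"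
  shows "(\<integral>\<^sup>+N. (\<Prod>k<fst N. ennreal (h (snd N k))) \<partial>poisson_process_law n \<rho> z)
     = ennreal (exp (LINT x:window n|lborel. \<rho> (z x) * (h x - 1)))"
proof -
  let ?\<Lambda> = "total_intensity n \<rho> z"
  define \<mu> where "\<mu> = point_law n \<rho> z"
  define a where "a = (LINT x:window n|lborel. \<rho> (z x) * h x)"
  have int1: "set_integrable lborel (window n) (\<lambda>x. \<rho> (z x))"
    by (rule window_integrable[where B=B]) (auto simp: \<rho>0 \<rho>B)
  have int2: "set_integrable lborel (window n) (\<lambda>x. \<rho> (z x) * h x)"
    by (rule window_integrable[where B="B*H"]) (auto simp: \<rho>0 \<rho>B h0 hB abs_mult intro!: mult_mono order_trans[OF \<rho>0 \<rho>B])
  have a0: "a \<ge> 0" unfolding a_def set_lebesgue_integral_def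
    by (intro integral_nonneg_AE AE_I2) (auto simp: \<rho>0 h0 indicator_def)
  interpret \<mu>: prob_space \<mu> unfolding \<mu>_def by (rule prob_space_point_law[OF int1 _ \<rho> pos]) (simp add: \<rho>0)
  have sets\<mu>[measurable_cong]: "sets \<mu> = sets borel" by (simp add: \<mu>_def point_law_eq[OF pos])
  have mean: "(\<integral>\<^sup>+x. ennreal (h x) \<partial>\<mu>) = ennreal (a / ?\<Lambda>)"
  proof -
    have "(\<integral>\<^sup>+x. ennreal (h x) \<partial>\<mu>) =
      (\<integral>\<^sup>+x. ennreal (indicator (window n) x * (\<rho> (z x) * h x) * (1 / ?\<Lambda>)) \<partial>lborel)"
      unfolding \<mu>_def point_law_eq[OF pos] using pos
      by (subst nn_integral_density)
        (auto intro!: nn_integral_cong simp: ennreal_mult[symmetric] \<rho>0 h0 indicator_def)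
    also have "\<dots> = ennreal (a * (1 / ?\<Lambda>))"
      unfolding a_def using pos by (intro nn_integral_window int2) (auto simp: \<rho>0 h0)
    finally show ?thesis by simp
  qed
  have h\<mu>: "(\<lambda>x. ennreal (h x)) \<in> borel_measurable \<mu>" by measurable
  have PP: "poisson_process_law n \<rho> z = measure_pmf (poisson_pmf ?\<Lambda>) \<Otimes>\<^sub>M (\<Pi>\<^sub>M i\<in>UNIV. \<mu>)"
    using pos by (simp add: poisson_process_law_def poisson_law_def \<mu>_def)
  interpret Q: prob_space "\<Pi>\<^sub>M i\<in>(UNIV::nat set). \<mu>" by (intro prob_space_PiM) unfold_locales
  have [measurable]: "(\<lambda>N. \<Prod>k<fst N. ennreal (h (snd N k))) \<in>
     borel_measurable (measure_pmf (poisson_pmf ?\<Lambda>) \<Otimes>\<^sub>M (\<Pi>\<^sub>M i\<in>UNIV. \<mu>))"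
    by (rule measurable_compose_countable[where f="\<lambda>j N. \<Prod>k<j. ennreal (h (snd N k))" and g=fst])
       measurable
  have "(\<integral>\<^sup>+N. (\<Prod>k<fst N. ennreal (h (snd N k))) \<partial>poisson_process_law n \<rho> z)
     = (\<integral>\<^sup>+K. \<integral>\<^sup>+X. (\<Prod>k<K. ennreal (h (X k))) \<partial>(\<Pi>\<^sub>M i\<in>UNIV. \<mu>) \<partial>measure_pmf (poisson_pmf ?\<Lambda>))"
    unfolding PP by (subst Q.nn_integral_fst[symmetric]) simp_all
  also have "\<dots> = (\<integral>\<^sup>+K. ennreal (a / ?\<Lambda>) ^ K \<partial>measure_pmf (poisson_pmf ?\<Lambda>))"
    by (intro nn_integral_cong) (simp add: nn_integral_iid_prod[OF \<mu>.prob_space_axioms h\<mu>] mean)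
  also have "\<dots> = (\<Sum>K. ennreal (exp (- ?\<Lambda>) * (a ^ K / fact K)))"
    unfolding nn_integral_measure_pmf using pos a0
    by (subst nn_integral_count_space_nat)
       (auto intro!: suminf_cong simp: ennreal_power ennreal_mult[symmetric] power_divide field_simps)
  also have "\<dots> = ennreal (exp (- ?\<Lambda>) * exp a)"
  proof (rule suminf_ennreal_eq)
    show "(\<lambda>K. exp (- ?\<Lambda>) * (a ^ K / fact K)) sums (exp (- ?\<Lambda>) * exp a)"
      using exp_converges[of a] by (intro sums_mult) (simp add: divide_inverse mult.commute)
  qed (use a0 in auto)
  also have "exp (- ?\<Lambda>) * exp a = exp (LINT x:window n|lborel. \<rho> (z x) * (h x - 1))"
    using set_integral_diff(2)[OF int2 int1]
    by (simp add: exp_add[symmetric] a_def total_intensity_def right_diff_distrib)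
  finally show ?thesis .
qed

section \<open>Intensity functions and their evaluation\<close>

text \<open>Intensities are only meaningful on the cube. Composing with the retraction \<open>clamp 0 1\<close> makes them
  continuous on the whole space, and it changes nothing along covariate paths, which stay in the cube.\<close>

lemma clamp_cube [simp]: "clamp 0 1 z \<in> (unit_cube :: (real ^ 'd) set)"
  by (rule clamp_in_interval) (auto simp: Basis_vec_def inner_axis)

lemma clamp_cube_cancel [simp]: "z \<in> unit_cube \<Longrightarrow> clamp 0 1 z = (z :: real ^ 'd)"
  by (rule clamp_cancel_cbox)

lemma C1_intensities_continuous: "\<rho> \<in> C1_intensities \<Longrightarrow> continuous_on unit_cube \<rho>"
  unfolding C1_intensities_def C1_cube_def
  by (auto simp: continuous_on_eq_continuous_within intro: differentiable_imp_continuous_within)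

lemma C1_intensities_nonneg: "\<rho> \<in> C1_intensities \<Longrightarrow> z \<in> unit_cube \<Longrightarrow> 0 \<le> \<rho> z"
  unfolding C1_intensities_def intensities_def by auto

lemma C1_intensities_bounded: "\<rho> \<in> C1_intensities \<Longrightarrow> bounded (\<rho> ` unit_cube)"
  unfolding C1_intensities_def intensities_def by auto

lemma continuous_on_clamp_cube:
  fixes f :: "real ^ 'd \<Rightarrow> real"
  assumes "continuous_on unit_cube f"
  shows "continuous_on UNIV (\<lambda>z. f (clamp 0 1 z))"
  using clamp_continuous_on[OF assms] by simp

lemma C1_intensities_measurable:
  fixes \<rho> :: "real ^ 'd \<Rightarrow> real"
  assumes "\<rho> \<in> C1_intensities"
  shows "\<rho> \<in> borel_measurable borel"
proof -
  have [measurable]: "(\<lambda>z. \<rho> (clamp 0 1 z)) \<in> borel_measurable borel"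
    using continuous_on_clamp_cube[OF C1_intensities_continuous[OF assms]]
    by (rule borel_measurable_continuous_onI)
  have "\<rho> = (\<lambda>z. if z \<in> unit_cube then \<rho> (clamp 0 1 z) else undefined)"
    using assms by (auto simp: C1_intensities_def intensities_def PiE_def extensional_def fun_eq_iff)
  also have "\<dots> \<in> borel_measurable borel" by measurable
  finally show ?thesis .
qed

lemma space_intensity_borel: "space intensity_borel = C1_intensities"
  unfolding intensity_borel_def by (rule space_measure_of) auto

lemma C1_intensities_bdd_above_diff:
  assumes "f \<in> C1_intensities" "g \<in> C1_intensities"
  shows "bdd_above ((\<lambda>z. \<bar>g z - f z\<bar>) ` unit_cube)"
proof -
  obtain a b where "\<And>z. z \<in> unit_cube \<Longrightarrow> \<bar>f z\<bar> \<le> a" "\<And>z. z \<in> unit_cube \<Longrightarrow> \<bar>g z\<bar> \<le> b"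
    using C1_intensities_bounded[OF assms(1)] C1_intensities_bounded[OF assms(2)]
    by (auto simp: bounded_iff)
  then show ?thesis by (intro bdd_aboveI2[where M="a+b"]) (smt (verit))
qed

text \<open>Evaluation at a point is continuous for the supremum distance.\<close>

lemma evaluation_measurable:
  fixes q :: "real ^ 'd"
  assumes q: "q \<in> unit_cube"
  shows "(\<lambda>\<rho>. \<rho> q) \<in> borel_measurable intensity_borel"
proof (rule borel_measurableI)
  fix S :: "real set" assume S: "open S"
  let ?U = "{\<rho> \<in> C1_intensities. \<rho> q \<in> S}"
  let ?G = "{U. U \<subseteq> C1_intensities \<and>
         (\<forall>f\<in>U. \<exists>e>0. \<forall>g\<in>C1_intensities. (SUP z\<in>unit_cube. \<bar>g z - f z\<bar>) < e \<longrightarrow> g \<in> U)}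
       :: (real ^ 'd \<Rightarrow> real) set set"
  have "\<exists>e>0. \<forall>g\<in>C1_intensities. (SUP z\<in>unit_cube. \<bar>g z - f z\<bar>) < e \<longrightarrow> g \<in> ?U" if f: "f \<in> ?U" for f
  proof -
    obtain e where e: "e > 0" "\<And>y. dist y (f q) < e \<Longrightarrow> y \<in> S" using S f by (auto simp: open_dist)
    have "\<bar>g q - f q\<bar> \<le> (SUP z\<in>unit_cube. \<bar>g z - f z\<bar>)" if "g \<in> C1_intensities" for g
      using C1_intensities_bdd_above_diff[of f g] f that q by (intro cSUP_upper) auto
    then show ?thesis using e f
      by (intro exI[of _ e]) (auto simp: dist_real_def intro: le_less_trans)
  qed
  then have "?U \<in> ?G" by blast
  then have "?U \<in> sets intensity_borel" unfolding intensity_borel_def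
    by (subst sets_measure_of) auto
  then show "(\<lambda>\<rho>. \<rho> q) -` S \<inter> space intensity_borel \<in> sets intensity_borel"
    by (simp add: space_intensity_borel vimage_def Int_def conj_commute)
qed

text \<open>A map that is measurable in \<open>\<rho>\<close> and continuous in \<open>z\<close> is jointly measurable: approximate
  \<open>z\<close> by simple functions, for each of which only finitely many evaluation functionals occur.\<close>

lemma joint_evaluation_measurable:
  "(\<lambda>(\<rho>, z :: real ^ 'd). \<rho> (clamp 0 1 z)) \<in> borel_measurable (intensity_borel \<Otimes>\<^sub>M borel)"
proof -
  obtain F :: "nat \<Rightarrow> real ^ 'd \<Rightarrow> real ^ 'd" where F: "\<And>i. simple_function borel (F i)"
      "\<And>x. (\<lambda>i. F i x) \<longlonglongrightarrow> x"
    using borel_measurable_implies_sequence_metric[of "\<lambda>x. x" "borel :: (real ^ 'd) measure" 0] by auto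
  have "(\<lambda>p. fst p (clamp 0 1 (F i (snd p)))) \<in> borel_measurable (intensity_borel \<Otimes>\<^sub>M borel)" for i
  proof (rule measurable_compose_countable'[where f="\<lambda>q p. fst p (clamp 0 1 q)" and g="\<lambda>p. F i (snd p)" and I="range (F i)"])
    show "countable (range (F i))" using simple_functionD(1)[OF F(1)[of i]] by (simp add: countable_finite)
    show "(\<lambda>p. F i (snd p)) \<in> intensity_borel \<Otimes>\<^sub>M borel \<rightarrow>\<^sub>M count_space (range (F i))"
      using simple_functionD[OF F(1)[of i]]
      by (intro measurable_compose[OF measurable_snd]) (auto simp: measurable_count_space_eq2)
    show "(\<lambda>p. fst p (clamp 0 1 q)) \<in> borel_measurable (intensity_borel \<Otimes>\<^sub>M borel)" for q :: "real ^ 'd"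
      by (rule measurable_compose[OF measurable_fst evaluation_measurable]) simp
  qed
  moreover have "(\<lambda>i. fst p (clamp 0 1 (F i (snd p)))) \<longlonglongrightarrow> fst p (clamp 0 1 (snd p))"
    if "p \<in> space (intensity_borel \<Otimes>\<^sub>M (borel :: (real ^ 'd) measure))" for p
  proof -
    have "fst p \<in> C1_intensities" using that by (auto simp: space_pair_measure space_intensity_borel)
    from continuous_on_clamp_cube[OF C1_intensities_continuous[OF this]]
    have "isCont (\<lambda>z. fst p (clamp 0 1 z)) (snd p)" by (simp add: continuous_on_eq_continuous_at)
    then show ?thesis using F(2) by (rule isCont_tendsto_compose)
  qed
  ultimately have "(\<lambda>p. fst p (clamp 0 1 (snd p))) \<in> borel_measurable (intensity_borel \<Otimes>\<^sub>M (borel :: (real ^ 'd) measure))"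
    by (rule borel_measurable_LIMSEQ_real[where u="\<lambda>i p. fst p (clamp 0 1 (F i (snd p)))", rotated])
  then show ?thesis by (simp add: case_prod_unfold)
qed

lemma evaluation_measurable_compose [measurable]:
  fixes u :: "'a \<Rightarrow> real ^ 'd"
  assumes "r \<in> measurable A intensity_borel" "u \<in> borel_measurable A"
  shows "(\<lambda>a. r a (clamp 0 1 (u a))) \<in> borel_measurable A"
  using measurable_compose[OF measurable_Pair[OF assms] joint_evaluation_measurable] by simp

section \<open>Pointwise bounds on the posterior\<close>

lemma posterior_le_1: "posterior P n N z A \<le> 1"
proof -
  define u where "u = (\<integral>\<^sup>+\<rho>\<in>A. ennreal (likelihood n N z \<rho>) \<partial>P)"
  define d where "d = (\<integral>\<^sup>+\<rho>. ennreal (likelihood n N z \<rho>) \<partial>P)"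
  have "u \<le> d" unfolding u_def d_def by (intro nn_integral_mono) (auto simp: indicator_def)
  then have "u / d \<le> 1"
  proof (cases "d = 0 \<or> d = top")
    case True
    then show ?thesis using \<open>u \<le> d\<close> by (auto simp: ennreal_divide_top)
  next
    case False
    then have "u / d \<le> d / d" using \<open>u \<le> d\<close> by (intro divide_right_mono_ennreal)
    then show ?thesis using False by (simp add: ennreal_divide_self top.not_eq_extremum)
  qed
  then show ?thesis by (simp add: posterior_def u_def d_def)
qed

text \<open>Any positive common factor \<open>l0\<close> cancels; taking it to be the likelihood of the true intensity makes
  \<open>r\<close> the likelihood ratio. The free parameter \<open>t\<close> balances numerator and denominator. Cauchy-Schwarz on
  \<open>B\<close>, applied to \<open>\<surd>r\<close> and \<open>1 / \<surd>r\<close>, replaces the reciprocal of the denominator by an integral, whose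
  expectation can be computed.\<close>

lemma posterior_le_weighted:
  fixes P :: "(real ^ 'd \<Rightarrow> real) measure" and z :: "real ^ 'm \<Rightarrow> real ^ 'd"
  assumes "prob_space P" and [measurable]: "r \<in> borel_measurable P" and [measurable]: "A \<in> sets P" "B \<in> sets P"
    and lik: "\<And>\<rho>. \<rho> \<in> space P \<Longrightarrow> likelihood n N z \<rho> = l0 * r \<rho>" and l0: "l0 > 0"
    and r0: "\<And>\<rho>. \<rho> \<in> space P \<Longrightarrow> 0 \<le> r \<rho>" and rB: "\<And>\<rho>. \<rho> \<in> B \<Longrightarrow> 0 < r \<rho>"
    and mB: "measure P B > 0" and t: "t > 0"
  shows "posterior P n N z A \<le> ennreal (t / 2) * (\<integral>\<^sup>+\<rho>\<in>A. ennreal (r \<rho>) \<partial>P)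
     + ennreal (1 / (2 * t * (measure P B)\<^sup>2)) * (\<integral>\<^sup>+\<rho>\<in>B. ennreal (1 / r \<rho>) \<partial>P)"
proof -
  interpret prob_space P by fact
  define u d q where "u = (\<integral>\<^sup>+\<rho>\<in>A. ennreal (r \<rho>) \<partial>P)" and "d = (\<integral>\<^sup>+\<rho>. ennreal (r \<rho>) \<partial>P)"
    and "q = (\<integral>\<^sup>+\<rho>\<in>B. ennreal (1 / r \<rho>) \<partial>P)"
  have num: "(\<integral>\<^sup>+\<rho>\<in>A. ennreal (likelihood n N z \<rho>) \<partial>P) = ennreal l0 * u"
    unfolding u_def using l0 r0
    by (subst nn_integral_cmult[symmetric]) (auto intro!: nn_integral_cong simp: lik ennreal_mult mult.assoc)
  have den: "(\<integral>\<^sup>+\<rho>. ennreal (likelihood n N z \<rho>) \<partial>P) = ennreal l0 * d"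
    unfolding d_def using l0 r0
    by (subst nn_integral_cmult[symmetric]) (auto intro!: nn_integral_cong simp: lik ennreal_mult)
  have post: "posterior P n N z A = (ennreal l0 * u) / (ennreal l0 * d)"
    by (simp add: posterior_def num den)
  have ud: "u \<le> d" unfolding u_def d_def by (intro nn_integral_mono) (auto simp: indicator_def)
  have CS: "(emeasure P B)\<^sup>2 \<le> d * q"
  proof -
    have "emeasure P B = (\<integral>\<^sup>+\<rho>. (ennreal (sqrt (r \<rho>)) * indicator B \<rho>) * (ennreal (sqrt (1 / r \<rho>)) * indicator B \<rho>) \<partial>P)"
    proof -
      have "(\<integral>\<^sup>+\<rho>. (ennreal (sqrt (r \<rho>)) * indicator B \<rho>) * (ennreal (sqrt (1 / r \<rho>)) * indicator B \<rho>) \<partial>P)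
          = (\<integral>\<^sup>+\<rho>. indicator B \<rho> \<partial>P)"
      proof (rule nn_integral_cong)
        fix \<rho>
        show "(ennreal (sqrt (r \<rho>)) * indicator B \<rho>) * (ennreal (sqrt (1 / r \<rho>)) * indicator B \<rho>) = (indicator B \<rho> :: ennreal)"
          using rB[of \<rho>] by (cases "\<rho> \<in> B") (simp_all add: ennreal_mult[symmetric] real_sqrt_mult[symmetric])
      qed
      then show ?thesis by simp
    qed
    also have "\<dots>\<^sup>2 \<le> (\<integral>\<^sup>+\<rho>. (ennreal (sqrt (r \<rho>)) * indicator B \<rho>)\<^sup>2 \<partial>P) * (\<integral>\<^sup>+\<rho>. (ennreal (sqrt (1 / r \<rho>)) * indicator B \<rho>)\<^sup>2 \<partial>P)"
      by (rule Cauchy_Schwarz_nn_integral) measurable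
    also have "\<dots> \<le> d * q" unfolding d_def q_def
      using r0 sets.sets_into_space[of B P] rB
      by (intro mult_mono nn_integral_mono) 
        (auto simp: indicator_def ennreal_power real_sqrt_pow2)
    finally show ?thesis .
  qed
  let ?m = "measure P B"
  show ?thesis
  proof (cases "d = \<infinity> \<or> q = \<infinity>")
    case True
    then show ?thesis
    proof (cases "q = \<infinity>")
      case True
      have "0 < 1 / (2 * t * ?m\<^sup>2)" using mB t by simp
      have "ennreal (1 / (2 * t * ?m\<^sup>2)) * \<infinity> = \<infinity>"
        using mB t by (simp add: ennreal_mult_top)
      then have "ennreal (1 / (2 * t * ?m\<^sup>2)) * q = top"
        using True by (simp only: infinity_ennreal_def)
      then show ?thesis unfolding q_def[symmetric] by (simp only: add_top_right_ennreal ennreal_add_eq_top top_greatest simp_thms)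
    next
      case False
      then have "d = \<infinity>" using True by simp
      then have "posterior P n N z A = 0" unfolding post using l0
        by (simp add: ennreal_mult_top)
      then show ?thesis by simp
    qed
  next
    case False
    then obtain d' where d': "d = ennreal d'" "d' \<ge> 0" by (cases d) auto
    obtain q' where q': "q = ennreal q'" "q' \<ge> 0" using False by (cases q) auto
    obtain u' where u': "u = ennreal u'" "u' \<ge> 0" using ud d' by (cases u) (auto simp: top_unique)
    have m: "?m\<^sup>2 \<le> d' * q'" using CS d' q'
      by (simp add: emeasure_eq_measure ennreal_power ennreal_mult[symmetric])
    have "d' > 0" using m mB d' by (cases "d' = 0") auto
    have ud': "u' \<le> d'" using ud u' d' by simp
    have p: "posterior P n N z A = ennreal (u' / d')"
      unfolding post u' d' using \<open>d' > 0\<close> l0 u'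
      by (simp add: ennreal_mult[symmetric] divide_ennreal)
    have "(1 / d') \<le> q' / ?m\<^sup>2" using m mB \<open>d' > 0\<close> by (simp add: field_simps)
    then have "1 / t * (1 / d') \<le> 1 / t * (q' / ?m\<^sup>2)" using t by (intro mult_left_mono) auto
    moreover have "2 * (u' / d') \<le> t * u' + 1 / (t * d')"
    proof -
      have "(t * u' + 1 / (t * d'))\<^sup>2 - (2 * (u' / d'))\<^sup>2 = (t * u' - 1 / (t * d'))\<^sup>2 + 4 * (u' / d') * (1 - u' / d')"
        using t \<open>d' > 0\<close> by (simp add: field_simps power2_eq_square)
      moreover have "u' / d' \<le> 1" "u' / d' \<ge> 0" using ud' \<open>d' > 0\<close> u' by auto
      ultimately have "(2 * (u' / d'))\<^sup>2 \<le> (t * u' + 1 / (t * d'))\<^sup>2"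
        by (smt (verit) mult_nonneg_nonneg zero_le_power2)
      then show ?thesis using t \<open>d' > 0\<close> u' by (auto elim!: power2_le_imp_le)
    qed
    moreover have "1 / (t * d') = 1 / t * (1 / d')" "1 / (2 * t) * (q' / ?m\<^sup>2) = (1 / t * (q' / ?m\<^sup>2)) / 2"
      by simp_all
    ultimately have "u' / d' \<le> t / 2 * u' + (1 / (2 * t)) * (q' / ?m\<^sup>2)"
      by linarith
    then show ?thesis unfolding p u_def[symmetric] q_def[symmetric] u' q' using t mB u' q'
      by (simp add: ennreal_mult[symmetric] ennreal_plus[symmetric] del: ennreal_plus)
  qed
qed

section \<open>The joint law of points and covariates\<close>

text \<open>The density of the law under \<open>\<rho>\<close> with respect to the law under \<open>\<rho>\<^sub>0\<close>, as opposed to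
  \<open>likelihood\<close>, where the reference intensity is \<open>1\<close>.\<close>

definition likelihood_ratio ::
  "nat \<Rightarrow> (real ^ 'd \<Rightarrow> real) \<Rightarrow> 'm points \<Rightarrow> (real ^ 'm \<Rightarrow> real ^ 'd) \<Rightarrow> (real ^ 'd \<Rightarrow> real) \<Rightarrow> real" where
  "likelihood_ratio n \<rho>\<^sub>0 N z \<rho> = (\<Prod>k<fst N. \<rho> (z (snd N k)) / \<rho>\<^sub>0 (z (snd N k))) *
     exp (- (LINT x:window n|lborel. (\<rho> (z x) - \<rho>\<^sub>0 (z x))))"

locale cox_model = prob_space M for M :: "'w measure" +
  fixes Z :: "'w \<Rightarrow> real ^ 'm \<Rightarrow> real ^ 'd" and n :: nat and \<rho>\<^sub>0 :: "real ^ 'd \<Rightarrow> real" and c\<^sub>0 B\<^sub>0 :: real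
  assumes Z_joint: "(\<lambda>(\<omega>, x). Z \<omega> x) \<in> borel_measurable (M \<Otimes>\<^sub>M borel)"
    and Z_cube: "\<And>\<omega> x. \<omega> \<in> space M \<Longrightarrow> Z \<omega> x \<in> unit_cube"
    and n_pos: "n \<ge> 1"
    and \<rho>\<^sub>0_C1: "\<rho>\<^sub>0 \<in> C1_intensities"
    and c\<^sub>0_pos: "0 < c\<^sub>0"
    and \<rho>\<^sub>0_lower: "\<And>z. z \<in> unit_cube \<Longrightarrow> c\<^sub>0 \<le> \<rho>\<^sub>0 z"
    and \<rho>\<^sub>0_upper: "\<And>z. z \<in> unit_cube \<Longrightarrow> \<rho>\<^sub>0 z \<le> B\<^sub>0"
begin

lemma Z_joint_compose [measurable (raw)]:
  assumes "f \<in> measurable A M" "u \<in> borel_measurable A"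
  shows "(\<lambda>a. Z (f a) (u a)) \<in> borel_measurable A"
  using measurable_compose[OF measurable_Pair[OF assms] Z_joint] by simp

lemma Z_path [measurable]: "\<omega> \<in> space M \<Longrightarrow> Z \<omega> \<in> borel_measurable borel"
  using Z_joint_compose[of "\<lambda>_. \<omega>" borel "\<lambda>x. x"] by simp

lemma \<rho>\<^sub>0_measurable [measurable]: "\<rho>\<^sub>0 \<in> borel_measurable borel"
  by (rule C1_intensities_measurable[OF \<rho>\<^sub>0_C1])

lemma path_integrable:
  fixes g :: "real ^ 'd \<Rightarrow> real"
  assumes "\<omega> \<in> space M" "g \<in> borel_measurable borel" "\<And>z. z \<in> unit_cube \<Longrightarrow> \<bar>g z\<bar> \<le> B"
  shows "set_integrable lborel (window n) (\<lambda>x. g (Z \<omega> x))"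
  by (rule window_integrable[where B=B]) 
    (use assms Z_cube measurable_compose[OF Z_path[OF assms(1)] assms(2)] in auto)

lemma \<rho>\<^sub>0_path_integrable: "\<omega> \<in> space M \<Longrightarrow> set_integrable lborel (window n) (\<lambda>x. \<rho>\<^sub>0 (Z \<omega> x))"
proof (rule path_integrable[where B=B\<^sub>0])
  fix z :: "real ^ 'd" assume "z \<in> unit_cube"
  then show "\<bar>\<rho>\<^sub>0 z\<bar> \<le> B\<^sub>0" using \<rho>\<^sub>0_lower[of z] \<rho>\<^sub>0_upper[of z] c\<^sub>0_pos by linarith
qed auto

lemma total_intensity_pos: "\<omega> \<in> space M \<Longrightarrow> 0 < total_intensity n \<rho>\<^sub>0 (Z \<omega>)"
proof -
  assume \<omega>: "\<omega> \<in> space M"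
  have "(LINT x:(window n :: (real ^ 'm) set)|lborel. c\<^sub>0) \<le> (LINT x:window n|lborel. \<rho>\<^sub>0 (Z \<omega> x))"
    using \<omega> by (intro window_integral_mono \<rho>\<^sub>0_path_integrable window_integrable[where B=c\<^sub>0])
     (auto intro!: \<rho>\<^sub>0_lower Z_cube simp: c\<^sub>0_pos less_imp_le)
  moreover have "0 < real n * c\<^sub>0" using n_pos c\<^sub>0_pos by simp
  ultimately show ?thesis by (simp add: window_integral_const[OF n_pos] total_intensity_def)
qed

lemma generating_functional:
  assumes \<omega>: "\<omega> \<in> space M" and g[measurable]: "g \<in> borel_measurable borel"
    and g0: "\<And>z. z \<in> unit_cube \<Longrightarrow> 0 \<le> g z" and gH: "\<And>z. z \<in> unit_cube \<Longrightarrow> g z \<le> H"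
  shows "(\<integral>\<^sup>+N. ennreal (\<Prod>k<fst N. g (Z \<omega> (snd N k))) \<partial>poisson_process_law n \<rho>\<^sub>0 (Z \<omega>))
     = ennreal (exp (LINT x:window n|lborel. \<rho>\<^sub>0 (Z \<omega> x) * (g (Z \<omega> x) - 1)))"
proof -
  have [measurable]: "Z \<omega> \<in> borel_measurable borel" by (rule Z_path[OF \<omega>])
  have "(\<integral>\<^sup>+N. (\<Prod>k<fst N. ennreal (g (Z \<omega> (snd N k)))) \<partial>poisson_process_law n \<rho>\<^sub>0 (Z \<omega>))
     = ennreal (exp (LINT x:window n|lborel. \<rho>\<^sub>0 (Z \<omega> x) * (g (Z \<omega> x) - 1)))"
    using Z_cube[OF \<omega>] g0 gH \<rho>\<^sub>0_lower \<rho>\<^sub>0_upper c\<^sub>0_pos total_intensity_pos[OF \<omega>]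
    by (intro poisson_process_generating_functional[where B=B\<^sub>0 and H=H])
      (auto intro: order_trans less_imp_le)
  then show ?thesis using g0 Z_cube[OF \<omega>] by (simp add: prod_ennreal)
qed

text \<open>Without this measurability the monadic bind defining the joint law would carry no information.\<close>

lemma observation_kernel:
  "(\<lambda>\<omega>. distr (poisson_process_law n \<rho>\<^sub>0 (Z \<omega>)) (points_space \<Otimes>\<^sub>M M) (\<lambda>N. (N, \<omega>)))
     \<in> measurable M (subprob_algebra (points_space \<Otimes>\<^sub>M M))"
proof (rule measurable_distr2)
  have tot[measurable]: "(\<lambda>\<omega>. total_intensity n \<rho>\<^sub>0 (Z \<omega>)) \<in> borel_measurable M"
    unfolding total_intensity_def set_lebesgue_integral_def by measurable
  have "(\<lambda>\<omega>. point_law n \<rho>\<^sub>0 (Z \<omega>)) \<in> measurable M (prob_algebra borel)"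
  proof (rule measurable_prob_algebraI)
    show prob: "prob_space (point_law n \<rho>\<^sub>0 (Z \<omega>))" if \<omega>: "\<omega> \<in> space M" for \<omega>
      using \<rho>\<^sub>0_path_integrable[OF \<omega>] Z_cube[OF \<omega>] \<rho>\<^sub>0_lower c\<^sub>0_pos total_intensity_pos[OF \<omega>] Z_path[OF \<omega>]
      by (intro prob_space_point_law) (auto intro: order_trans less_imp_le)
    show "(\<lambda>\<omega>. point_law n \<rho>\<^sub>0 (Z \<omega>)) \<in> measurable M (subprob_algebra borel)"
    proof (rule measurable_subprob_algebra)
      show "subprob_space (point_law n \<rho>\<^sub>0 (Z \<omega>))" if "\<omega> \<in> space M" for \<omega>
        by (rule prob_space_imp_subprob_space[OF prob[OF that]])
      show "sets (point_law n \<rho>\<^sub>0 (Z \<omega>)) = sets borel" if \<omega>: "\<omega> \<in> space M" for \<omega>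
        by (simp add: point_law_eq[OF total_intensity_pos[OF \<omega>]])
      fix A :: "(real ^ 'm) set" assume [measurable]: "A \<in> sets borel"
      have "(\<lambda>\<omega>. \<integral>\<^sup>+x. ennreal (indicator (window n) x * \<rho>\<^sub>0 (Z \<omega> x) / total_intensity n \<rho>\<^sub>0 (Z \<omega>)) * indicator A x \<partial>lborel)
         \<in> borel_measurable M" by measurable
      moreover have "emeasure (point_law n \<rho>\<^sub>0 (Z \<omega>)) A =
        (\<integral>\<^sup>+x. ennreal (indicator (window n) x * \<rho>\<^sub>0 (Z \<omega> x) / total_intensity n \<rho>\<^sub>0 (Z \<omega>)) * indicator A x \<partial>lborel)"
        if \<omega>: "\<omega> \<in> space M" for \<omega>
        unfolding point_law_eq[OF total_intensity_pos[OF \<omega>]] using Z_path[OF \<omega>]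
        by (subst emeasure_density) auto
      ultimately show "(\<lambda>\<omega>. emeasure (point_law n \<rho>\<^sub>0 (Z \<omega>)) A) \<in> borel_measurable M"
        by (simp cong: measurable_cong)
    qed
  qed
  then have "(\<lambda>\<omega>. poisson_process_law n \<rho>\<^sub>0 (Z \<omega>)) \<in> measurable M (prob_algebra points_space)"
    unfolding poisson_process_law_def
    by (intro measurable_pair_prob measurable_PiM_kernel poisson_law_kernel tot total_intensity_pos)
  then show "(\<lambda>\<omega>. poisson_process_law n \<rho>\<^sub>0 (Z \<omega>)) \<in> measurable M (subprob_algebra points_space)"
    by (rule measurable_prob_algebraD)
  show "(\<lambda>(\<omega>, N). (N, \<omega>)) \<in> M \<Otimes>\<^sub>M points_space \<rightarrow>\<^sub>M points_space \<Otimes>\<^sub>M M" by measurable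
qed

lemma sets_poisson_process_law:
  "\<omega> \<in> space M \<Longrightarrow> sets (poisson_process_law n \<rho>\<^sub>0 (Z \<omega>)) = sets points_space"
  unfolding poisson_process_law_def poisson_law_def
  by (intro sets_pair_measure_cong sets_PiM_cong) (auto simp: point_law_eq[OF total_intensity_pos])

lemma nn_integral_observation:
  assumes F[measurable]: "F \<in> borel_measurable (points_space \<Otimes>\<^sub>M M)"
  shows "(\<integral>\<^sup>+y. F y \<partial>observation_law M Z n \<rho>\<^sub>0) = (\<integral>\<^sup>+\<omega>. \<integral>\<^sup>+N. F (N, \<omega>) \<partial>poisson_process_law n \<rho>\<^sub>0 (Z \<omega>) \<partial>M)"
proof -
  have "(\<integral>\<^sup>+y. F y \<partial>observation_law M Z n \<rho>\<^sub>0) = (\<integral>\<^sup>+\<omega>. \<integral>\<^sup>+y. F y 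
       \<partial>distr (poisson_process_law n \<rho>\<^sub>0 (Z \<omega>)) (points_space \<Otimes>\<^sub>M M) (\<lambda>N. (N, \<omega>)) \<partial>M)"
    unfolding observation_law_def by (rule nn_integral_bind[OF F observation_kernel])
  also have "\<dots> = (\<integral>\<^sup>+\<omega>. \<integral>\<^sup>+N. F (N, \<omega>) \<partial>poisson_process_law n \<rho>\<^sub>0 (Z \<omega>) \<partial>M)"
  proof (rule nn_integral_cong)
    fix \<omega> assume \<omega>[measurable]: "\<omega> \<in> space M"
    note [measurable_cong] = sets_poisson_process_law[OF \<omega>]
    show "(\<integral>\<^sup>+y. F y \<partial>distr (poisson_process_law n \<rho>\<^sub>0 (Z \<omega>)) (points_space \<Otimes>\<^sub>M M) (\<lambda>N. (N, \<omega>)))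
      = (\<integral>\<^sup>+N. F (N, \<omega>) \<partial>poisson_process_law n \<rho>\<^sub>0 (Z \<omega>))"
      by (subst nn_integral_distr) auto
  qed
  finally show ?thesis .
qed

end

section \<open>Exponential moments of likelihood ratios and test statistics\<close>

lemma exp_le_quadratic:
  fixes u :: real
  assumes "\<bar>u\<bar> \<le> 1"
  shows "exp u \<le> 1 + u + u\<^sup>2"
proof (cases "u \<ge> 0")
  case True
  then show ?thesis using assms by (intro exp_bound) auto
next
  case False
  define v where "v = - u"
  have v: "0 \<le> v" "v \<le> 1" using False assms by (auto simp: v_def)
  have "0 \<le> v ^ 2 / 2 + v ^ 3 / 2 + v ^ 4 / 2" using v by simp
  also have "\<dots> = (1 - v + v\<^sup>2) * (1 + v + v\<^sup>2 / 2) - 1"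
    by (simp add: field_simps eval_nat_numeral)
  finally have "1 \<le> (1 - v + v\<^sup>2) * (1 + v + v\<^sup>2 / 2)" by simp
  also have "\<dots> \<le> (1 - v + v\<^sup>2) * exp v"
    using exp_lower_Taylor_quadratic[OF v(1)] v by (intro mult_left_mono) auto
  finally have "exp (- v) \<le> 1 - v + v\<^sup>2" by (simp add: exp_minus field_simps)
  then show ?thesis by (simp add: v_def)
qed

text \<open>The exponential of \<open>\<theta>\<close> times the centred statistic \<open>\<Sum>k s(z(X\<^sub>k)) - \<integral> s(z) \<rho>\<^sub>0(z)\<close>. Using the
  exponential itself as test statistic keeps the product form required by the generating functional.\<close>

definition exp_statistic ::
  "nat \<Rightarrow> (real ^ 'd \<Rightarrow> real) \<Rightarrow> (real ^ 'd \<Rightarrow> real) \<Rightarrow> real \<Rightarrow> 'm points \<Rightarrow> (real ^ 'm \<Rightarrow> real ^ 'd) \<Rightarrow> real" where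
  "exp_statistic n \<rho>\<^sub>0 s \<theta> N z = (\<Prod>k<fst N. exp (\<theta> * s (z (snd N k)))) *
     exp (- (LINT x:window n|lborel. \<theta> * s (z x) * \<rho>\<^sub>0 (z x)))"

lemma exp_statistic_pos: "0 < exp_statistic n \<rho>\<^sub>0 s \<theta> N z"
  unfolding exp_statistic_def by (intro mult_pos_pos prod_pos) auto

lemma exp_statistic_minus: "exp_statistic n \<rho>\<^sub>0 s (- \<theta>) N z * exp_statistic n \<rho>\<^sub>0 s \<theta> N z = 1"
proof -
  have "(\<Prod>k<fst N. exp (- \<theta> * s (z (snd N k)))) * (\<Prod>k<fst N. exp (\<theta> * s (z (snd N k)))) = 1"
    by (subst prod.distrib[symmetric]) (simp add: exp_add[symmetric])
  moreover have "(LINT x:window n|lborel. - \<theta> * s (z x) * \<rho>\<^sub>0 (z x)) = - (LINT x:window n|lborel. \<theta> * s (z x) * \<rho>\<^sub>0 (z x))"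
    by (simp add: set_lebesgue_integral_def)
  ultimately show ?thesis unfolding exp_statistic_def by (simp add: exp_minus field_simps)
qed

context cox_model begin

lemma \<rho>\<^sub>0_pos: "z \<in> unit_cube \<Longrightarrow> 0 < \<rho>\<^sub>0 z"
  using \<rho>\<^sub>0_lower[of z] c\<^sub>0_pos by linarith

text \<open>All exponential moments below are instances: \<open>g\<close> is the factor contributed by each point, \<open>b\<close> the
  compensator, and \<open>u\<close> dominates the resulting exponent \<open>\<rho>\<^sub>0 (g - 1) - b\<close> pointwise on the cube.\<close>

lemma tilted_expectation_le:
  assumes \<omega>: "\<omega> \<in> space M" and g[measurable]: "g \<in> borel_measurable borel"
    and g0: "\<And>z. z \<in> unit_cube \<Longrightarrow> 0 \<le> g z" and gH: "\<And>z. z \<in> unit_cube \<Longrightarrow> g z \<le> H"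
    and b[measurable]: "b \<in> borel_measurable borel" and bB: "\<And>z. z \<in> unit_cube \<Longrightarrow> \<bar>b z\<bar> \<le> C"
    and u[measurable]: "u \<in> borel_measurable borel" and uU: "\<And>z. z \<in> unit_cube \<Longrightarrow> \<bar>u z\<bar> \<le> U"
    and le: "\<And>z. z \<in> unit_cube \<Longrightarrow> \<rho>\<^sub>0 z * (g z - 1) - b z \<le> u z"
  shows "(\<integral>\<^sup>+N. ennreal ((\<Prod>k<fst N. g (Z \<omega> (snd N k))) * exp (- (LINT x:window n|lborel. b (Z \<omega> x))))
       \<partial>poisson_process_law n \<rho>\<^sub>0 (Z \<omega>)) \<le> ennreal (exp (LINT x:window n|lborel. u (Z \<omega> x)))"
proof -
  have b': "set_integrable lborel (window n) (\<lambda>x. b (Z \<omega> x))" by (rule path_integrable[OF \<omega> b bB])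
  have u': "set_integrable lborel (window n) (\<lambda>x. u (Z \<omega> x))" by (rule path_integrable[OF \<omega> u uU])
  have g': "set_integrable lborel (window n) (\<lambda>x. \<rho>\<^sub>0 (Z \<omega> x) * (g (Z \<omega> x) - 1))"
  proof (rule path_integrable[OF \<omega>, where g="\<lambda>z. \<rho>\<^sub>0 z * (g z - 1)" and B="B\<^sub>0 * (H + 1)"])
    fix z :: "real ^ 'd" assume z: "z \<in> unit_cube"
    show "\<bar>\<rho>\<^sub>0 z * (g z - 1)\<bar> \<le> B\<^sub>0 * (H + 1)" unfolding abs_mult
      using g0[OF z] gH[OF z] \<rho>\<^sub>0_pos[OF z] \<rho>\<^sub>0_upper[OF z] by (intro mult_mono) auto
  qed measurable
  have prod0: "0 \<le> (\<Prod>k<fst N. g (Z \<omega> (snd N k)))" for N :: "'m points"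
    using Z_cube[OF \<omega>] g0 by (intro prod_nonneg) auto
  have [measurable]: "Z \<omega> \<in> borel_measurable borel" by (rule Z_path[OF \<omega>])
  note [measurable_cong] = sets_poisson_process_law[OF \<omega>]
  have [measurable]: "(\<lambda>N. \<Prod>k<fst N. g (Z \<omega> (snd N k))) \<in> borel_measurable (poisson_process_law n \<rho>\<^sub>0 (Z \<omega>))"
    by (rule measurable_compose_countable[where f="\<lambda>j N. \<Prod>k<j. g (Z \<omega> (snd N k))" and g=fst]) measurable
  have "(\<integral>\<^sup>+N. ennreal ((\<Prod>k<fst N. g (Z \<omega> (snd N k))) * exp (- (LINT x:window n|lborel. b (Z \<omega> x))))
       \<partial>poisson_process_law n \<rho>\<^sub>0 (Z \<omega>)) = 
     (\<integral>\<^sup>+N. ennreal (\<Prod>k<fst N. g (Z \<omega> (snd N k))) \<partial>poisson_process_law n \<rho>\<^sub>0 (Z \<omega>)) *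
       ennreal (exp (- (LINT x:window n|lborel. b (Z \<omega> x))))"
    using prod0 by (simp add: ennreal_mult nn_integral_multc)
  also have "\<dots> = ennreal (exp ((LINT x:window n|lborel. \<rho>\<^sub>0 (Z \<omega> x) * (g (Z \<omega> x) - 1)) - (LINT x:window n|lborel. b (Z \<omega> x))))"
    by (subst generating_functional[OF \<omega> g g0 gH]) (simp_all add: ennreal_mult[symmetric] exp_add[symmetric])
  also have "(LINT x:window n|lborel. \<rho>\<^sub>0 (Z \<omega> x) * (g (Z \<omega> x) - 1)) - (LINT x:window n|lborel. b (Z \<omega> x))
     = (LINT x:window n|lborel. \<rho>\<^sub>0 (Z \<omega> x) * (g (Z \<omega> x) - 1) - b (Z \<omega> x))"
    by (rule set_integral_diff(2)[OF g' b', symmetric])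
  also have "ennreal (exp (LINT x:window n|lborel. \<rho>\<^sub>0 (Z \<omega> x) * (g (Z \<omega> x) - 1) - b (Z \<omega> x)))
    \<le> ennreal (exp (LINT x:window n|lborel. u (Z \<omega> x)))"
    by (intro ennreal_leI exp_le_cancel_iff[THEN iffD2] window_integral_mono set_integral_diff(1) g' b' u' le Z_cube \<omega>)
  finally show ?thesis .
qed

lemma C1_bound:
  assumes "\<rho> \<in> C1_intensities"
  obtains b where "\<And>z. z \<in> unit_cube \<Longrightarrow> \<rho> z \<le> b" "b > 0"
proof -
  obtain b where "\<And>z. z \<in> unit_cube \<Longrightarrow> \<bar>\<rho> z\<bar> \<le> b"
    using C1_intensities_bounded[OF assms] by (auto simp: bounded_iff)
  then have "\<rho> z \<le> \<bar>b\<bar> + 1" if "z \<in> unit_cube" for z using that by fastforce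
  then show ?thesis by (intro that[of "\<bar>b\<bar> + 1"]) auto
qed

lemma expected_likelihood_ratio:
  assumes \<omega>: "\<omega> \<in> space M" and \<rho>: "\<rho> \<in> C1_intensities"
  shows "(\<integral>\<^sup>+N. ennreal (likelihood_ratio n \<rho>\<^sub>0 N (Z \<omega>) \<rho>) \<partial>poisson_process_law n \<rho>\<^sub>0 (Z \<omega>)) \<le> 1"
proof -
  note [measurable] = C1_intensities_measurable[OF \<rho>]
  obtain b where b: "\<And>z. z \<in> unit_cube \<Longrightarrow> \<rho> z \<le> b" "b > 0" using C1_bound[OF \<rho>] by metis
  have "(\<integral>\<^sup>+N. ennreal (likelihood_ratio n \<rho>\<^sub>0 N (Z \<omega>) \<rho>) \<partial>poisson_process_law n \<rho>\<^sub>0 (Z \<omega>))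
     \<le> ennreal (exp (LINT x:window n|lborel. (\<lambda>_. 0) (Z \<omega> x)))"
    unfolding likelihood_ratio_def
  proof (rule tilted_expectation_le[OF \<omega>, where g="\<lambda>z. \<rho> z / \<rho>\<^sub>0 z" and H="b / c\<^sub>0" and b="\<lambda>z. \<rho> z - \<rho>\<^sub>0 z" and C="b + B\<^sub>0" and U=0])
    fix z :: "real ^ 'd" assume z: "z \<in> unit_cube"
    note f = C1_intensities_nonneg[OF \<rho> z] b(1)[OF z] b(2) \<rho>\<^sub>0_pos[OF z] \<rho>\<^sub>0_lower[OF z] \<rho>\<^sub>0_upper[OF z] c\<^sub>0_pos
    show "0 \<le> \<rho> z / \<rho>\<^sub>0 z" "\<bar>\<rho> z - \<rho>\<^sub>0 z\<bar> \<le> b + B\<^sub>0" using f by auto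
    show "\<rho> z / \<rho>\<^sub>0 z \<le> b / c\<^sub>0" using f by (intro frac_le) auto
    show "\<rho>\<^sub>0 z * (\<rho> z / \<rho>\<^sub>0 z - 1) - (\<rho> z - \<rho>\<^sub>0 z) \<le> 0" using f by (simp add: field_simps)
  qed auto
  then show ?thesis by simp
qed

text \<open>The exponent is \<open>\<integral> (\<rho> - \<rho>\<^sub>0)\<^sup>2 / \<rho>\<close>, a chi-square distance, and \<open>\<rho> \<ge> c\<^sub>0 / 2\<close> by
  closeness.\<close>

lemma expected_inverse_likelihood_ratio:
  assumes \<omega>: "\<omega> \<in> space M" and \<rho>: "\<rho> \<in> C1_intensities"
    and close: "\<And>z. z \<in> unit_cube \<Longrightarrow> \<bar>\<rho> z - \<rho>\<^sub>0 z\<bar> \<le> e" and e: "e \<le> c\<^sub>0 / 2"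
  shows "(\<integral>\<^sup>+N. ennreal (1 / likelihood_ratio n \<rho>\<^sub>0 N (Z \<omega>) \<rho>) \<partial>poisson_process_law n \<rho>\<^sub>0 (Z \<omega>))
     \<le> ennreal (exp (2 / c\<^sub>0 * (real n * e\<^sup>2)))"
proof -
  note [measurable] = C1_intensities_measurable[OF \<rho>]
  have "1 / likelihood_ratio n \<rho>\<^sub>0 N (Z \<omega>) \<rho> = (\<Prod>k<fst N. \<rho>\<^sub>0 (Z \<omega> (snd N k)) / \<rho> (Z \<omega> (snd N k))) *
     exp (- (LINT x:window n|lborel. (\<rho>\<^sub>0 (Z \<omega> x) - \<rho> (Z \<omega> x))))" for N
  proof -
    have "(LINT x:window n|lborel. (\<rho>\<^sub>0 (Z \<omega> x) - \<rho> (Z \<omega> x))) = - (LINT x:window n|lborel. (\<rho> (Z \<omega> x) - \<rho>\<^sub>0 (Z \<omega> x)))"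
      unfolding set_lebesgue_integral_def by (subst Bochner_Integration.integral_minus[symmetric]) (simp add: algebra_simps)
    then show ?thesis unfolding likelihood_ratio_def by (simp add: exp_minus prod_dividef field_simps)
  qed
  then have "(\<integral>\<^sup>+N. ennreal (1 / likelihood_ratio n \<rho>\<^sub>0 N (Z \<omega>) \<rho>) \<partial>poisson_process_law n \<rho>\<^sub>0 (Z \<omega>))
     = (\<integral>\<^sup>+N. ennreal ((\<Prod>k<fst N. \<rho>\<^sub>0 (Z \<omega> (snd N k)) / \<rho> (Z \<omega> (snd N k))) *
     exp (- (LINT x:window n|lborel. (\<rho>\<^sub>0 (Z \<omega> x) - \<rho> (Z \<omega> x))))) \<partial>poisson_process_law n \<rho>\<^sub>0 (Z \<omega>))"
    by simp
  also have "\<dots> \<le> ennreal (exp (LINT x:window n|lborel. (\<lambda>_. 2 * e\<^sup>2 / c\<^sub>0) (Z \<omega> x)))"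
  proof (rule tilted_expectation_le[OF \<omega>, where g="\<lambda>z. \<rho>\<^sub>0 z / \<rho> z" and H="B\<^sub>0 / (c\<^sub>0/2)" and b="\<lambda>z. \<rho>\<^sub>0 z - \<rho> z" and C="e" and U="2 * e\<^sup>2 / c\<^sub>0"])
    fix z :: "real ^ 'd" assume z: "z \<in> unit_cube"
    note f = close[OF z] \<rho>\<^sub>0_pos[OF z] \<rho>\<^sub>0_lower[OF z] \<rho>\<^sub>0_upper[OF z] c\<^sub>0_pos e
    have l: "c\<^sub>0 / 2 \<le> \<rho> z" using f by linarith
    show "0 \<le> \<rho>\<^sub>0 z / \<rho> z" "\<bar>\<rho>\<^sub>0 z - \<rho> z\<bar> \<le> e" using f l by auto
    show "\<rho>\<^sub>0 z / \<rho> z \<le> B\<^sub>0 / (c\<^sub>0/2)" using f l by (intro frac_le) auto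
    have "\<rho>\<^sub>0 z * (\<rho>\<^sub>0 z / \<rho> z - 1) - (\<rho>\<^sub>0 z - \<rho> z) = (\<rho> z - \<rho>\<^sub>0 z)\<^sup>2 / \<rho> z" using f l c\<^sub>0_pos by (simp add: field_simps power2_eq_square)
    also have "\<dots> \<le> e\<^sup>2 / (c\<^sub>0 / 2)" using f l c\<^sub>0_pos
      by (intro frac_le) (auto simp: power2_le_iff_abs_le)
    finally show "\<rho>\<^sub>0 z * (\<rho>\<^sub>0 z / \<rho> z - 1) - (\<rho>\<^sub>0 z - \<rho> z) \<le> 2 * e\<^sup>2 / c\<^sub>0" by (simp add: mult.commute)
  qed (use c\<^sub>0_pos in auto)
  also have "(LINT x:window n|lborel. (\<lambda>_. 2 * e\<^sup>2 / c\<^sub>0) (Z \<omega> x)) = 2 / c\<^sub>0 * (real n * e\<^sup>2)"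
    by (simp add: window_integral_const[OF n_pos])
  finally show ?thesis .
qed

text \<open>The linear term of \<open>exp (\<theta> s)\<close> is cancelled by the centring, which leaves a second-order term.\<close>

lemma expected_statistic_null:
  assumes \<omega>: "\<omega> \<in> space M" and s[measurable]: "s \<in> borel_measurable borel" and s1: "\<And>z. \<bar>s z\<bar> \<le> 1"
    and \<theta>: "0 \<le> \<theta>" "\<theta> \<le> 1"
  shows "(\<integral>\<^sup>+N. ennreal (exp_statistic n \<rho>\<^sub>0 s \<theta> N (Z \<omega>)) \<partial>poisson_process_law n \<rho>\<^sub>0 (Z \<omega>))
     \<le> ennreal (exp (B\<^sub>0 * (real n * \<theta>\<^sup>2)))"
proof -
  have B0: "0 \<le> B\<^sub>0" using \<rho>\<^sub>0_pos[of 0] \<rho>\<^sub>0_upper[of 0] by (auto simp: mem_box_cart)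
  have "(\<integral>\<^sup>+N. ennreal (exp_statistic n \<rho>\<^sub>0 s \<theta> N (Z \<omega>)) \<partial>poisson_process_law n \<rho>\<^sub>0 (Z \<omega>))
     \<le> ennreal (exp (LINT x:window n|lborel. (\<lambda>_. B\<^sub>0 * \<theta>\<^sup>2) (Z \<omega> x)))"
    unfolding exp_statistic_def
  proof (rule tilted_expectation_le[OF \<omega>, where g="\<lambda>z. exp (\<theta> * s z)" and H="exp 1" and b="\<lambda>z. \<theta> * s z * \<rho>\<^sub>0 z" and C="B\<^sub>0" and U="B\<^sub>0 * \<theta>\<^sup>2"])
    fix z :: "real ^ 'd" assume z: "z \<in> unit_cube"
    note f = \<rho>\<^sub>0_pos[OF z] \<rho>\<^sub>0_lower[OF z] \<rho>\<^sub>0_upper[OF z] s1[of z]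
    have \<theta>s: "\<bar>\<theta> * s z\<bar> \<le> 1" unfolding abs_mult using \<theta> s1[of z] by (intro mult_le_one) auto
    have s2: "(s z)\<^sup>2 \<le> 1" using s1[of z] by (simp add: abs_square_le_1)
    show "exp (\<theta> * s z) \<le> exp 1" using \<theta>s by simp
    have "\<bar>\<theta> * s z\<bar> * \<bar>\<rho>\<^sub>0 z\<bar> \<le> 1 * B\<^sub>0" using f \<theta>s by (intro mult_mono) auto
    then show "\<bar>\<theta> * s z * \<rho>\<^sub>0 z\<bar> \<le> B\<^sub>0" by (simp add: abs_mult)
    have "\<rho>\<^sub>0 z * (exp (\<theta> * s z) - 1) - \<theta> * s z * \<rho>\<^sub>0 z = \<rho>\<^sub>0 z * (exp (\<theta> * s z) - 1 - \<theta> * s z)" by (simp add: algebra_simps)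
    also have "\<dots> \<le> \<rho>\<^sub>0 z * (\<theta> * s z)\<^sup>2" using exp_le_quadratic[OF \<theta>s] f by (intro mult_left_mono) auto
    also have "\<dots> \<le> B\<^sub>0 * (\<theta>\<^sup>2 * 1)" unfolding power_mult_distrib using f B0 s2 by (intro mult_mono) auto
    finally show "\<rho>\<^sub>0 z * (exp (\<theta> * s z) - 1) - \<theta> * s z * \<rho>\<^sub>0 z \<le> B\<^sub>0 * \<theta>\<^sup>2" by simp
  qed (use B0 in auto)
  also have "(LINT x:window n|lborel. (\<lambda>_. B\<^sub>0 * \<theta>\<^sup>2) (Z \<omega> x)) = B\<^sub>0 * (real n * \<theta>\<^sup>2)"
    by (simp add: window_integral_const[OF n_pos])
  finally show ?thesis .
qed

text \<open>The integrand is \<open>r(\<rho>)\<close> times the reciprocal statistic, so this is the moment that controls the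
  probability of acceptance under \<open>\<rho>\<close>. The centring is that of \<open>\<rho>\<^sub>0\<close>, hence the drift
  \<open>- \<theta> s (\<rho> - \<rho>\<^sub>0)\<close> survives.\<close>

lemma expected_statistic_alternative:
  assumes \<omega>: "\<omega> \<in> space M" and s[measurable]: "s \<in> borel_measurable borel" and s1: "\<And>z. \<bar>s z\<bar> \<le> 1"
    and \<theta>: "0 \<le> \<theta>" "\<theta> \<le> 1" and \<rho>: "\<rho> \<in> C1_intensities" and L: "\<And>z. z \<in> unit_cube \<Longrightarrow> \<rho> z \<le> L" "0 \<le> L"
  shows "(\<integral>\<^sup>+N. ennreal (likelihood_ratio n \<rho>\<^sub>0 N (Z \<omega>) \<rho> * exp_statistic n \<rho>\<^sub>0 s (- \<theta>) N (Z \<omega>)) \<partial>poisson_process_law n \<rho>\<^sub>0 (Z \<omega>))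
     \<le> ennreal (exp (LINT x:window n|lborel. L * \<theta>\<^sup>2 - \<theta> * (s (Z \<omega> x) * (\<rho> (Z \<omega> x) - \<rho>\<^sub>0 (Z \<omega> x)))))"
proof -
  note \<rho>m[measurable] = C1_intensities_measurable[OF \<rho>]
  have bd: "\<bar>\<theta> * s z\<bar> \<le> 1" for z unfolding abs_mult using \<theta> s1[of z] by (intro mult_le_one) auto
  have i1: "set_integrable lborel (window n) (\<lambda>x. \<rho> (Z \<omega> x) - \<rho>\<^sub>0 (Z \<omega> x))"
    using L C1_intensities_nonneg[OF \<rho>]
    by (intro set_integral_diff(1) \<rho>\<^sub>0_path_integrable \<omega> path_integrable[OF \<omega>, where B=L]) (auto)
  have i2: "set_integrable lborel (window n) (\<lambda>x. \<theta> * s (Z \<omega> x) * \<rho>\<^sub>0 (Z \<omega> x))"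
  proof (rule path_integrable[OF \<omega>, where B=B\<^sub>0 and g="\<lambda>z. \<theta> * s z * \<rho>\<^sub>0 z"])
    fix z :: "real ^ 'd" assume z: "z \<in> unit_cube"
    have "\<bar>\<theta> * s z\<bar> * \<bar>\<rho>\<^sub>0 z\<bar> \<le> 1 * B\<^sub>0" using \<rho>\<^sub>0_pos[OF z] \<rho>\<^sub>0_upper[OF z] bd by (intro mult_mono) auto
    then show "\<bar>\<theta> * s z * \<rho>\<^sub>0 z\<bar> \<le> B\<^sub>0" by (simp add: abs_mult)
  qed measurable
  have "likelihood_ratio n \<rho>\<^sub>0 N (Z \<omega>) \<rho> * exp_statistic n \<rho>\<^sub>0 s (- \<theta>) N (Z \<omega>) =
     (\<Prod>k<fst N. \<rho> (Z \<omega> (snd N k)) / \<rho>\<^sub>0 (Z \<omega> (snd N k)) * exp (- (\<theta> * s (Z \<omega> (snd N k))))) *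
     exp (- (LINT x:window n|lborel. (\<rho> (Z \<omega> x) - \<rho>\<^sub>0 (Z \<omega> x)) - \<theta> * s (Z \<omega> x) * \<rho>\<^sub>0 (Z \<omega> x)))" for N
  proof -
    have "(LINT x:window n|lborel. (- \<theta>) * s (Z \<omega> x) * \<rho>\<^sub>0 (Z \<omega> x)) = - (LINT x:window n|lborel. \<theta> * s (Z \<omega> x) * \<rho>\<^sub>0 (Z \<omega> x))"
      unfolding set_lebesgue_integral_def by simp
    then show ?thesis unfolding likelihood_ratio_def exp_statistic_def set_integral_diff(2)[OF i1 i2] prod.distrib
      by (simp add: exp_diff) (simp add: exp_minus field_simps)
  qed
  then have "(\<integral>\<^sup>+N. ennreal (likelihood_ratio n \<rho>\<^sub>0 N (Z \<omega>) \<rho> * exp_statistic n \<rho>\<^sub>0 s (- \<theta>) N (Z \<omega>)) \<partial>poisson_process_law n \<rho>\<^sub>0 (Z \<omega>))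
    = (\<integral>\<^sup>+N. ennreal ((\<Prod>k<fst N. (\<lambda>z. \<rho> z / \<rho>\<^sub>0 z * exp (- (\<theta> * s z))) (Z \<omega> (snd N k))) *
     exp (- (LINT x:window n|lborel. (\<lambda>z. (\<rho> z - \<rho>\<^sub>0 z) - \<theta> * s z * \<rho>\<^sub>0 z) (Z \<omega> x)))) \<partial>poisson_process_law n \<rho>\<^sub>0 (Z \<omega>))"
    by simp
  also have "\<dots> \<le> ennreal (exp (LINT x:window n|lborel. (\<lambda>z. L * \<theta>\<^sup>2 - \<theta> * (s z * (\<rho> z - \<rho>\<^sub>0 z))) (Z \<omega> x)))"
  proof (rule tilted_expectation_le[OF \<omega>, where H="L / c\<^sub>0 * exp 1" and C="L + B\<^sub>0 + B\<^sub>0" and U="L * 1 + (L + B\<^sub>0)"])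
    fix z :: "real ^ 'd" assume z: "z \<in> unit_cube"
    note f = \<rho>\<^sub>0_pos[OF z] \<rho>\<^sub>0_lower[OF z] \<rho>\<^sub>0_upper[OF z] s1[of z] c\<^sub>0_pos L(1)[OF z] L(2) C1_intensities_nonneg[OF \<rho> z]
    have s2: "(s z)\<^sup>2 \<le> 1" using s1[of z] by (simp add: abs_square_le_1)
    show "0 \<le> \<rho> z / \<rho>\<^sub>0 z * exp (- (\<theta> * s z))" using f by simp
    show "\<rho> z / \<rho>\<^sub>0 z * exp (- (\<theta> * s z)) \<le> L / c\<^sub>0 * exp 1"
      using f bd[of z] by (intro mult_mono frac_le) auto
    have a: "\<bar>\<theta> * s z\<bar> * \<bar>\<rho>\<^sub>0 z\<bar> \<le> 1 * B\<^sub>0" using f bd by (intro mult_mono) auto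
    then have a': "\<bar>\<theta> * s z * \<rho>\<^sub>0 z\<bar> \<le> B\<^sub>0" by (simp add: abs_mult)
    then show "\<bar>\<rho> z - \<rho>\<^sub>0 z - \<theta> * s z * \<rho>\<^sub>0 z\<bar> \<le> L + B\<^sub>0 + B\<^sub>0" using f by linarith
    have "\<bar>\<theta> * s z\<bar> * \<bar>\<rho> z - \<rho>\<^sub>0 z\<bar> \<le> 1 * (L + B\<^sub>0)" using f bd by (intro mult_mono) auto
    then have "\<bar>\<theta> * (s z * (\<rho> z - \<rho>\<^sub>0 z))\<bar> \<le> L + B\<^sub>0" by (simp add: abs_mult)
    moreover have "L * \<theta>\<^sup>2 \<le> L * 1" using \<theta> L(2) by (intro mult_left_mono power_le_one)
    moreover have "0 \<le> L * \<theta>\<^sup>2" using L(2) by simp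
    ultimately show "\<bar>L * \<theta>\<^sup>2 - \<theta> * (s z * (\<rho> z - \<rho>\<^sub>0 z))\<bar> \<le> L * 1 + (L + B\<^sub>0)" by linarith
    have "\<rho>\<^sub>0 z * (\<rho> z / \<rho>\<^sub>0 z * exp (- (\<theta> * s z)) - 1) - (\<rho> z - \<rho>\<^sub>0 z - \<theta> * s z * \<rho>\<^sub>0 z)
       = \<rho> z * (exp (- (\<theta> * s z)) - 1 - (- (\<theta> * s z))) - \<theta> * (s z * (\<rho> z - \<rho>\<^sub>0 z))"
      using f by (simp add: field_simps)
    also have "\<rho> z * (exp (- (\<theta> * s z)) - 1 - (- (\<theta> * s z))) \<le> \<rho> z * (\<theta> * s z)\<^sup>2"
      using exp_le_quadratic[of "- (\<theta> * s z)"] bd[of z] f by (intro mult_left_mono) auto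
    also have "\<dots> \<le> L * (\<theta>\<^sup>2 * 1)" unfolding power_mult_distrib using f s2 by (intro mult_mono) auto
    finally show "\<rho>\<^sub>0 z * (\<rho> z / \<rho>\<^sub>0 z * exp (- (\<theta> * s z)) - 1) - (\<rho> z - \<rho>\<^sub>0 z - \<theta> * s z * \<rho>\<^sub>0 z)
       \<le> L * \<theta>\<^sup>2 - \<theta> * (s z * (\<rho> z - \<rho>\<^sub>0 z))" by simp
  qed measurable
  finally show ?thesis .
qed

end

section \<open>Weak gradients and Borel functionals of the covariate path\<close>

text \<open>The integral of a difference quotient vanishes by translation invariance of Lebesgue measure, and
  the difference quotients converge dominatedly because \<open>h\<close> is Lipschitz in direction \<open>e\<close> with bounded
  support. This gives integration by parts without iterated integrals.\<close>

lemma integral_directional_derivative_zero: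
  fixes h :: "'a::euclidean_space \<Rightarrow> real" and e :: 'a
  assumes der: "\<And>x. (h has_derivative h' x) (at x)" and bd: "\<And>x. \<bar>h' x e\<bar> \<le> B"
    and supp: "\<And>x. x \<notin> ball 0 r \<Longrightarrow> h x = 0" and e: "norm e \<le> 1"
  shows "(LINT x|lborel. h' x e) = 0" and "(\<lambda>x. h' x e) \<in> borel_measurable borel"
proof -
  define q where "q = (\<lambda>k x. (h (x + (1 / real (Suc k)) *\<^sub>R e) - h x) * real (Suc k))"
  have cont: "continuous_on UNIV h"
    using der by (meson continuous_at_imp_continuous_on has_derivative_continuous)
  have hm[measurable]: "h \<in> borel_measurable borel" using cont by (rule borel_measurable_continuous_onI)
  have line: "((\<lambda>t. h (x + t *\<^sub>R e)) has_real_derivative h' (x + t *\<^sub>R e) e) (at t)" for x t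
  proof -
    have "((\<lambda>t. h (x + t *\<^sub>R e)) has_derivative (\<lambda>s. h' (x + t *\<^sub>R e) (0 + s *\<^sub>R e))) (at t)"
      by (rule has_derivative_compose[OF _ der, where f="\<lambda>t. x + t *\<^sub>R e"]) (auto intro!: derivative_eq_intros)
    moreover have "(\<lambda>s. h' (x + t *\<^sub>R e) (0 + s *\<^sub>R e)) = (*) (h' (x + t *\<^sub>R e) e)"
      using has_derivative_bounded_linear[OF der, of "x + t *\<^sub>R e"]
      by (auto simp: linear_simps mult.commute)
    ultimately show ?thesis by (simp add: has_field_derivative_def)
  qed
  have lim: "(\<lambda>k. q k x) \<longlonglongrightarrow> h' x e" for x
  proof -
    have "((\<lambda>s. (h (x + s *\<^sub>R e) - h x) / s) \<longlongrightarrow> h' x e) (at 0)"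
      using line[of x 0] by (simp add: has_field_derivative_iff)
    moreover have "filterlim (\<lambda>k. 1 / real (Suc k)) (at 0) sequentially"
      by (intro filterlim_atI lim_1_over_n[THEN LIMSEQ_Suc]) auto
    ultimately have "(\<lambda>k. (h (x + (1 / real (Suc k)) *\<^sub>R e) - h x) / (1 / real (Suc k))) \<longlonglongrightarrow> h' x e"
      by (rule filterlim_compose)
    then show ?thesis by (simp add: q_def)
  qed
  have qm[measurable]: "q k \<in> borel_measurable borel" for k unfolding q_def by measurable
  show h'm: "(\<lambda>x. h' x e) \<in> borel_measurable borel" by (rule borel_measurable_LIMSEQ_real[OF lim]) auto
  have lip: "\<bar>h (x + t *\<^sub>R e) - h x\<bar> \<le> B * t" if "t > 0" for x t
  proof -
    have "\<exists>s>0. s < t \<and> h (x + t *\<^sub>R e) - h (x + 0 *\<^sub>R e) = (t - 0) * h' (x + s *\<^sub>R e) e"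
      using that by (intro MVT2 line)
    then obtain s where "h (x + t *\<^sub>R e) - h (x + 0 *\<^sub>R e) = (t - 0) * h' (x + s *\<^sub>R e) e" by blast
    then show ?thesis using that bd[of "x + s *\<^sub>R e"] by (simp add: abs_mult mult.commute mult_left_mono)
  qed
  have qB: "norm (q k x) \<le> B * indicator (ball 0 (r + 1)) x" for k x
  proof (cases "x \<in> ball 0 (r + 1)")
    case True
    have "\<bar>q k x\<bar> \<le> (B * (1 / real (Suc k))) * real (Suc k)"
      unfolding q_def abs_mult using lip[of "1 / real (Suc k)" x] by (intro mult_mono) auto
    then show ?thesis using True by simp
  next
    case False
    then have nx: "norm x \<ge> r + 1" by simp
    have "norm ((1 / real (Suc k)) *\<^sub>R e) \<le> 1" using e by (simp add: divide_le_eq)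
    then have "norm (x + (1 / real (Suc k)) *\<^sub>R e) \<ge> r" using nx norm_diff_ineq[of x "(1 / real (Suc k)) *\<^sub>R e"] by linarith
    then have "q k x = 0" using supp[of x] supp[of "x + (1 / real (Suc k)) *\<^sub>R e"] nx by (simp add: q_def)
    then show ?thesis using False by simp
  qed
  have hint: "integrable lborel h"
  proof -
    have "continuous_on (cball 0 r) h" using cont continuous_on_subset by blast
    then have "bounded (h ` cball 0 r)" by (intro compact_imp_bounded compact_continuous_image) auto
    then obtain C where C: "\<And>x. x \<in> cball 0 r \<Longrightarrow> \<bar>h x\<bar> \<le> C"
      unfolding bounded_iff by (metis imageI real_norm_def)
    have "integrable lborel (\<lambda>x::'a. C * indicator (ball 0 r) x :: real)"
      using emeasure_lborel_ball_finite[of "0::'a" r] by (intro integrable_mult_right integrable_real_indicator) auto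
    then show ?thesis
    proof (rule Bochner_Integration.integrable_bound)
      have "norm (h x) \<le> norm (C * indicator (ball 0 r) x)" for x
        using C[of x] supp[of x] by (cases "x \<in> ball 0 r") auto
      then show "AE x in lborel. norm (h x) \<le> norm (C * indicator (ball 0 r) x)" by simp
    qed simp
  qed
  have "(LINT x|lborel. q k x) = 0" for k
  proof -
    have d: "lborel = distr lborel borel ((+) ((1 / real (Suc k)) *\<^sub>R e))" by (rule lborel_distr_plus[symmetric])
    have int': "integrable lborel (\<lambda>x. h ((1 / real (Suc k)) *\<^sub>R e + x))"
      using hint by (subst (asm) d) (simp add: integrable_distr_eq)
    have "(LINT x|lborel. h ((1 / real (Suc k)) *\<^sub>R e + x)) = (LINT x|lborel. h x)"
      by (subst (2) d) (simp add: integral_distr)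
    then show ?thesis unfolding q_def using hint int' by (simp add: add.commute)
  qed
  moreover have "(\<lambda>k. LINT x|lborel. q k x) \<longlonglongrightarrow> (LINT x|lborel. h' x e)"
  proof (rule integral_dominated_convergence)
    show "integrable lborel (\<lambda>x::'a. B * indicator (ball 0 (r + 1)) x :: real)"
      using emeasure_lborel_ball_finite[of "0::'a" "r+1"] by (intro integrable_mult_right integrable_real_indicator) auto
    show "(\<lambda>x. h' x e) \<in> borel_measurable lborel" using h'm by simp
  qed (use lim qB in auto)
  ultimately show "(LINT x|lborel. h' x e) = 0" by (simp add: LIMSEQ_const_iff)
qed

lemma Linf_norm_le:
  assumes [measurable]: "f \<in> borel_measurable borel" and "S \<in> sets borel" "\<And>x. x \<in> S \<Longrightarrow> norm (f x) \<le> a"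
  shows "Linf_norm S f \<le> ereal a"
  unfolding Linf_norm_def
proof (rule esssup_I)
  show "(\<lambda>x. ereal (norm (f x))) \<in> borel_measurable (restrict_space lborel S)"
    by (intro measurable_restrict_space1) simp
  show "AE x in restrict_space lborel S. ereal (norm (f x)) \<le> ereal a"
    using assms by (intro AE_I2) (auto simp: space_restrict_space)
qed

lemma Linf_bounded:
  assumes "f \<in> borel_measurable borel" "S \<in> sets borel" "\<And>x. x \<in> S \<Longrightarrow> norm (f x) \<le> a"
  shows "f \<in> Linf S"
  using Linf_norm_le[OF assms] assms(1) unfolding Linf_def
  by (auto intro: measurable_restrict_space1 le_less_trans)

text \<open>Classical derivatives on the open cube are weak derivatives: for a test function \<open>\<phi>\<close> the product
  \<open>f \<phi>\<close>, extended by zero, is differentiable everywhere, so its partial derivatives integrate to zero.\<close>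

lemma W1inf_norm_le:
  fixes f :: "real ^ 'd \<Rightarrow> real" and G :: "'d \<Rightarrow> real ^ 'd \<Rightarrow> real"
  assumes fm[measurable]: "f \<in> borel_measurable borel" and Gm[measurable]: "\<And>i. G i \<in> borel_measurable borel"
    and fa: "\<And>z. z \<in> unit_cube \<Longrightarrow> \<bar>f z\<bar> \<le> a" and Gb: "\<And>i z. z \<in> unit_cube \<Longrightarrow> \<bar>G i z\<bar> \<le> b"
    and der: "\<And>z. z \<in> box 0 1 \<Longrightarrow> \<exists>f'. (f has_derivative f') (at z) \<and> (\<forall>i. f' (axis i 1) = G i z)"
  shows "W1inf_norm f \<le> ereal (a + real CARD('d) * b)"
proof -
  have "(LINT z:box 0 1|lborel. f z * partial_deriv UNIV i \<phi> z) = - (LINT z:box 0 1|lborel. G i z * \<phi> z)"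
    if \<phi>: "test_function (box 0 1) \<phi>" for \<phi> :: "real ^ 'd \<Rightarrow> real" and i
  proof -
    obtain K where K: "compact K" "K \<subseteq> box 0 1" "\<And>z. z \<notin> K \<Longrightarrow> \<phi> z = 0" and Ck: "\<And>k. C_k k \<phi>"
      using \<phi> by (auto simp: test_function_def)
    let ?e = "axis i 1 :: real ^ 'd"
    have \<phi>c: "continuous_on UNIV \<phi>" using Ck[of 0] by simp
    have \<phi>d: "(\<phi> has_derivative frechet_derivative \<phi> (at z)) (at z)" for z
      using Ck[of 1] by (simp add: frechet_derivative_works)
    have \<phi>'c: "continuous_on UNIV (partial_deriv UNIV i \<phi>)" using Ck[of 1] by simp
    have [measurable]: "\<phi> \<in> borel_measurable borel" "partial_deriv UNIV i \<phi> \<in> borel_measurable borel"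
      using \<phi>c \<phi>'c by (auto intro: borel_measurable_continuous_onI)
    obtain f' where f': "\<And>z. z \<in> box 0 1 \<Longrightarrow> (f has_derivative f' z) (at z)"
        "\<And>z. z \<in> box 0 1 \<Longrightarrow> f' z ?e = G i z" using der by metis
    have cc: "compact (unit_cube :: (real ^ 'd) set)" by (rule compact_cbox)
    have "bounded (\<phi> ` unit_cube)" "bounded (partial_deriv UNIV i \<phi> ` unit_cube)"
      using \<phi>c \<phi>'c cc by (auto intro!: compact_imp_bounded compact_continuous_image intro: continuous_on_subset)
    then obtain p p' where p: "\<And>z. z \<in> unit_cube \<Longrightarrow> \<bar>\<phi> z\<bar> \<le> p" "\<And>z. z \<in> unit_cube \<Longrightarrow> \<bar>partial_deriv UNIV i \<phi> z\<bar> \<le> p'"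
      unfolding bounded_iff by (metis imageI real_norm_def)
    define h where "h z = (if z \<in> box 0 1 then f z * \<phi> z else 0)" for z
    define h' where "h' z = (if z \<in> box 0 1 then (\<lambda>v. f z * frechet_derivative \<phi> (at z) v + f' z v * \<phi> z) else (\<lambda>v. 0))" for z
    have sub: "box 0 1 \<subseteq> (unit_cube :: (real ^ 'd) set)" by (rule box_subset_cbox)
    have hd: "(h has_derivative h' z) (at z)" for z
    proof (cases "z \<in> box 0 1")
      case True
      have "((\<lambda>z. f z * \<phi> z) has_derivative h' z) (at z)"
        using has_derivative_mult[OF f'(1)[OF True] \<phi>d] True by (simp add: h'_def)
      then show ?thesis
        by (rule has_derivative_transform_within_open[OF _ open_box True]) (simp add: h_def)
    next
      case False
      then have "z \<in> - K" using K(2) by auto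
      have "((\<lambda>z. 0) has_derivative h' z) (at z)" using False by (simp add: h'_def)
      then show ?thesis
        by (rule has_derivative_transform_within_open[OF _ _ \<open>z \<in> - K\<close>])
          (use K in \<open>auto simp: h_def compact_imp_closed open_Compl\<close>)
    qed
    \<comment> \<open>Outside the open cube both sides vanish.\<close>
    have h'e: "h' z ?e = indicator (box 0 1) z * (f z * partial_deriv UNIV i \<phi> z + G i z * \<phi> z)" for z
      by (simp add: h'_def partial_deriv_def f')
    have ap: "0 \<le> a" "0 \<le> b" "0 \<le> p" "0 \<le> p'"
      using fa[of 0] Gb[of 0] p[of 0] by (auto simp: mem_box_cart intro: order_trans[OF abs_ge_zero])
    have b1: "\<bar>f z * partial_deriv UNIV i \<phi> z\<bar> \<le> a * p'" "\<bar>G i z * \<phi> z\<bar> \<le> b * p" if "z \<in> box 0 1" for z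
      using fa[of z] Gb[of z] p[of z] that sub ap by (auto simp: abs_mult intro!: mult_mono)
    have h'B: "\<bar>h' z ?e\<bar> \<le> a * p' + b * p" for z
      unfolding h'e using b1[of z] ap by (auto simp: indicator_def intro: add_nonneg_nonneg)
    obtain r where r: "box 0 (1 :: real ^ 'd) \<subseteq> ball 0 r" using bounded_subset_ballD[OF bounded_box] by blast
    have zero: "(LINT z|lborel. h' z ?e) = 0"
      by (rule integral_directional_derivative_zero(1)[OF hd h'B, where r=r]) (use r in \<open>auto simp: h_def\<close>)
    have fin: "emeasure lborel (box 0 (1 :: real ^ 'd)) < \<infinity>" by (rule emeasure_lborel_box_finite)
    have si: "set_integrable lborel (box 0 1) g" if "g \<in> borel_measurable borel" "\<And>z. z \<in> box 0 1 \<Longrightarrow> \<bar>g z\<bar> \<le> c" for g :: "real ^ 'd \<Rightarrow> real" and c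
      unfolding set_integrable_def
    proof (rule Bochner_Integration.integrable_bound)
      show "integrable lborel (\<lambda>x::real^'d. indicator (box 0 1) x * c)"
        using fin by (intro integrable_mult_left integrable_real_indicator) auto
    qed (use that in \<open>force simp: indicator_def\<close>)+
    have "(LINT z:box 0 1|lborel. f z * partial_deriv UNIV i \<phi> z) + (LINT z:box 0 1|lborel. G i z * \<phi> z)
      = (LINT z:box 0 1|lborel. f z * partial_deriv UNIV i \<phi> z + G i z * \<phi> z)"
      using b1 by (intro set_integral_add(2)[symmetric] si) auto
    also have "\<dots> = 0" using zero unfolding h'e set_lebesgue_integral_def by simp
    finally show ?thesis by linarith
  qed
  then have wg: "weak_gradient f G"
    unfolding weak_gradient_def using fa Gb by (auto intro!: Linf_bounded)
  have "W1inf_norm f \<le> Linf_norm unit_cube f + (\<Sum>i\<in>UNIV. Linf_norm unit_cube (G i))"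
    unfolding W1inf_norm_def by (rule INF_lower) (use wg in simp)
  also have "\<dots> \<le> ereal a + (\<Sum>i\<in>(UNIV :: 'd set). ereal b)"
    using fa Gb by (intro add_mono sum_mono Linf_norm_le) auto
  also have "\<dots> = ereal (a + real CARD('d) * b)" by simp
  finally show ?thesis .
qed

text \<open>For uniformly continuous \<open>f\<close> the average is continuous in the essential supremum distance, so the
  event is open. Measurability matters because \<open>measure\<close> is zero on sets that are not measurable,
  where a bound on it would be void.\<close>

lemma window_average_sets:
  fixes f :: "real ^ 'd \<Rightarrow> real"
  assumes n: "n \<ge> 1" and uc: "uniformly_continuous_on UNIV f" and B: "\<And>z. \<bar>f z\<bar> \<le> B"
  shows "{z \<in> Linf (window n :: (real ^ 'm) set). t < \<bar>(LINT x:window n|lborel. f (z x)) / real n - m\<bar>}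
     \<in> sets (Linf_borel (window n))"
proof -
  let ?W = "window n :: (real ^ 'm) set"
  define I where "I z = (LINT x:?W|lborel. f (z x)) / real n" for z
  have [measurable]: "f \<in> borel_measurable borel"
    using uc by (intro borel_measurable_continuous_onI uniformly_continuous_imp_continuous)
  have int: "set_integrable lborel ?W (\<lambda>x. f (z x))" if "z \<in> Linf ?W" for z :: "real ^ 'm \<Rightarrow> real ^ 'd"
    unfolding set_integrable_def
  proof (rule Bochner_Integration.integrable_bound)
    show "integrable lborel (\<lambda>x. indicator ?W x * B)"
      using emeasure_window_finite[of n, where 'm='m] by (intro integrable_mult_left integrable_real_indicator) auto
    have "z \<in> borel_measurable (restrict_space lborel ?W)" using that by (simp add: Linf_def)
    then have "(\<lambda>x. f (z x)) \<in> borel_measurable (restrict_space lborel ?W)" by measurable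
    then show "(\<lambda>x. indicator ?W x *\<^sub>R f (z x)) \<in> borel_measurable lborel"
      by (subst (asm) borel_measurable_restrict_space_iff) auto
    show "AE x in lborel. norm (indicator ?W x *\<^sub>R f (z x)) \<le> norm (indicator ?W x * B)"
      using B by (intro AE_I2) (force simp: indicator_def intro: order_trans)
  qed
  have close: "\<bar>I g - I z\<bar> \<le> \<delta>"
    if z: "z \<in> Linf ?W" and g: "g \<in> Linf ?W" and lt: "Linf_norm ?W (\<lambda>x. g x - z x) < ereal e"
      and e: "\<And>u v. dist u v < e \<Longrightarrow> dist (f u) (f v) < \<delta>" and d: "\<delta> > 0" for z g e \<delta>
  proof -
    have "AE x in restrict_space lborel ?W. ereal (norm (g x - z x)) \<le> Linf_norm ?W (\<lambda>x. g x - z x)"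
      unfolding Linf_norm_def by (rule esssup_AE)
    then have ae: "AE x in lborel. x \<in> ?W \<longrightarrow> ereal (norm (g x - z x)) \<le> Linf_norm ?W (\<lambda>x. g x - z x)"
      by (subst (asm) AE_restrict_space_iff) auto
    have ae': "AE x in lborel. \<bar>indicator ?W x * (f (g x) - f (z x))\<bar> \<le> indicator ?W x * \<delta>"
      using ae
    proof eventually_elim
      case (elim x)
      show ?case
      proof (cases "x \<in> ?W")
        case True
        then have "ereal (norm (g x - z x)) < ereal e" using elim lt by (metis le_less_trans)
        then have "dist (f (g x)) (f (z x)) < \<delta>" by (intro e) (simp add: dist_norm)
        then show ?thesis using True by (simp add: dist_real_def)
      qed simp
    qed
    have i: "integrable lborel (\<lambda>x. indicator ?W x * (f (g x) - f (z x)))"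
      using set_integral_diff(1)[OF int[OF g] int[OF z]] by (simp add: set_integrable_def)
    have "real n * (I g - I z) = (LINT x|lborel. indicator ?W x * (f (g x) - f (z x)))"
    proof -
      have "real n * (I g - I z) = (LINT x:?W|lborel. f (g x)) - (LINT x:?W|lborel. f (z x))"
        using n by (simp add: I_def right_diff_distrib)
      also have "\<dots> = (LINT x:?W|lborel. f (g x) - f (z x))"
        by (rule set_integral_diff(2)[OF int[OF g] int[OF z], symmetric])
      finally show ?thesis by (simp add: set_lebesgue_integral_def)
    qed
    then have "real n * \<bar>I g - I z\<bar> = \<bar>LINT x|lborel. indicator ?W x * (f (g x) - f (z x))\<bar>"
      by (metis abs_mult abs_of_nat)
    also have "\<dots> \<le> (LINT x|lborel. \<bar>indicator ?W x * (f (g x) - f (z x))\<bar>)" by (rule integral_abs_bound)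
    also have "\<dots> \<le> (LINT x|lborel. indicator ?W x * \<delta>)"
      using emeasure_window_finite[of n, where 'm='m]
      by (intro integral_mono_AE integrable_abs i ae' integrable_mult_left integrable_real_indicator) auto
    also have "\<dots> = real n * \<delta>" using window_integral_const[OF n, where 'a='m, of \<delta>] by (simp add: set_lebesgue_integral_def)
    finally show ?thesis using n by simp
  qed
  let ?S = "{z \<in> Linf ?W. t < \<bar>I z - m\<bar>}"
  have "\<exists>e>0. \<forall>g\<in>Linf ?W. Linf_norm ?W (\<lambda>x. g x - z x) < ereal e \<longrightarrow> g \<in> ?S" if z: "z \<in> ?S" for z
  proof -
    define \<delta> where "\<delta> = (\<bar>I z - m\<bar> - t) / 2"
    have \<delta>: "\<delta> > 0" using z by (simp add: \<delta>_def)
    obtain e where e: "e > 0" "\<And>u v. dist u v < e \<Longrightarrow> dist (f u) (f v) < \<delta>"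
      using uc \<delta> unfolding uniformly_continuous_on_def by (metis UNIV_I)
    show ?thesis
    proof (intro exI[of _ e] conjI ballI impI)
      fix g assume g: "g \<in> Linf ?W" "Linf_norm ?W (\<lambda>x. g x - z x) < ereal e"
      have "\<bar>I g - I z\<bar> \<le> \<delta>" using close[OF _ g e(2) \<delta>] z by blast
      then have "t < \<bar>I g - m\<bar>" using \<delta> unfolding \<delta>_def by argo
      then show "g \<in> ?S" using g by simp
    qed (rule e)
  qed
  then have "?S \<in> sets (Linf_borel ?W)" unfolding Linf_borel_def
    by (subst sets_measure_of) (auto intro: sigma_sets.Basic)
  then show ?thesis by (simp add: I_def)
qed

lemma covariate_concentration:
  fixes Z :: "'w \<Rightarrow> real ^ 'm \<Rightarrow> real ^ 'd" and f :: "real ^ 'd \<Rightarrow> real"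
  assumes Z: "Z \<in> measurable M (Linf_borel (window n))" and n: "n \<ge> 1"
    and uc: "uniformly_continuous_on UNIV f" and B: "\<And>z. \<bar>f z\<bar> \<le> B"
    and conc: "measure (covariate_law M Z n)
             {z \<in> Linf (window n).
                t < \<bar>(LINT x:window n|lborel. f (z x)) / measure lborel (window n :: (real ^ 'm) set) - m\<bar>} \<le> c"
  shows "measure M {\<omega> \<in> space M. t < \<bar>(LINT x:window n|lborel. f (Z \<omega> x)) / real n - m\<bar>} \<le> c"
proof -
  have "space (Linf_borel (window n :: (real ^ 'm) set)) = (Linf (window n) :: (real ^ 'm \<Rightarrow> real ^ 'd) set)"
    unfolding Linf_borel_def by (rule space_measure_of) auto
  then have "\<And>\<omega>. \<omega> \<in> space M \<Longrightarrow> Z \<omega> \<in> Linf (window n)" using measurable_space[OF Z] by simp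
  then have "{\<omega> \<in> space M. t < \<bar>(LINT x:window n|lborel. f (Z \<omega> x)) / real n - m\<bar>} =
     Z -` {z \<in> Linf (window n). t < \<bar>(LINT x:window n|lborel. f (z x)) / real n - m\<bar>} \<inter> space M" by auto
  then show ?thesis
    using conc unfolding covariate_law_def measure_window[OF n]
    by (subst (asm) measure_distr[OF Z window_average_sets[OF n uc B]]) simp
qed

section \<open>Concentration of distances along the covariate path\<close>

text \<open>A \<open>C\<^sup>1\<close> substitute for \<open>\<bar>f - g\<bar>\<close>, to which the concentration hypothesis can be applied. The
  retraction makes it uniformly continuous on the whole space.\<close>

definition smooth_abs_diff :: "real \<Rightarrow> (real ^ 'd \<Rightarrow> real) \<Rightarrow> (real ^ 'd \<Rightarrow> real) \<Rightarrow> real ^ 'd \<Rightarrow> real" where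
  "smooth_abs_diff e f g z = sqrt ((f (clamp 0 1 z) - g (clamp 0 1 z))\<^sup>2 + e\<^sup>2)"

lemma smooth_abs_diff_bounds:
  assumes "0 \<le> e"
  shows "\<bar>f (clamp 0 1 z) - g (clamp 0 1 z)\<bar> \<le> smooth_abs_diff e f g z"
    and "smooth_abs_diff e f g z \<le> \<bar>f (clamp 0 1 z) - g (clamp 0 1 z)\<bar> + e"
proof -
  show "\<bar>f (clamp 0 1 z) - g (clamp 0 1 z)\<bar> \<le> smooth_abs_diff e f g z"
    unfolding smooth_abs_diff_def by (intro real_le_rsqrt) simp
  show "smooth_abs_diff e f g z \<le> \<bar>f (clamp 0 1 z) - g (clamp 0 1 z)\<bar> + e"
    unfolding smooth_abs_diff_def using assms
    by (intro real_le_lsqrt) (auto simp: power2_eq_square algebra_simps)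
qed

lemma C1_norm_bounds:
  fixes \<rho> :: "real ^ 'd \<Rightarrow> real"
  assumes "\<rho> \<in> C1_intensities" "z \<in> unit_cube"
  shows "\<bar>\<rho> z\<bar> \<le> C1_norm \<rho>" and "\<bar>partial_deriv unit_cube i \<rho> z\<bar> \<le> C1_norm \<rho>"
proof -
  have bdd: "bdd_above ((\<lambda>z. \<bar>f z\<bar>) ` (unit_cube :: (real ^ 'd) set))" if "continuous_on unit_cube f" for f :: "real ^ 'd \<Rightarrow> real"
    using that by (intro bounded_imp_bdd_above compact_imp_bounded compact_continuous_image continuous_intros) auto
  have le: "\<bar>f z\<bar> \<le> (SUP z\<in>unit_cube. \<bar>f z\<bar>)" if "continuous_on unit_cube f" for f :: "real ^ 'd \<Rightarrow> real"
    by (rule cSUP_upper[OF assms(2) bdd[OF that]])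
  have ge0: "0 \<le> (SUP z\<in>unit_cube. \<bar>f z\<bar>)" if "continuous_on unit_cube f" for f :: "real ^ 'd \<Rightarrow> real"
    using le[OF that] by linarith
  have pc: "continuous_on unit_cube (partial_deriv unit_cube i \<rho>)" for i
    using assms(1) by (simp add: C1_intensities_def C1_cube_def)
  note c = C1_intensities_continuous[OF assms(1)]
  have s0: "0 \<le> (\<Sum>i\<in>UNIV. SUP z\<in>unit_cube. \<bar>partial_deriv unit_cube i \<rho> z\<bar>)"
    by (intro sum_nonneg ge0 pc)
  show "\<bar>\<rho> z\<bar> \<le> C1_norm \<rho>" using le[OF c] s0 by (simp add: C1_norm_def)
  have "(SUP z\<in>unit_cube. \<bar>partial_deriv unit_cube i \<rho> z\<bar>) \<le> (\<Sum>i\<in>UNIV. SUP z\<in>unit_cube. \<bar>partial_deriv unit_cube i \<rho> z\<bar>)"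
    by (rule member_le_sum) (auto intro: ge0 pc)
  then show "\<bar>partial_deriv unit_cube i \<rho> z\<bar> \<le> C1_norm \<rho>" using le[OF pc, of i] ge0[OF c]
    unfolding C1_norm_def by linarith
qed

lemma C1_intensities_has_derivative:
  fixes \<rho> :: "real ^ 'd \<Rightarrow> real"
  assumes "\<rho> \<in> C1_intensities" "z \<in> box 0 1"
  shows "(\<rho> has_derivative frechet_derivative \<rho> (at z within unit_cube)) (at z)"
proof -
  have z: "z \<in> unit_cube" using assms(2) box_subset_cbox by blast
  have "(\<rho> has_derivative frechet_derivative \<rho> (at z within unit_cube)) (at z within unit_cube)"
    using assms z by (subst frechet_derivative_works[symmetric]) (auto simp: C1_intensities_def C1_cube_def)
  moreover have "at z within unit_cube = at z" using assms(2) by (intro at_within_interior) (simp add: interior_cbox)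
  ultimately show ?thesis by simp
qed

lemma smooth_abs_diff_continuous:
  fixes \<rho> :: "real ^ 'd \<Rightarrow> real"
  assumes "\<rho> \<in> C1_intensities" "\<rho>' \<in> C1_intensities"
  shows "uniformly_continuous_on UNIV (smooth_abs_diff e \<rho> \<rho>')"
proof -
  define F where "F z = sqrt ((\<rho> z - \<rho>' z)\<^sup>2 + e\<^sup>2)" for z
  have "uniformly_continuous_on (unit_cube :: (real ^ 'd) set) F"
    unfolding F_def using assms
    by (intro compact_uniformly_continuous continuous_intros C1_intensities_continuous) auto
  then have F: "uniformly_continuous_on (range (clamp 0 (1 :: real ^ 'd))) F"
    unfolding uniformly_continuous_on_def by (metis clamp_cube imageE)
  have "uniformly_continuous_on UNIV (clamp 0 (1 :: real ^ 'd))"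
    unfolding uniformly_continuous_on_def
    by (blast intro: le_less_trans[OF dist_clamps_le_dist_args])
  from uniformly_continuous_on_compose[OF this F]
  have "uniformly_continuous_on UNIV (\<lambda>z. F (clamp 0 1 z))" .
  then show ?thesis by (simp add: F_def smooth_abs_diff_def[abs_def])
qed

text \<open>The gradient is \<open>(\<rho> - \<rho>') / \<surd>((\<rho> - \<rho>')\<^sup>2 + e\<^sup>2)\<close> times that of \<open>\<rho> - \<rho>'\<close>, and the
  first factor is at most \<open>1\<close> in modulus, uniformly in \<open>e\<close>.\<close>

lemma smooth_abs_diff_W1inf:
  fixes \<rho> :: "real ^ 'd \<Rightarrow> real"
  assumes C1: "\<rho> \<in> C1_intensities" "\<rho>' \<in> C1_intensities" and L: "C1_norm \<rho> \<le> L" "C1_norm \<rho>' \<le> L"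
    and e: "0 < e" "e \<le> 1"
  shows "\<bar>smooth_abs_diff e \<rho> \<rho>' z\<bar> \<le> 2 * L + 1"
    and "W1inf_norm (smooth_abs_diff e \<rho> \<rho>') \<le> ereal (2 * L + 1 + real CARD('d) * (2 * L))"
proof -
  have le: "\<bar>smooth_abs_diff e \<rho> \<rho>' z\<bar> \<le> 2 * L + 1" for z
    using smooth_abs_diff_bounds[where e=e and f=\<rho> and g=\<rho>' and z=z] C1_norm_bounds(1)[OF C1(1) clamp_cube, of z]
      C1_norm_bounds(1)[OF C1(2) clamp_cube, of z] L e by linarith
  show "\<bar>smooth_abs_diff e \<rho> \<rho>' z\<bar> \<le> 2 * L + 1" by (rule le)
  have pos: "0 < smooth_abs_diff e \<rho> \<rho>' z" for z
    unfolding smooth_abs_diff_def using e by (simp add: add_nonneg_pos)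
  define c where "c z = clamp 0 (1 :: real ^ 'd) z" for z
  define G where "G i z = (\<rho> (c z) - \<rho>' (c z)) / smooth_abs_diff e \<rho> \<rho>' z *
     (partial_deriv unit_cube i \<rho> (c z) - partial_deriv unit_cube i \<rho>' (c z))" for i z
  have sm[measurable]: "smooth_abs_diff e \<rho> \<rho>' \<in> borel_measurable borel"
    using smooth_abs_diff_continuous[OF C1] by (intro borel_measurable_continuous_onI uniformly_continuous_imp_continuous)
  have [measurable]: "(\<lambda>z. r (c z)) \<in> borel_measurable borel" "(\<lambda>z. partial_deriv unit_cube i r (c z)) \<in> borel_measurable borel"
    if "r \<in> C1_intensities" for r i
    using that C1_intensities_continuous[OF that] unfolding c_def
    by (auto intro!: borel_measurable_continuous_onI continuous_on_clamp_cube simp: C1_intensities_def C1_cube_def)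
  show "W1inf_norm (smooth_abs_diff e \<rho> \<rho>') \<le> ereal (2 * L + 1 + real CARD('d) * (2 * L))"
  proof (rule W1inf_norm_le[where G=G])
    show "G i \<in> borel_measurable borel" for i unfolding G_def using C1 by measurable
    show "\<bar>G i z\<bar> \<le> 2 * L" for i z
    proof -
      have "\<bar>\<rho> (c z) - \<rho>' (c z)\<bar> / smooth_abs_diff e \<rho> \<rho>' z \<le> 1"
        using smooth_abs_diff_bounds(1)[where e=e and f=\<rho> and g=\<rho>' and z=z] pos[of z] e by (simp add: c_def)
      moreover have "\<bar>partial_deriv unit_cube i \<rho> (c z) - partial_deriv unit_cube i \<rho>' (c z)\<bar> \<le> 2 * L"
        using C1_norm_bounds(2)[OF C1(1) clamp_cube, of i z] C1_norm_bounds(2)[OF C1(2) clamp_cube, of i z] L unfolding c_def by linarith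
      ultimately have "\<bar>\<rho> (c z) - \<rho>' (c z)\<bar> / smooth_abs_diff e \<rho> \<rho>' z * \<bar>partial_deriv unit_cube i \<rho> (c z) - partial_deriv unit_cube i \<rho>' (c z)\<bar> \<le> 1 * (2 * L)"
        by (intro mult_mono) auto
      then show ?thesis using pos[of z] by (simp add: G_def abs_mult)
    qed
    fix z :: "real ^ 'd" assume z: "z \<in> box 0 1"
    then have zc: "z \<in> unit_cube" using box_subset_cbox by blast
    let ?D = "frechet_derivative \<rho> (at z within unit_cube)" and ?D' = "frechet_derivative \<rho>' (at z within unit_cube)"
    have p: "0 < (\<rho> z - \<rho>' z)\<^sup>2 + e\<^sup>2" using e by (simp add: add_nonneg_pos)
    have "((\<lambda>z. sqrt ((\<rho> z - \<rho>' z)\<^sup>2 + e\<^sup>2)) has_derivative (\<lambda>v. (\<rho> z - \<rho>' z) / sqrt ((\<rho> z - \<rho>' z)\<^sup>2 + e\<^sup>2) * (?D v - ?D' v))) (at z)"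
    proof -
      have d: "((\<lambda>z. \<rho> z - \<rho>' z) has_derivative (\<lambda>v. ?D v - ?D' v)) (at z)"
        by (intro has_derivative_diff C1_intensities_has_derivative C1 z)
      have q: "((\<lambda>z. (\<rho> z - \<rho>' z)\<^sup>2 + e\<^sup>2) has_derivative (\<lambda>v. 2 * (\<rho> z - \<rho>' z) * (?D v - ?D' v))) (at z)"
        by (rule has_derivative_eq_rhs[OF has_derivative_add[OF has_derivative_power[OF d] has_derivative_const]]) (auto simp: fun_eq_iff algebra_simps)
      have alg: "2 * a * b * (inverse c / 2) = a / c * b" for a b c :: real
        by (simp add: field_simps)
      have "(\<lambda>v. 2 * (\<rho> z - \<rho>' z) * (?D v - ?D' v) * (inverse (sqrt ((\<rho> z - \<rho>' z)\<^sup>2 + e\<^sup>2)) / 2)) =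
          (\<lambda>v. (\<rho> z - \<rho>' z) / sqrt ((\<rho> z - \<rho>' z)\<^sup>2 + e\<^sup>2) * (?D v - ?D' v))"
        by (rule ext) (rule alg)
      with has_derivative_real_sqrt[OF p q] show ?thesis by simp
    qed
    then have "(smooth_abs_diff e \<rho> \<rho>' has_derivative (\<lambda>v. (\<rho> z - \<rho>' z) / sqrt ((\<rho> z - \<rho>' z)\<^sup>2 + e\<^sup>2) * (?D v - ?D' v))) (at z)"
      by (rule has_derivative_transform_within_open[OF _ open_box z])
        (simp add: smooth_abs_diff_def clamp_cube_cancel[OF subsetD[OF box_subset_cbox]])
    then show "\<exists>f'. (smooth_abs_diff e \<rho> \<rho>' has_derivative f') (at z) \<and> (\<forall>i. f' (axis i 1) = G i z)"
      using zc by (intro exI conjI) (auto simp: G_def c_def partial_deriv_def smooth_abs_diff_def)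
  qed (use le in auto)
qed

lemma cube_integrable:
  fixes f :: "real ^ 'd \<Rightarrow> real"
  assumes "emeasure \<mu> unit_cube < \<infinity>" "sets \<mu> = sets borel" "f \<in> borel_measurable borel" "\<And>z. z \<in> unit_cube \<Longrightarrow> \<bar>f z\<bar> \<le> B"
  shows "set_integrable \<mu> unit_cube f"
  unfolding set_integrable_def
proof (rule Bochner_Integration.integrable_bound)
  show "integrable \<mu> (\<lambda>x. indicator unit_cube x * B)"
    using assms(1,2) by (intro integrable_mult_left integrable_real_indicator) auto
  show "AE x in \<mu>. norm (indicator unit_cube x *\<^sub>R f x) \<le> norm (indicator unit_cube x * B)"
    using assms(4) by (intro AE_I2) (force simp: indicator_def)
  have "f \<in> borel_measurable \<mu>" using assms(3) measurable_cong_sets[OF assms(2) refl] by blast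
  then show "(\<lambda>x. indicator unit_cube x *\<^sub>R f x) \<in> borel_measurable \<mu>" 
    using assms(2) by (intro borel_measurable_scaleR borel_measurable_indicator) auto
qed

lemma L1_dist_density_le:
  fixes f g :: "real ^ 'd \<Rightarrow> real"
  assumes \<nu>: "\<nu> = density lborel (\<lambda>z. ennreal (p z))" and [measurable]: "p \<in> borel_measurable borel"
    and p: "\<And>z. 0 \<le> p z" "\<And>z. p z \<le> C"
    and [measurable]: "f \<in> borel_measurable borel" "g \<in> borel_measurable borel"
    and B: "\<And>z. z \<in> unit_cube \<Longrightarrow> \<bar>f z - g z\<bar> \<le> B"
  shows "L1_dist \<nu> f g \<le> C * L1_dist lborel f g"
proof -
  have i: "set_integrable lborel unit_cube (\<lambda>z. \<bar>f z - g z\<bar>)"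
    by (rule cube_integrable[OF emeasure_lborel_cbox_finite, where B=B]) (use B in auto)
  have "L1_dist \<nu> f g = (LINT z|lborel. p z * (indicator unit_cube z * \<bar>f z - g z\<bar>))"
    unfolding L1_dist_def set_lebesgue_integral_def \<nu> using p(1)
    by (subst integral_density) auto
  also have "\<dots> \<le> (LINT z|lborel. C * (indicator unit_cube z * \<bar>f z - g z\<bar>))"
  proof (rule integral_mono)
    have *: "integrable lborel (\<lambda>z. C * (indicator unit_cube z * \<bar>f z - g z\<bar>))"
      using i by (simp add: set_integrable_def)
    then show "integrable lborel (\<lambda>z. p z * (indicator unit_cube z * \<bar>f z - g z\<bar>))"
    proof (rule Bochner_Integration.integrable_bound)
      show "AE z in lborel. norm (p z * (indicator unit_cube z * \<bar>f z - g z\<bar>)) \<le> norm (C * (indicator unit_cube z * \<bar>f z - g z\<bar>))"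
        using p by (intro AE_I2) (auto simp: abs_mult intro!: mult_right_mono order_trans[OF p(2) abs_ge_self])
    qed measurable
    show "p z * (indicator unit_cube z * \<bar>f z - g z\<bar>) \<le> C * (indicator unit_cube z * \<bar>f z - g z\<bar>)" for z
      using p by (intro mult_right_mono) auto
  qed (use i in \<open>simp add: set_integrable_def\<close>)
  also have "\<dots> = C * L1_dist lborel f g" by (simp add: L1_dist_def set_lebesgue_integral_def)
  finally show ?thesis .
qed

definition path_L1_dist :: "nat \<Rightarrow> (real ^ 'm \<Rightarrow> real ^ 'd) \<Rightarrow> (real ^ 'd \<Rightarrow> real) \<Rightarrow> (real ^ 'd \<Rightarrow> real) \<Rightarrow> real" where
  "path_L1_dist n z f g = (LINT x:window n|lborel. \<bar>f (z x) - g (z x)\<bar>) / real n"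

text \<open>One constant serves all pairs of intensities with \<open>C\<^sup>1\<close> norm at most \<open>L\<close> and all smoothing
  parameters \<open>e\<close>. The path average and the \<open>\<nu>\<close>-integral of the smoothed distance both exceed those of
  \<open>\<bar>\<rho> - \<rho>'\<bar>\<close> by an amount in \<open>[0, e]\<close>, so the smoothing costs only \<open>e\<close> in the deviation.\<close>

lemma path_L1_dist_concentration:
  fixes M :: "'w measure" and Z :: "'w \<Rightarrow> real ^ 'm \<Rightarrow> real ^ 'd"
  assumes field: "covariate_field M Z" and ergodic: "ergodic_covariates M Z \<nu>" and L: "0 \<le> L"
  obtains K where "K > 0"
    "\<And>\<rho> \<rho>' e t n. \<rho> \<in> C1_intensities \<Longrightarrow> \<rho>' \<in> C1_intensities \<Longrightarrow> C1_norm \<rho> \<le> L \<Longrightarrow> C1_norm \<rho>' \<le> L \<Longrightarrow>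
      0 < e \<Longrightarrow> e \<le> 1 \<Longrightarrow> 0 < t \<Longrightarrow> n \<ge> 1 \<Longrightarrow>
      measure M {\<omega> \<in> space M. t + e < \<bar>path_L1_dist n (Z \<omega>) \<rho> \<rho>' - L1_dist \<nu> \<rho> \<rho>'\<bar>} \<le> exp (- K * (real n * t\<^sup>2))"
proof -
  define K\<^sub>1 where "K\<^sub>1 = 2 * L + 1 + real CARD('d) * (2 * L)"
  have "K\<^sub>1 > 0" using L by (simp add: K\<^sub>1_def add_pos_nonneg)
  then obtain K where K: "K > 0" and conc: "\<And>f t n. f \<in> borel_measurable borel \<Longrightarrow> W1inf_norm f \<le> ereal K\<^sub>1 \<Longrightarrow> t > 0 \<Longrightarrow> n \<ge> 1 \<Longrightarrow>
     measure (covariate_law M Z n)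
             {z \<in> Linf (window n).
                t < \<bar>(LINT x:window n|lborel. f (z x)) / measure lborel (window n :: (real ^ 'm) set)
                     - (LINT u:unit_cube|\<nu>. f u)\<bar>}
           \<le> exp (- K * measure lborel (window n :: (real ^ 'm) set) * t\<^sup>2)"
  proof -
    have "\<exists>K>0. \<forall>f\<in>borel_measurable borel. W1inf_norm f \<le> ereal K\<^sub>1 \<longrightarrow>
        (\<forall>t>0. \<forall>n\<ge>1.
           measure (covariate_law M Z n)
             {z \<in> Linf (window n).
                t < \<bar>(LINT x:window n|lborel. f (z x)) / measure lborel (window n :: (real ^ 'm) set)
                     - (LINT u:unit_cube|\<nu>. f u)\<bar>}
           \<le> exp (- K * measure lborel (window n :: (real ^ 'm) set) * t\<^sup>2))"
      using ergodic \<open>K\<^sub>1 > 0\<close> unfolding ergodic_covariates_def by (elim conjE allE impE)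
    then show ?thesis using that by blast
  qed
  show ?thesis
  proof (rule that[OF K])
    fix \<rho> \<rho>' :: "real ^ 'd \<Rightarrow> real" and e t :: real and n :: nat
    assume C1: "\<rho> \<in> C1_intensities" "\<rho>' \<in> C1_intensities" and nL: "C1_norm \<rho> \<le> L" "C1_norm \<rho>' \<le> L"
      and e: "0 < e" "e \<le> 1" and t: "0 < t" and n: "n \<ge> 1"
    interpret prob_space M using field by (simp add: covariate_field_def)
    let ?f = "smooth_abs_diff e \<rho> \<rho>'"
    note [measurable] = C1_intensities_measurable[OF C1(1)] C1_intensities_measurable[OF C1(2)]
    have fm[measurable]: "?f \<in> borel_measurable borel"
      using smooth_abs_diff_continuous[OF C1] by (intro borel_measurable_continuous_onI uniformly_continuous_imp_continuous)
    have ZL: "Z \<in> measurable M (Linf_borel (window n))" using field n by (auto simp: covariate_field_def)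
    let ?m = "LINT u:unit_cube|\<nu>. ?f u"
    let ?E = "{\<omega> \<in> space M. t < \<bar>(LINT x:window n|lborel. ?f (Z \<omega> x)) / real n - ?m\<bar>}"
    have "measure M ?E \<le> exp (- K * measure lborel (window n :: (real ^ 'm) set) * t\<^sup>2)"
      by (rule covariate_concentration[OF ZL n smooth_abs_diff_continuous[OF C1] smooth_abs_diff_W1inf(1)[OF C1 nL e]])
        (rule conc[OF fm smooth_abs_diff_W1inf(2)[OF C1 nL e, folded K\<^sub>1_def] t n])
    then have E: "measure M ?E \<le> exp (- K * (real n * t\<^sup>2))" by (simp add: measure_window[OF n] mult.assoc)
    have jm: "(\<lambda>(\<omega>, x). Z \<omega> x) \<in> borel_measurable (M \<Otimes>\<^sub>M borel)" using field by (simp add: covariate_field_def)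
    have Zc: "Z \<omega> x \<in> unit_cube" if "\<omega> \<in> space M" for \<omega> x using field that unfolding covariate_field_def by blast
    have Zm: "(\<lambda>(\<omega>, x). indicator (window n) x *\<^sub>R ?f (Z \<omega> x)) \<in> borel_measurable (M \<Otimes>\<^sub>M lborel)"
      using measurable_compose[OF jm fm] by (auto simp: case_prod_unfold)
    have "(\<lambda>\<omega>. LINT x:window n|lborel. ?f (Z \<omega> x)) \<in> borel_measurable M"
      unfolding set_lebesgue_integral_def by (rule lborel.borel_measurable_lebesgue_integral[OF Zm])
    then have Es: "?E \<in> sets M" by measurable
    have psn: "prob_space \<nu>" and sn: "sets \<nu> = sets borel"
    proof -
      have d: "distr M borel (\<lambda>\<omega>. Z \<omega> 0) = \<nu>" using ergodic by (simp add: ergodic_covariates_def)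
      have "(\<lambda>\<omega>. Z \<omega> 0) \<in> borel_measurable M"
        using measurable_compose[OF measurable_Pair[OF measurable_ident_sets[OF refl] measurable_const[of 0]] jm] by simp
      then show "prob_space \<nu>" using prob_space_distr d by metis
      show "sets \<nu> = sets borel" using d by auto
    qed
    interpret \<nu>: prob_space \<nu> by (rule psn)
    define g where "g z = \<bar>\<rho> z - \<rho>' z\<bar>" for z
    have gm[measurable]: "g \<in> borel_measurable borel" unfolding g_def by measurable
    have fg: "g z \<le> ?f z" "?f z \<le> g z + e" "\<bar>?f z\<bar> \<le> 2 * L + 1" "\<bar>g z\<bar> \<le> 2 * L + 1" "\<bar>g z + e\<bar> \<le> 2 * L + 1 + 1" if "z \<in> unit_cube" for z
    proof -
      show a: "g z \<le> ?f z" "?f z \<le> g z + e"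
        using smooth_abs_diff_bounds[where e=e and f=\<rho> and g=\<rho>' and z=z] that e by (auto simp: g_def)
      show b: "\<bar>?f z\<bar> \<le> 2 * L + 1" by (rule smooth_abs_diff_W1inf(1)[OF C1 nL e])
      show "\<bar>g z\<bar> \<le> 2 * L + 1" "\<bar>g z + e\<bar> \<le> 2 * L + 1 + 1" using a b e by (auto simp: g_def)
    qed
    have n1: "L1_dist \<nu> \<rho> \<rho>' \<le> ?m" "?m \<le> L1_dist \<nu> \<rho> \<rho>' + e"
    proof -
      have fin: "emeasure \<nu> unit_cube < \<infinity>" by (simp add: less_top[symmetric])
      have if': "set_integrable \<nu> unit_cube ?f" and ig: "set_integrable \<nu> unit_cube g" and ie: "set_integrable \<nu> unit_cube (\<lambda>_. e)"
        using fg e by (auto intro!: cube_integrable[OF fin sn])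
      have Lg: "L1_dist \<nu> \<rho> \<rho>' = (LINT z:unit_cube|\<nu>. g z)" by (simp add: L1_dist_def g_def)
      show "L1_dist \<nu> \<rho> \<rho>' \<le> ?m" unfolding Lg by (rule set_integral_mono[OF ig if']) (rule fg)
      have "?m \<le> (LINT z:unit_cube|\<nu>. g z + e)"
        by (rule set_integral_mono[OF if' set_integral_add(1)[OF ig ie]]) (rule fg)
      also have "\<dots> = (LINT z:unit_cube|\<nu>. g z) + (LINT z:unit_cube|\<nu>. e)" by (rule set_integral_add(2)[OF ig ie])
      also have "(LINT z:unit_cube|\<nu>. e) = e * measure \<nu> unit_cube" by (simp add: set_lebesgue_integral_def sn mult.commute)
      also have "\<dots> \<le> e" using e by (simp add: mult_left_le)
      finally show "?m \<le> L1_dist \<nu> \<rho> \<rho>' + e" by (simp add: Lg)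
    qed
    have n2: "path_L1_dist n (Z \<omega>) \<rho> \<rho>' \<le> (LINT x:window n|lborel. ?f (Z \<omega> x)) / real n"
      "(LINT x:window n|lborel. ?f (Z \<omega> x)) / real n \<le> path_L1_dist n (Z \<omega>) \<rho> \<rho>' + e" if \<omega>: "\<omega> \<in> space M" for \<omega>
    proof -
      have Zp[measurable]: "Z \<omega> \<in> borel_measurable borel"
        using measurable_compose[OF measurable_Pair[OF measurable_const[OF \<omega>] measurable_ident_sets[OF refl]] jm] by simp
      have if': "set_integrable lborel (window n) (\<lambda>x. ?f (Z \<omega> x))" and ig: "set_integrable lborel (window n) (\<lambda>x. g (Z \<omega> x))"
        and ie: "set_integrable lborel (window n :: (real ^ 'm) set) (\<lambda>x. e)"
        using fg[OF Zc[OF \<omega>]] by (auto intro!: window_integrable)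
      have Lg: "path_L1_dist n (Z \<omega>) \<rho> \<rho>' = (LINT x:window n|lborel. g (Z \<omega> x)) / real n" by (simp add: path_L1_dist_def g_def)
      show "path_L1_dist n (Z \<omega>) \<rho> \<rho>' \<le> (LINT x:window n|lborel. ?f (Z \<omega> x)) / real n" unfolding Lg
        using window_integral_mono[OF ig if'] fg(1)[OF Zc[OF \<omega>]] by (intro divide_right_mono) auto
      have "(LINT x:window n|lborel. ?f (Z \<omega> x)) \<le> (LINT x:window n|lborel. g (Z \<omega> x) + e)"
        by (rule window_integral_mono[OF if' set_integral_add(1)[OF ig ie]]) (rule fg(2)[OF Zc[OF \<omega>]])
      also have "\<dots> = (LINT x:window n|lborel. g (Z \<omega> x)) + real n * e"
        by (simp add: set_integral_add(2)[OF ig ie] window_integral_const[OF n])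
      finally show "(LINT x:window n|lborel. ?f (Z \<omega> x)) / real n \<le> path_L1_dist n (Z \<omega>) \<rho> \<rho>' + e"
        using n by (simp add: Lg field_simps)
    qed
    have "{\<omega> \<in> space M. t + e < \<bar>path_L1_dist n (Z \<omega>) \<rho> \<rho>' - L1_dist \<nu> \<rho> \<rho>'\<bar>} \<subseteq> ?E"
    proof safe
      fix \<omega> assume \<omega>: "\<omega> \<in> space M" and "t + e < \<bar>path_L1_dist n (Z \<omega>) \<rho> \<rho>' - L1_dist \<nu> \<rho> \<rho>'\<bar>"
      then show "t < \<bar>(LINT x:window n|lborel. ?f (Z \<omega> x)) / real n - ?m\<bar>" using n1 n2[OF \<omega>] by linarith
    qed
    then show "measure M {\<omega> \<in> space M. t + e < \<bar>path_L1_dist n (Z \<omega>) \<rho> \<rho>' - L1_dist \<nu> \<rho> \<rho>'\<bar>} \<le> exp (- K * (real n * t\<^sup>2))"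
      using E by (rule order_trans[OF finite_measure_mono[OF _ Es]])
  qed
qed

section \<open>The posterior at a fixed sample size\<close>

context cox_model begin

lemma Z_clamp: "\<omega> \<in> space M \<Longrightarrow> clamp 0 1 (Z \<omega> x) = Z \<omega> x"
  by (rule clamp_cube_cancel[OF Z_cube])

lemma C1_path_integrable: "\<omega> \<in> space M \<Longrightarrow> \<rho> \<in> C1_intensities \<Longrightarrow> set_integrable lborel (window n) (\<lambda>x. \<rho> (Z \<omega> x))"
proof -
  assume \<omega>: "\<omega> \<in> space M" and \<rho>: "\<rho> \<in> C1_intensities"
  obtain b where b: "\<And>z. z \<in> unit_cube \<Longrightarrow> \<rho> z \<le> b" "b > 0" using C1_bound[OF \<rho>] by metis
  show ?thesis using b C1_intensities_nonneg[OF \<rho>]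
    by (intro path_integrable[where B=b] \<omega> C1_intensities_measurable \<rho>) auto
qed

lemma likelihood_eq_ratio:
  assumes \<omega>: "\<omega> \<in> space M" and \<rho>: "\<rho> \<in> C1_intensities"
  shows "likelihood n N (Z \<omega>) \<rho> = likelihood n N (Z \<omega>) \<rho>\<^sub>0 * likelihood_ratio n \<rho>\<^sub>0 N (Z \<omega>) \<rho>"
proof -
  have one: "set_integrable lborel (window n :: (real ^ 'm) set) (\<lambda>x. 1 :: real)"
    by (rule window_integrable[where B=1]) auto
  note i = C1_path_integrable[OF \<omega> \<rho>] C1_path_integrable[OF \<omega> \<rho>\<^sub>0_C1]
  have "(LINT x:window n|lborel. (\<rho> (Z \<omega> x) - 1)) =
    (LINT x:window n|lborel. (\<rho>\<^sub>0 (Z \<omega> x) - 1)) + (LINT x:window n|lborel. (\<rho> (Z \<omega> x) - \<rho>\<^sub>0 (Z \<omega> x)))"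
    by (simp add: set_integral_diff(2)[OF i(1) one] set_integral_diff(2)[OF i(2) one] set_integral_diff(2)[OF i])
  moreover have "(\<Prod>k<fst N. \<rho> (Z \<omega> (snd N k))) = (\<Prod>k<fst N. \<rho>\<^sub>0 (Z \<omega> (snd N k))) * (\<Prod>k<fst N. \<rho> (Z \<omega> (snd N k)) / \<rho>\<^sub>0 (Z \<omega> (snd N k)))"
    using \<rho>\<^sub>0_pos[OF Z_cube[OF \<omega>]] by (subst prod.distrib[symmetric], intro prod.cong refl) (metis less_irrefl nonzero_mult_div_cancel_left times_divide_eq_right)
  ultimately show ?thesis by (simp add: likelihood_def likelihood_ratio_def exp_add[symmetric])
qed

lemma likelihood_truth_pos: "\<omega> \<in> space M \<Longrightarrow> 0 < likelihood n N (Z \<omega>) \<rho>\<^sub>0"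
  unfolding likelihood_def using \<rho>\<^sub>0_pos[OF Z_cube] by (intro mult_pos_pos prod_pos) auto

lemma likelihood_ratio_nonneg:
  "\<omega> \<in> space M \<Longrightarrow> \<rho> \<in> C1_intensities \<Longrightarrow> 0 \<le> likelihood_ratio n \<rho>\<^sub>0 N (Z \<omega>) \<rho>"
  unfolding likelihood_ratio_def using \<rho>\<^sub>0_pos[OF Z_cube] C1_intensities_nonneg[OF _ Z_cube]
  by (intro mult_nonneg_nonneg prod_nonneg) (auto intro!: divide_nonneg_pos)

lemma likelihood_ratio_pos:
  "\<omega> \<in> space M \<Longrightarrow> (\<And>z. z \<in> unit_cube \<Longrightarrow> 0 < \<rho> z) \<Longrightarrow> 0 < likelihood_ratio n \<rho>\<^sub>0 N (Z \<omega>) \<rho>"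
  unfolding likelihood_ratio_def using \<rho>\<^sub>0_pos[OF Z_cube] Z_cube
  by (intro mult_pos_pos prod_pos) (auto intro!: divide_pos_pos)

lemma likelihood_ratio_measurable:
  assumes N[measurable]: "N \<in> measurable A points_space" and w[measurable]: "w \<in> measurable A M"
    and r[measurable]: "r \<in> measurable A intensity_borel"
  shows "(\<lambda>a. likelihood_ratio n \<rho>\<^sub>0 (N a) (Z (w a)) (r a)) \<in> borel_measurable A"
proof -
  have pt: "(\<lambda>a. snd (N a) k) \<in> borel_measurable A" for k
    using measurable_compose[OF N, of "\<lambda>p. snd p k" borel] by simp
  have ev: "(\<lambda>a. r a (clamp 0 1 (Z (w a) (snd (N a) k))) / \<rho>\<^sub>0 (Z (w a) (snd (N a) k))) \<in> borel_measurable A" for k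
    by (intro borel_measurable_divide evaluation_measurable_compose r Z_joint_compose w pt
        measurable_compose[OF _ \<rho>\<^sub>0_measurable])
  have pr: "(\<lambda>a. \<Prod>k<fst (N a). r a (clamp 0 1 (Z (w a) (snd (N a) k))) / \<rho>\<^sub>0 (Z (w a) (snd (N a) k))) \<in> borel_measurable A"
    by (rule measurable_compose_countable[where f="\<lambda>j a. \<Prod>k<j. r a (clamp 0 1 (Z (w a) (snd (N a) k))) / \<rho>\<^sub>0 (Z (w a) (snd (N a) k))" and g="\<lambda>a. fst (N a)"])
      (auto intro: borel_measurable_prod ev measurable_compose[OF N measurable_fst])
  have Zx: "(\<lambda>p. Z (w (fst p)) (snd p)) \<in> borel_measurable (A \<Otimes>\<^sub>M lborel)"
    by (intro Z_joint_compose measurable_compose[OF measurable_fst w]) simp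
  have "(\<lambda>(a, x). indicator (window n) x *\<^sub>R (r a (clamp 0 1 (Z (w a) x)) - \<rho>\<^sub>0 (Z (w a) x))) \<in> borel_measurable (A \<Otimes>\<^sub>M lborel)"
    unfolding case_prod_unfold
    using evaluation_measurable_compose[OF measurable_compose[OF measurable_fst r] Zx]
      measurable_compose[OF Zx \<rho>\<^sub>0_measurable] by measurable
  then have "(\<lambda>a. LINT x:window n|lborel. (r a (clamp 0 1 (Z (w a) x)) - \<rho>\<^sub>0 (Z (w a) x))) \<in> borel_measurable A"
    unfolding set_lebesgue_integral_def by (rule lborel.borel_measurable_lebesgue_integral)
  with pr have "(\<lambda>a. (\<Prod>k<fst (N a). r a (clamp 0 1 (Z (w a) (snd (N a) k))) / \<rho>\<^sub>0 (Z (w a) (snd (N a) k))) *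
      exp (- (LINT x:window n|lborel. (r a (clamp 0 1 (Z (w a) x)) - \<rho>\<^sub>0 (Z (w a) x))))) \<in> borel_measurable A"
    by measurable
  then show ?thesis
    unfolding likelihood_ratio_def using measurable_space[OF w] by (simp add: Z_clamp cong: measurable_cong)
qed

lemma exp_statistic_measurable:
  assumes N[measurable]: "N \<in> measurable A points_space" and w[measurable]: "w \<in> measurable A M"
    and s[measurable]: "s \<in> borel_measurable borel"
  shows "(\<lambda>a. exp_statistic n \<rho>\<^sub>0 s \<theta> (N a) (Z (w a))) \<in> borel_measurable A"
proof -
  have pt: "(\<lambda>a. snd (N a) k) \<in> borel_measurable A" for k
    using measurable_compose[OF N, of "\<lambda>p. snd p k" borel] by simp
  have ev: "(\<lambda>a. exp (\<theta> * s (Z (w a) (snd (N a) k)))) \<in> borel_measurable A" for k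
    using measurable_compose[OF Z_joint_compose[OF w pt] s] by measurable
  have [measurable]: "(\<lambda>a. \<Prod>k<fst (N a). exp (\<theta> * s (Z (w a) (snd (N a) k)))) \<in> borel_measurable A"
    by (rule measurable_compose_countable[where f="\<lambda>j a. \<Prod>k<j. exp (\<theta> * s (Z (w a) (snd (N a) k)))" and g="\<lambda>a. fst (N a)"])
      (auto intro: borel_measurable_prod ev measurable_compose[OF N measurable_fst])
  have Zx[measurable]: "(\<lambda>p. Z (w (fst p)) (snd p)) \<in> borel_measurable (A \<Otimes>\<^sub>M lborel)"
    by (intro Z_joint_compose measurable_compose[OF measurable_fst w]) simp
  have "(\<lambda>(a, x). indicator (window n) x *\<^sub>R (\<theta> * s (Z (w a) x) * \<rho>\<^sub>0 (Z (w a) x))) \<in> borel_measurable (A \<Otimes>\<^sub>M lborel)"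
    unfolding case_prod_unfold by measurable
  then have [measurable]: "(\<lambda>a. LINT x:window n|lborel. \<theta> * s (Z (w a) x) * \<rho>\<^sub>0 (Z (w a) x)) \<in> borel_measurable A"
    unfolding set_lebesgue_integral_def by (rule lborel.borel_measurable_lebesgue_integral)
  show ?thesis unfolding exp_statistic_def by measurable
qed

lemma path_L1_dist_measurable:
  assumes "\<rho> \<in> C1_intensities" "\<rho>' \<in> C1_intensities"
  shows "(\<lambda>\<omega>. path_L1_dist n (Z \<omega>) \<rho> \<rho>') \<in> borel_measurable M"
proof -
  note [measurable] = C1_intensities_measurable[OF assms(1)] C1_intensities_measurable[OF assms(2)]
  have "(\<lambda>(\<omega>, x). indicator (window n) x *\<^sub>R \<bar>\<rho> (Z \<omega> x) - \<rho>' (Z \<omega> x)\<bar>) \<in> borel_measurable (M \<Otimes>\<^sub>M lborel)"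
    unfolding case_prod_unfold by measurable
  then have [measurable]: "(\<lambda>\<omega>. LINT x:window n|lborel. \<bar>\<rho> (Z \<omega> x) - \<rho>' (Z \<omega> x)\<bar>) \<in> borel_measurable M"
    unfolding set_lebesgue_integral_def by (rule lborel.borel_measurable_lebesgue_integral)
  show ?thesis unfolding path_L1_dist_def by measurable
qed

lemma sets_observation [measurable_cong]: "sets (observation_law M Z n \<rho>\<^sub>0) = sets (points_space \<Otimes>\<^sub>M M)"
  unfolding observation_law_def by (rule sets_bind) (auto simp: not_empty)

lemma sigma_finite_observation: "sigma_finite_measure (observation_law M Z n \<rho>\<^sub>0)"
proof -
  interpret O: subprob_space "observation_law M Z n \<rho>\<^sub>0"
    unfolding observation_law_def
    by (rule subprob_space_bind[OF prob_space_imp_subprob_space[OF prob_space_axioms] observation_kernel])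
  show ?thesis by unfold_locales
qed

definition test_sign :: "(real ^ 'd \<Rightarrow> real) \<Rightarrow> real ^ 'd \<Rightarrow> real" where
  "test_sign \<rho>' z = sgn (\<rho>' z - \<rho>\<^sub>0 z)"

lemma test_sign_measurable: "\<rho>' \<in> C1_intensities \<Longrightarrow> test_sign \<rho>' \<in> borel_measurable borel"
  using C1_intensities_measurable[of \<rho>'] unfolding test_sign_def[abs_def] by measurable

lemma test_sign_le: "\<bar>test_sign \<rho>' z\<bar> \<le> 1" by (simp add: test_sign_def sgn_if)

text \<open>Pointwise \<open>s (\<rho> - \<rho>\<^sub>0) = \<bar>\<rho>' - \<rho>\<^sub>0\<bar> + s (\<rho> - \<rho>')\<close>, which is at least
  \<open>\<bar>\<rho> - \<rho>\<^sub>0\<bar> - 2 \<bar>\<rho> - \<rho>'\<bar>\<close>.\<close>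

lemma expected_test_statistic:
  assumes \<omega>: "\<omega> \<in> space M" and \<rho>: "\<rho> \<in> C1_intensities" and \<rho>': "\<rho>' \<in> C1_intensities"
    and \<theta>: "0 \<le> \<theta>" "\<theta> \<le> 1" and L: "\<And>z. z \<in> unit_cube \<Longrightarrow> \<rho> z \<le> L" "0 \<le> L"
    and sep: "\<delta> \<le> path_L1_dist n (Z \<omega>) \<rho> \<rho>\<^sub>0 - 2 * path_L1_dist n (Z \<omega>) \<rho> \<rho>'"
  shows "(\<integral>\<^sup>+N. ennreal (likelihood_ratio n \<rho>\<^sub>0 N (Z \<omega>) \<rho> * exp_statistic n \<rho>\<^sub>0 (test_sign \<rho>') (- \<theta>) N (Z \<omega>)) \<partial>poisson_process_law n \<rho>\<^sub>0 (Z \<omega>))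
     \<le> ennreal (exp (real n * (L * \<theta>\<^sup>2 - \<theta> * \<delta>)))"
proof -
  let ?z = "Z \<omega>"
  note i = C1_path_integrable[OF \<omega> \<rho>] C1_path_integrable[OF \<omega> \<rho>\<^sub>0_C1] C1_path_integrable[OF \<omega> \<rho>']
  have d0: "set_integrable lborel (window n) (\<lambda>x. \<bar>\<rho> (?z x) - \<rho>\<^sub>0 (?z x)\<bar>)"
    and d1: "set_integrable lborel (window n) (\<lambda>x. \<bar>\<rho> (?z x) - \<rho>' (?z x)\<bar>)"
    by (rule set_integrable_abs[OF set_integral_diff(1)[OF i(1) i(2)]]) (rule set_integrable_abs[OF set_integral_diff(1)[OF i(1) i(3)]])
  have d1': "set_integrable lborel (window n) (\<lambda>x. 2 * \<bar>\<rho> (?z x) - \<rho>' (?z x)\<bar>)" using d1 by simp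
  note d = set_integral_diff(1)[OF d0 d1']
  have d': "set_integrable lborel (window n) (\<lambda>x. \<theta> * (\<bar>\<rho> (?z x) - \<rho>\<^sub>0 (?z x)\<bar> - 2 * \<bar>\<rho> (?z x) - \<rho>' (?z x)\<bar>))" using d by simp
  have c: "set_integrable lborel (window n :: (real ^ 'm) set) (\<lambda>x. L * \<theta>\<^sup>2)"
    by (rule window_integrable[where B="\<bar>L * \<theta>\<^sup>2\<bar>"]) auto
  have sm: "(\<lambda>x. test_sign \<rho>' (?z x)) \<in> borel_measurable borel"
    by (rule measurable_compose[OF Z_path[OF \<omega>] test_sign_measurable[OF \<rho>']])
  have s': "set_integrable lborel (window n) (\<lambda>x. \<theta> * (test_sign \<rho>' (?z x) * (\<rho> (?z x) - \<rho>\<^sub>0 (?z x))))"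
    unfolding set_integrable_def
  proof (rule Bochner_Integration.integrable_bound)
    show "integrable lborel (\<lambda>x. indicator (window n) x *\<^sub>R (\<theta> * \<bar>\<rho> (?z x) - \<rho>\<^sub>0 (?z x)\<bar>))"
      using d0 set_integrable_mult_right[of \<theta>] by (simp add: set_integrable_def)
    have "\<bar>test_sign \<rho>' z * (\<rho> z - \<rho>\<^sub>0 z)\<bar> \<le> \<bar>\<rho> z - \<rho>\<^sub>0 z\<bar>" for z
      using mult_right_mono[OF test_sign_le[of \<rho>' z], of "\<bar>\<rho> z - \<rho>\<^sub>0 z\<bar>"] by (simp add: abs_mult)
    then show "AE x in lborel. norm (indicator (window n) x *\<^sub>R (\<theta> * (test_sign \<rho>' (?z x) * (\<rho> (?z x) - \<rho>\<^sub>0 (?z x))))) \<le>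
      norm (indicator (window n) x *\<^sub>R (\<theta> * \<bar>\<rho> (?z x) - \<rho>\<^sub>0 (?z x)\<bar>))"
      using \<theta>(1) by (intro AE_I2) (auto simp: abs_mult indicator_def intro!: mult_left_mono)
    show "(\<lambda>x. indicator (window n) x *\<^sub>R (\<theta> * (test_sign \<rho>' (?z x) * (\<rho> (?z x) - \<rho>\<^sub>0 (?z x))))) \<in> borel_measurable lborel"
      using sm measurable_compose[OF Z_path[OF \<omega>] C1_intensities_measurable[OF \<rho>]]
        measurable_compose[OF Z_path[OF \<omega>] \<rho>\<^sub>0_measurable]
      by (intro borel_measurable_scaleR borel_measurable_times borel_measurable_diff borel_measurable_const) auto
  qed
  have "(\<integral>\<^sup>+N. ennreal (likelihood_ratio n \<rho>\<^sub>0 N ?z \<rho> * exp_statistic n \<rho>\<^sub>0 (test_sign \<rho>') (- \<theta>) N ?z) \<partial>poisson_process_law n \<rho>\<^sub>0 ?z)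
     \<le> ennreal (exp (LINT x:window n|lborel. L * \<theta>\<^sup>2 - \<theta> * (test_sign \<rho>' (?z x) * (\<rho> (?z x) - \<rho>\<^sub>0 (?z x)))))"
    by (rule expected_statistic_alternative[OF \<omega> test_sign_measurable[OF \<rho>'] test_sign_le \<theta> \<rho> L])
  also have "\<dots> \<le> ennreal (exp (LINT x:window n|lborel. L * \<theta>\<^sup>2 - \<theta> * (\<bar>\<rho> (?z x) - \<rho>\<^sub>0 (?z x)\<bar> - 2 * \<bar>\<rho> (?z x) - \<rho>' (?z x)\<bar>)))"
  proof (intro ennreal_leI exp_le_cancel_iff[THEN iffD2] window_integral_mono set_integral_diff(1)[OF c s'] set_integral_diff(1)[OF c d'])
    fix x
    have "\<bar>\<rho> (?z x) - \<rho>\<^sub>0 (?z x)\<bar> - 2 * \<bar>\<rho> (?z x) - \<rho>' (?z x)\<bar> \<le> test_sign \<rho>' (?z x) * (\<rho> (?z x) - \<rho>\<^sub>0 (?z x))"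
      unfolding test_sign_def sgn_if abs_if by auto
    then show "L * \<theta>\<^sup>2 - \<theta> * (test_sign \<rho>' (?z x) * (\<rho> (?z x) - \<rho>\<^sub>0 (?z x))) \<le>
       L * \<theta>\<^sup>2 - \<theta> * (\<bar>\<rho> (?z x) - \<rho>\<^sub>0 (?z x)\<bar> - 2 * \<bar>\<rho> (?z x) - \<rho>' (?z x)\<bar>)"
      using \<theta>(1) by (simp add: mult_left_mono)
  qed
  also have "(LINT x:window n|lborel. L * \<theta>\<^sup>2 - \<theta> * (\<bar>\<rho> (?z x) - \<rho>\<^sub>0 (?z x)\<bar> - 2 * \<bar>\<rho> (?z x) - \<rho>' (?z x)\<bar>))
     = real n * (L * \<theta>\<^sup>2 - \<theta> * (path_L1_dist n ?z \<rho> \<rho>\<^sub>0 - 2 * path_L1_dist n ?z \<rho> \<rho>'))"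
  proof -
    have D: "(LINT x:window n|lborel. \<bar>\<rho> (?z x) - \<rho>\<^sub>0 (?z x)\<bar> - 2 * \<bar>\<rho> (?z x) - \<rho>' (?z x)\<bar>)
       = real n * path_L1_dist n ?z \<rho> \<rho>\<^sub>0 - 2 * (real n * path_L1_dist n ?z \<rho> \<rho>')"
      using n_pos by (simp only: set_integral_diff(2)[OF d0 d1']) (simp add: path_L1_dist_def)
    show ?thesis
      by (simp only: set_integral_diff(2)[OF c d'] set_integral_mult_right D window_integral_const[OF n_pos])
        (simp add: algebra_simps)
  qed
  also have "ennreal (exp (real n * (L * \<theta>\<^sup>2 - \<theta> * (path_L1_dist n ?z \<rho> \<rho>\<^sub>0 - 2 * path_L1_dist n ?z \<rho> \<rho>'))))
     \<le> ennreal (exp (real n * (L * \<theta>\<^sup>2 - \<theta> * \<delta>)))"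
    using sep \<theta>(1) by (intro ennreal_leI exp_le_cancel_iff[THEN iffD2] mult_left_mono diff_left_mono) auto
  finally show ?thesis .
qed

definition test_statistic :: "real \<Rightarrow> (real ^ 'd \<Rightarrow> real) \<Rightarrow> 'm points \<times> 'w \<Rightarrow> real" where
  "test_statistic \<theta> \<rho>' y = exp_statistic n \<rho>\<^sub>0 (test_sign \<rho>') \<theta> (fst y) (Z (snd y))"

definition acceptance :: "real \<Rightarrow> real \<Rightarrow> (real ^ 'd \<Rightarrow> real) set \<Rightarrow> ('m points \<times> 'w) set" where
  "acceptance \<theta> \<tau> J = {y \<in> space (points_space \<Otimes>\<^sub>M M). \<forall>\<rho>'\<in>J. test_statistic \<theta> \<rho>' y \<le> exp \<tau>}"

lemma test_statistic_measurable:
  "\<rho>' \<in> C1_intensities \<Longrightarrow> test_statistic \<theta> \<rho>' \<in> borel_measurable (points_space \<Otimes>\<^sub>M M)"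
  unfolding test_statistic_def[abs_def]
  by (intro exp_statistic_measurable test_sign_measurable) measurable

lemma acceptance_sets:
  assumes "finite J" "J \<subseteq> C1_intensities"
  shows "acceptance \<theta> \<tau> J \<in> sets (points_space \<Otimes>\<^sub>M M)"
  unfolding acceptance_def
proof (rule sets.sets_Collect_finite_All[OF _ assms(1)])
  fix \<rho>' assume "\<rho>' \<in> J"
  then have [measurable]: "test_statistic \<theta> \<rho>' \<in> borel_measurable (points_space \<Otimes>\<^sub>M M)"
    using assms(2) by (intro test_statistic_measurable) auto
  show "{y \<in> space (points_space \<Otimes>\<^sub>M M). test_statistic \<theta> \<rho>' y \<le> exp \<tau>} \<in> sets (points_space \<Otimes>\<^sub>M M)"
    by measurable
qed

text \<open>On paths along which \<open>\<rho>\<close> is separated from \<open>\<rho>\<^sub>0\<close> the test based on \<open>\<rho>'\<close> has a small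
  probability of acceptance; on the other paths the expected ratio is still at most \<open>1\<close>, so they
  contribute at most their probability.\<close>

lemma expected_ratio_accepted:
  assumes J: "finite J" "J \<subseteq> C1_intensities" and \<rho>': "\<rho>' \<in> J" and \<rho>: "\<rho> \<in> C1_intensities"
    and \<theta>: "0 \<le> \<theta>" "\<theta> \<le> 1" and L: "\<And>z. z \<in> unit_cube \<Longrightarrow> \<rho> z \<le> L" "0 \<le> L"
  shows "(\<integral>\<^sup>+y. ennreal (likelihood_ratio n \<rho>\<^sub>0 (fst y) (Z (snd y)) \<rho>) * indicator (acceptance \<theta> \<tau> J) y \<partial>observation_law M Z n \<rho>\<^sub>0)
    \<le> ennreal (exp (\<tau> + real n * (L * \<theta>\<^sup>2 - \<theta> * \<delta>))) +
      ennreal (measure M {\<omega> \<in> space M. path_L1_dist n (Z \<omega>) \<rho> \<rho>\<^sub>0 - 2 * path_L1_dist n (Z \<omega>) \<rho> \<rho>' < \<delta>})"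
proof -
  let ?r = "\<lambda>N \<omega>. likelihood_ratio n \<rho>\<^sub>0 N (Z \<omega>) \<rho>"
  let ?b = "{\<omega> \<in> space M. path_L1_dist n (Z \<omega>) \<rho> \<rho>\<^sub>0 - 2 * path_L1_dist n (Z \<omega>) \<rho> \<rho>' < \<delta>}"
  let ?c = "ennreal (exp (\<tau> + real n * (L * \<theta>\<^sup>2 - \<theta> * \<delta>)))"
  have \<rho>'C: "\<rho>' \<in> C1_intensities" using J \<rho>' by blast
  note [measurable] = acceptance_sets[OF J, of \<theta> \<tau>] path_L1_dist_measurable[OF \<rho> \<rho>\<^sub>0_C1] path_L1_dist_measurable[OF \<rho> \<rho>'C]
  have rm[measurable]: "(\<lambda>y. ?r (fst y) (snd y)) \<in> borel_measurable (points_space \<Otimes>\<^sub>M M)"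
    using \<rho> by (intro likelihood_ratio_measurable) (auto simp: space_intensity_borel)
  have "(\<integral>\<^sup>+y. ennreal (?r (fst y) (snd y)) * indicator (acceptance \<theta> \<tau> J) y \<partial>observation_law M Z n \<rho>\<^sub>0)
    = (\<integral>\<^sup>+\<omega>. \<integral>\<^sup>+N. ennreal (?r N \<omega>) * indicator (acceptance \<theta> \<tau> J) (N, \<omega>) \<partial>poisson_process_law n \<rho>\<^sub>0 (Z \<omega>) \<partial>M)"
    by (subst nn_integral_observation) auto
  also have "\<dots> \<le> (\<integral>\<^sup>+\<omega>. ?c + indicator ?b \<omega> \<partial>M)"
  proof (rule nn_integral_mono)
    fix \<omega> assume \<omega>: "\<omega> \<in> space M"
    show "(\<integral>\<^sup>+N. ennreal (?r N \<omega>) * indicator (acceptance \<theta> \<tau> J) (N, \<omega>) \<partial>poisson_process_law n \<rho>\<^sub>0 (Z \<omega>)) \<le> ?c + indicator ?b \<omega>"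
    proof (cases "\<omega> \<in> ?b")
      case True
      have "(\<integral>\<^sup>+N. ennreal (?r N \<omega>) * indicator (acceptance \<theta> \<tau> J) (N, \<omega>) \<partial>poisson_process_law n \<rho>\<^sub>0 (Z \<omega>))
        \<le> (\<integral>\<^sup>+N. ennreal (?r N \<omega>) \<partial>poisson_process_law n \<rho>\<^sub>0 (Z \<omega>))"
        by (intro nn_integral_mono) (auto simp: indicator_def)
      also have "\<dots> \<le> 1" by (rule expected_likelihood_ratio[OF \<omega> \<rho>])
      also have "\<dots> \<le> ?c + indicator ?b \<omega>" using True by simp
      finally show ?thesis .
    next
      case False
      let ?t = "\<lambda>N. exp_statistic n \<rho>\<^sub>0 (test_sign \<rho>') (- \<theta>) N (Z \<omega>)"
      note [measurable_cong] = sets_poisson_process_law[OF \<omega>]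
      have tm[measurable]: "(\<lambda>N. ?r N \<omega> * ?t N) \<in> borel_measurable (poisson_process_law n \<rho>\<^sub>0 (Z \<omega>))"
        using \<rho> \<omega> by (intro borel_measurable_times likelihood_ratio_measurable exp_statistic_measurable test_sign_measurable \<rho>'C)
          (auto simp: space_intensity_borel)
      have "(\<integral>\<^sup>+N. ennreal (?r N \<omega>) * indicator (acceptance \<theta> \<tau> J) (N, \<omega>) \<partial>poisson_process_law n \<rho>\<^sub>0 (Z \<omega>))
        \<le> (\<integral>\<^sup>+N. ennreal (exp \<tau>) * ennreal (?r N \<omega> * ?t N) \<partial>poisson_process_law n \<rho>\<^sub>0 (Z \<omega>))"
      proof (rule nn_integral_mono)
        fix N :: "'m points"
        show "ennreal (?r N \<omega>) * indicator (acceptance \<theta> \<tau> J) (N, \<omega>) \<le> ennreal (exp \<tau>) * ennreal (?r N \<omega> * ?t N)"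
        proof (cases "(N, \<omega>) \<in> acceptance \<theta> \<tau> J")
          case True
          then have le: "exp_statistic n \<rho>\<^sub>0 (test_sign \<rho>') \<theta> N (Z \<omega>) \<le> exp \<tau>"
            using \<rho>' by (auto simp: acceptance_def test_statistic_def)
          have "1 = ?t N * exp_statistic n \<rho>\<^sub>0 (test_sign \<rho>') \<theta> N (Z \<omega>)" by (simp add: exp_statistic_minus)
          also have "\<dots> \<le> ?t N * exp \<tau>" using le exp_statistic_pos[of n \<rho>\<^sub>0 "test_sign \<rho>'" "- \<theta>" N "Z \<omega>"] by (intro mult_left_mono) auto
          finally have "?r N \<omega> * 1 \<le> ?r N \<omega> * (?t N * exp \<tau>)" by (rule mult_left_mono[OF _ likelihood_ratio_nonneg[OF \<omega> \<rho>]])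
          then show ?thesis using True likelihood_ratio_nonneg[OF \<omega> \<rho>, of N] exp_statistic_pos[of n \<rho>\<^sub>0 "test_sign \<rho>'" "- \<theta>" N "Z \<omega>"]
            by (simp add: ennreal_mult[symmetric] mult.commute mult.left_commute)
        qed simp
      qed
      also have "\<dots> = ennreal (exp \<tau>) * (\<integral>\<^sup>+N. ennreal (?r N \<omega> * ?t N) \<partial>poisson_process_law n \<rho>\<^sub>0 (Z \<omega>))"
        by (rule nn_integral_cmult) measurable
      also have "\<dots> \<le> ennreal (exp \<tau>) * ennreal (exp (real n * (L * \<theta>\<^sup>2 - \<theta> * \<delta>)))"
        using False \<omega> by (intro mult_left_mono expected_test_statistic \<rho> \<rho>'C \<theta> L) auto
      also have "\<dots> = ?c" by (simp add: ennreal_mult[symmetric] exp_add)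
      also have "\<dots> \<le> ?c + indicator ?b \<omega>" by simp
      finally show ?thesis .
    qed
  qed
  also have "\<dots> = ?c + emeasure M ?b"
    by (subst nn_integral_add) (auto simp: emeasure_space_1)
  finally show ?thesis by (simp add: emeasure_eq_measure)
qed

text \<open>Some test rejects only where \<open>exp (- \<tau>)\<close> times its statistic exceeds \<open>1\<close>, so the sum dominates the
  indicator of rejection.\<close>

lemma expected_rejection:
  assumes J: "finite J" "J \<subseteq> C1_intensities" and \<theta>: "0 \<le> \<theta>" "\<theta> \<le> 1"
  shows "(\<integral>\<^sup>+y. (\<Sum>\<rho>'\<in>J. ennreal (exp (- \<tau>) * test_statistic \<theta> \<rho>' y)) \<partial>observation_law M Z n \<rho>\<^sub>0)
     \<le> ennreal (real (card J) * exp (B\<^sub>0 * (real n * \<theta>\<^sup>2) - \<tau>))"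
proof -
  have 1: "(\<integral>\<^sup>+y. ennreal (exp (- \<tau>) * test_statistic \<theta> \<rho>' y) \<partial>observation_law M Z n \<rho>\<^sub>0) \<le> ennreal (exp (B\<^sub>0 * (real n * \<theta>\<^sup>2) - \<tau>))"
    if "\<rho>' \<in> J" for \<rho>'
  proof -
    have C: "\<rho>' \<in> C1_intensities" using that J by blast
    note [measurable] = test_statistic_measurable[OF C, of \<theta>]
    have "(\<integral>\<^sup>+y. ennreal (exp (- \<tau>) * test_statistic \<theta> \<rho>' y) \<partial>observation_law M Z n \<rho>\<^sub>0)
       = ennreal (exp (- \<tau>)) * (\<integral>\<^sup>+y. ennreal (test_statistic \<theta> \<rho>' y) \<partial>observation_law M Z n \<rho>\<^sub>0)"
      by (simp add: ennreal_mult' nn_integral_cmult)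
    also have "(\<integral>\<^sup>+y. ennreal (test_statistic \<theta> \<rho>' y) \<partial>observation_law M Z n \<rho>\<^sub>0)
       = (\<integral>\<^sup>+\<omega>. \<integral>\<^sup>+N. ennreal (exp_statistic n \<rho>\<^sub>0 (test_sign \<rho>') \<theta> N (Z \<omega>)) \<partial>poisson_process_law n \<rho>\<^sub>0 (Z \<omega>) \<partial>M)"
    proof -
      have "(\<lambda>y. ennreal (test_statistic \<theta> \<rho>' y)) \<in> borel_measurable (points_space \<Otimes>\<^sub>M M)" by measurable
      then show ?thesis by (subst nn_integral_observation) (simp_all add: test_statistic_def)
    qed
    also have "\<dots> \<le> (\<integral>\<^sup>+\<omega>. ennreal (exp (B\<^sub>0 * (real n * \<theta>\<^sup>2))) \<partial>M)"
      by (intro nn_integral_mono expected_statistic_null test_sign_measurable C test_sign_le \<theta>)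
    also have "\<dots> = ennreal (exp (B\<^sub>0 * (real n * \<theta>\<^sup>2)))" by (simp add: emeasure_space_1)
    finally have "(\<integral>\<^sup>+y. ennreal (exp (- \<tau>) * test_statistic \<theta> \<rho>' y) \<partial>observation_law M Z n \<rho>\<^sub>0)
       \<le> ennreal (exp (- \<tau>)) * ennreal (exp (B\<^sub>0 * (real n * \<theta>\<^sup>2)))" by (simp add: mult_left_mono)
    also have "\<dots> = ennreal (exp (B\<^sub>0 * (real n * \<theta>\<^sup>2) - \<tau>))" by (simp add: ennreal_mult[symmetric] exp_add[symmetric])
    finally show ?thesis .
  qed
  have "(\<integral>\<^sup>+y. (\<Sum>\<rho>'\<in>J. ennreal (exp (- \<tau>) * test_statistic \<theta> \<rho>' y)) \<partial>observation_law M Z n \<rho>\<^sub>0)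
     = (\<Sum>\<rho>'\<in>J. \<integral>\<^sup>+y. ennreal (exp (- \<tau>) * test_statistic \<theta> \<rho>' y) \<partial>observation_law M Z n \<rho>\<^sub>0)"
  proof (rule nn_integral_sum)
    fix \<rho>' assume "\<rho>' \<in> J"
    then have [measurable]: "test_statistic \<theta> \<rho>' \<in> borel_measurable (points_space \<Otimes>\<^sub>M M)"
      using J by (intro test_statistic_measurable) auto
    show "(\<lambda>y. ennreal (exp (- \<tau>) * test_statistic \<theta> \<rho>' y)) \<in> borel_measurable (observation_law M Z n \<rho>\<^sub>0)" by measurable
  qed
  also have "\<dots> \<le> (\<Sum>\<rho>'\<in>J. ennreal (exp (B\<^sub>0 * (real n * \<theta>\<^sup>2) - \<tau>)))" by (intro sum_mono 1)
  also have "\<dots> = ennreal (real (card J) * exp (B\<^sub>0 * (real n * \<theta>\<^sup>2) - \<tau>))"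
    by (simp add: ennreal_mult ennreal_of_nat_eq_real_of_nat)
  finally show ?thesis .
qed

text \<open>Where some test rejects, the posterior is bounded by \<open>1\<close>; where all accept, by
  \<open>posterior_le_weighted\<close> with \<open>t = exp ((\<kappa> + 1) x)\<close>. This \<open>t\<close> lies strictly between the growth
  \<open>exp (\<kappa> x)\<close> of the expected reciprocal denominator and the decay \<open>exp (- (\<kappa> + 2) x)\<close> of the expected
  numerator, so that both halves are of order \<open>exp (- x)\<close>.\<close>

lemma expected_posterior_le:
  fixes P :: "(real ^ 'd \<Rightarrow> real) measure" and e \<kappa> K L L\<^sub>1 L\<^sub>3 :: real
  defines "x \<equiv> real n * e\<^sup>2"
  defines "\<kappa> \<equiv> 2 / c\<^sub>0 + L\<^sub>1"
  assumes P: "prob_space P" "sets P = sets intensity_borel"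
    and e: "0 < e" "e \<le> 1" "e \<le> c\<^sub>0 / 2"
    and A: "A \<in> sets P" and B: "B \<in> sets P" and R: "R \<in> sets P"
    and Bclose: "\<And>\<rho> z. \<rho> \<in> B \<Longrightarrow> z \<in> unit_cube \<Longrightarrow> \<bar>\<rho> z - \<rho>\<^sub>0 z\<bar> \<le> e"
    and Bmass: "exp (- L\<^sub>1 * x) \<le> measure P B"
    and Rmass: "measure P (C1_intensities - R) \<le> exp (- (\<kappa> + 2) * x)"
    and J: "finite J" "J \<subseteq> C1_intensities" "real (card J) \<le> exp (L\<^sub>3 * x)"
    and L: "0 \<le> L" "\<And>\<rho> z. \<rho> \<in> R \<Longrightarrow> z \<in> unit_cube \<Longrightarrow> \<rho> z \<le> L"
    and sep: "\<And>\<rho>. \<rho> \<in> R \<inter> A \<Longrightarrow> \<exists>\<rho>'\<in>J.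
       measure M {\<omega> \<in> space M. path_L1_dist n (Z \<omega>) \<rho> \<rho>\<^sub>0 - 2 * path_L1_dist n (Z \<omega>) \<rho> \<rho>' < K / 2 * e} \<le> 2 * exp (- (\<kappa> + 2) * x)"
    and K: "L + \<kappa> + 2 \<le> K / 4" "B\<^sub>0 + L\<^sub>3 + 1 \<le> K / 4"
  shows "(\<integral>\<^sup>+(N, \<omega>). posterior P n N (Z \<omega>) A \<partial>observation_law M Z n \<rho>\<^sub>0) \<le> ennreal (4 * exp (- x))"
proof -
  interpret P: prob_space P by (rule P)
  interpret O: sigma_finite_measure "observation_law M Z n \<rho>\<^sub>0" by (rule sigma_finite_observation)
  interpret OP: pair_sigma_finite P "observation_law M Z n \<rho>\<^sub>0" by unfold_locales
  note [measurable_cong] = P(2)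
  note [measurable] = A B R
  have spP: "space P = C1_intensities" using sets_eq_imp_space_eq[OF P(2)] by (simp add: space_intensity_borel)
  have sub: "A \<subseteq> C1_intensities" "B \<subseteq> C1_intensities" "R \<subseteq> C1_intensities"
    using A B R sets.sets_into_space[of _ P] unfolding spP by auto
  let ?O = "observation_law M Z n \<rho>\<^sub>0"
  \<comment> \<open>Half of the drift \<open>K x / 2\<close> that remains under the alternative.\<close>
  define \<tau> where "\<tau> = K / 4 * x"
  define t where "t = exp ((\<kappa> + 1) * x)"
  define m where "m = measure P B"
  define I where "I = acceptance e \<tau> J"
  define r where "r y \<rho> = likelihood_ratio n \<rho>\<^sub>0 (fst y) (Z (snd y)) \<rho>" for y \<rho>
  have x0: "0 \<le> x" by (simp add: x_def)
  have m0: "m > 0" using Bmass exp_gt_zero less_le_trans unfolding m_def by blast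
  have t0: "t > 0" by (simp add: t_def)
  have Im[measurable]: "I \<in> sets (points_space \<Otimes>\<^sub>M M)" unfolding I_def by (rule acceptance_sets[OF J(1,2)])
  have rm[measurable]: "(\<lambda>q. r (f q) (g q)) \<in> borel_measurable S"
    if "f \<in> measurable S (points_space \<Otimes>\<^sub>M M)" "g \<in> measurable S P" for S :: "'s measure" and f g
  proof -
    have g: "g \<in> measurable S intensity_borel" using that(2) measurable_cong_sets[OF refl P(2)] by blast
    show ?thesis unfolding r_def
      by (rule likelihood_ratio_measurable[OF measurable_compose[OF that(1) measurable_fst] measurable_compose[OF that(1) measurable_snd] g])
  qed
  have Bpos: "0 < \<rho> z" if "\<rho> \<in> B" "z \<in> unit_cube" for \<rho> z
    using Bclose[OF that] \<rho>\<^sub>0_lower[OF that(2)] e(3) c\<^sub>0_pos by linarith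
  define F\<^sub>1 where "F\<^sub>1 y = (\<Sum>\<rho>'\<in>J. ennreal (exp (- \<tau>) * test_statistic e \<rho>' y))" for y
  define F\<^sub>2 where "F\<^sub>2 y = (\<integral>\<^sup>+\<rho>. ennreal (r y \<rho>) * indicator I y * indicator A \<rho> \<partial>P)" for y
  define F\<^sub>3 where "F\<^sub>3 y = (\<integral>\<^sup>+\<rho>. ennreal (1 / r y \<rho>) * indicator B \<rho> \<partial>P)" for y
  have pointwise: "posterior P n (fst y) (Z (snd y)) A \<le> F\<^sub>1 y + (ennreal (t / 2) * F\<^sub>2 y + ennreal (1 / (2 * t * m\<^sup>2)) * F\<^sub>3 y)"
    if y: "y \<in> space (points_space \<Otimes>\<^sub>M M)" for y
  proof (cases "y \<in> I")
    case True
    have \<omega>: "snd y \<in> space M" using y by (auto simp: space_pair_measure)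
    have "posterior P n (fst y) (Z (snd y)) A \<le> ennreal (t / 2) * (\<integral>\<^sup>+\<rho>\<in>A. ennreal (r y \<rho>) \<partial>P)
      + ennreal (1 / (2 * t * (measure P B)\<^sup>2)) * (\<integral>\<^sup>+\<rho>\<in>B. ennreal (1 / r y \<rho>) \<partial>P)"
    proof (rule posterior_le_weighted[OF P(1) _ A B _ likelihood_truth_pos[OF \<omega>]])
      show "r y \<in> borel_measurable P" using rm[of "\<lambda>_. y" P "\<lambda>\<rho>. \<rho>"] y by simp
      show "likelihood n (fst y) (Z (snd y)) \<rho> = likelihood n (fst y) (Z (snd y)) \<rho>\<^sub>0 * r y \<rho>" if "\<rho> \<in> space P" for \<rho>
        unfolding r_def using that spP by (intro likelihood_eq_ratio[OF \<omega>]) simp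
      show "0 \<le> r y \<rho>" if "\<rho> \<in> space P" for \<rho>
        unfolding r_def using that spP by (intro likelihood_ratio_nonneg[OF \<omega>]) simp
      show "0 < r y \<rho>" if "\<rho> \<in> B" for \<rho>
        unfolding r_def using Bpos[OF that] by (rule likelihood_ratio_pos[OF \<omega>])
    qed (use m0 t0 in \<open>auto simp: m_def\<close>)
    also have "\<dots> = ennreal (t / 2) * F\<^sub>2 y + ennreal (1 / (2 * t * m\<^sup>2)) * F\<^sub>3 y"
      using True by (simp add: F\<^sub>2_def F\<^sub>3_def m_def)
    also have "\<dots> \<le> F\<^sub>1 y + \<dots>" by simp
    finally show ?thesis .
  next
    case False
    then obtain \<rho>' where \<rho>': "\<rho>' \<in> J" "exp \<tau> < test_statistic e \<rho>' y" using y by (auto simp: I_def acceptance_def not_le)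
    have "exp (- \<tau>) * exp \<tau> \<le> exp (- \<tau>) * test_statistic e \<rho>' y" using \<rho>'(2) by (intro mult_left_mono) auto
    then have "1 \<le> ennreal (exp (- \<tau>) * test_statistic e \<rho>' y)" by (simp add: exp_add[symmetric])
    also have "\<dots> \<le> F\<^sub>1 y" unfolding F\<^sub>1_def using \<rho>'(1) J(1) by (intro member_le_sum) auto
    finally have "posterior P n (fst y) (Z (snd y)) A \<le> F\<^sub>1 y" using posterior_le_1 order_trans by blast
    also have "\<dots> \<le> F\<^sub>1 y + (ennreal (t / 2) * F\<^sub>2 y + ennreal (1 / (2 * t * m\<^sup>2)) * F\<^sub>3 y)" by simp
    finally show ?thesis .
  qed
  have F1m: "F\<^sub>1 \<in> borel_measurable ?O"
  proof -
    have "(\<lambda>y. ennreal (exp (- \<tau>) * test_statistic e \<rho>' y)) \<in> borel_measurable ?O" if "\<rho>' \<in> J" for \<rho>'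
    proof -
      have [measurable]: "test_statistic e \<rho>' \<in> borel_measurable (points_space \<Otimes>\<^sub>M M)"
        using that J by (intro test_statistic_measurable) auto
      show ?thesis by measurable
    qed
    then show ?thesis unfolding F\<^sub>1_def by (intro borel_measurable_sum)
  qed
  have m2: "(\<lambda>(\<rho>, y). ennreal (r y \<rho>) * indicator I y * indicator A \<rho>) \<in> borel_measurable (P \<Otimes>\<^sub>M ?O)"
    and m3: "(\<lambda>(\<rho>, y). ennreal (1 / r y \<rho>) * indicator B \<rho>) \<in> borel_measurable (P \<Otimes>\<^sub>M ?O)"
    by measurable
  have F2m: "F\<^sub>2 \<in> borel_measurable ?O" unfolding F\<^sub>2_def
    by (rule P.borel_measurable_nn_integral) measurable
  have F3m: "F\<^sub>3 \<in> borel_measurable ?O" unfolding F\<^sub>3_def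
    by (rule P.borel_measurable_nn_integral) measurable
  note [measurable] = F1m F2m F3m
  have "(\<integral>\<^sup>+(N, \<omega>). posterior P n N (Z \<omega>) A \<partial>?O) \<le>
      (\<integral>\<^sup>+y. F\<^sub>1 y + (ennreal (t / 2) * F\<^sub>2 y + ennreal (1 / (2 * t * m\<^sup>2)) * F\<^sub>3 y) \<partial>?O)"
    using pointwise sets_eq_imp_space_eq[OF sets_observation]
    by (intro nn_integral_mono) (auto simp: case_prod_unfold)
  also have "\<dots> = (\<integral>\<^sup>+y. F\<^sub>1 y \<partial>?O) + (ennreal (t / 2) * (\<integral>\<^sup>+y. F\<^sub>2 y \<partial>?O) + ennreal (1 / (2 * t * m\<^sup>2)) * (\<integral>\<^sup>+y. F\<^sub>3 y \<partial>?O))"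
    by (simp add: nn_integral_add nn_integral_cmult)
  also have "\<dots> \<le> ennreal (exp (- x)) + (ennreal (t / 2) * ennreal (4 * exp (- (\<kappa> + 2) * x)) + ennreal (1 / (2 * t * m\<^sup>2)) * ennreal (exp (2 / c\<^sub>0 * x) * m))"
  proof (intro add_mono mult_left_mono)
    have "(\<integral>\<^sup>+y. F\<^sub>1 y \<partial>?O) \<le> ennreal (real (card J) * exp (B\<^sub>0 * (real n * e\<^sup>2) - \<tau>))"
      unfolding F\<^sub>1_def using e by (intro expected_rejection J) auto
    also have "\<dots> \<le> ennreal (exp (- x))"
    proof (rule ennreal_leI)
      have "real (card J) * exp (B\<^sub>0 * (real n * e\<^sup>2) - \<tau>) \<le> exp (L\<^sub>3 * x) * exp (B\<^sub>0 * x - \<tau>)"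
        unfolding x_def[symmetric] by (intro mult_right_mono J(3)) auto
      also have "\<dots> = exp ((B\<^sub>0 + L\<^sub>3 - K / 4) * x)" by (simp add: exp_add[symmetric] \<tau>_def algebra_simps)
      also have "\<dots> \<le> exp ((- 1) * x)" using K(2) x0 by (intro exp_le_cancel_iff[THEN iffD2] mult_right_mono) auto
      finally show "real (card J) * exp (B\<^sub>0 * (real n * e\<^sup>2) - \<tau>) \<le> exp (- x)" by simp
    qed
    finally show "(\<integral>\<^sup>+y. F\<^sub>1 y \<partial>?O) \<le> ennreal (exp (- x))" .
  next
    have inner: "(\<integral>\<^sup>+y. ennreal (r y \<rho>) * indicator I y * indicator A \<rho> \<partial>?O) \<le>
        ennreal (3 * exp (- (\<kappa> + 2) * x)) + indicator (C1_intensities - R) \<rho>" if \<rho>: "\<rho> \<in> space P" for \<rho>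
    proof -
      have \<rho>C: "\<rho> \<in> C1_intensities" using \<rho> spP by simp
      consider "\<rho> \<notin> A" | "\<rho> \<in> A" "\<rho> \<notin> R" | "\<rho> \<in> A" "\<rho> \<in> R" by blast
      then show ?thesis
      proof cases
        case 1 then show ?thesis by simp
      next
        case 2
        have "(\<integral>\<^sup>+y. ennreal (r y \<rho>) * indicator I y * indicator A \<rho> \<partial>?O) \<le> (\<integral>\<^sup>+y. ennreal (r y \<rho>) \<partial>?O)"
          by (intro nn_integral_mono) (auto simp: indicator_def)
        also have "\<dots> = (\<integral>\<^sup>+\<omega>. \<integral>\<^sup>+N. ennreal (likelihood_ratio n \<rho>\<^sub>0 N (Z \<omega>) \<rho>) \<partial>poisson_process_law n \<rho>\<^sub>0 (Z \<omega>) \<partial>M)"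
          using rm[of "\<lambda>y. y" "points_space \<Otimes>\<^sub>M M" "\<lambda>_. \<rho>"] \<rho> by (subst nn_integral_observation) (auto simp: r_def)
        also have "\<dots> \<le> (\<integral>\<^sup>+\<omega>. 1 \<partial>M)" by (intro nn_integral_mono expected_likelihood_ratio \<rho>C)
        also have "\<dots> = indicator (C1_intensities - R) \<rho>" using 2 \<rho>C by (simp add: emeasure_space_1)
        also have "\<dots> \<le> ennreal (3 * exp (- (\<kappa> + 2) * x)) + indicator (C1_intensities - R) \<rho>" by simp
        finally show ?thesis .
      next
        case 3
        then obtain \<rho>' where \<rho>': "\<rho>' \<in> J" and bad: "measure M {\<omega> \<in> space M. path_L1_dist n (Z \<omega>) \<rho> \<rho>\<^sub>0 - 2 * path_L1_dist n (Z \<omega>) \<rho> \<rho>' < K / 2 * e} \<le> 2 * exp (- (\<kappa> + 2) * x)"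
          using sep by blast
        have "(\<integral>\<^sup>+y. ennreal (r y \<rho>) * indicator I y * indicator A \<rho> \<partial>?O) = (\<integral>\<^sup>+y. ennreal (likelihood_ratio n \<rho>\<^sub>0 (fst y) (Z (snd y)) \<rho>) * indicator (acceptance e \<tau> J) y \<partial>?O)"
          using 3 by (simp add: r_def I_def)
        also have "\<dots> \<le> ennreal (exp (\<tau> + real n * (L * e\<^sup>2 - e * (K / 2 * e)))) + 
           ennreal (measure M {\<omega> \<in> space M. path_L1_dist n (Z \<omega>) \<rho> \<rho>\<^sub>0 - 2 * path_L1_dist n (Z \<omega>) \<rho> \<rho>' < K / 2 * e})"
          using e 3 by (intro expected_ratio_accepted J \<rho>' \<rho>C L) auto
        also have "\<dots> \<le> ennreal (exp (- (\<kappa> + 2) * x)) + ennreal (2 * exp (- (\<kappa> + 2) * x))"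
        proof (intro add_mono ennreal_leI bad exp_le_cancel_iff[THEN iffD2])
          have "\<tau> + real n * (L * e\<^sup>2 - e * (K / 2 * e)) = (L - K / 4) * x"
            by (simp add: \<tau>_def x_def power2_eq_square algebra_simps)
          also have "\<dots> \<le> (- (\<kappa> + 2)) * x" using K(1) x0 by (intro mult_right_mono) auto
          finally show "\<tau> + real n * (L * e\<^sup>2 - e * (K / 2 * e)) \<le> - (\<kappa> + 2) * x" .
        qed
        also have "\<dots> = ennreal (3 * exp (- (\<kappa> + 2) * x))" by (simp add: ennreal_plus[symmetric] del: ennreal_plus)
        also have "\<dots> \<le> ennreal (3 * exp (- (\<kappa> + 2) * x)) + indicator (C1_intensities - R) \<rho>" by simp
        finally show ?thesis .
      qed
    qed
    have "(\<integral>\<^sup>+y. F\<^sub>2 y \<partial>?O) = (\<integral>\<^sup>+\<rho>. \<integral>\<^sup>+y. ennreal (r y \<rho>) * indicator I y * indicator A \<rho> \<partial>?O \<partial>P)"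
      unfolding F\<^sub>2_def by (rule OP.Fubini'[OF m2])
    also have "\<dots> \<le> (\<integral>\<^sup>+\<rho>. ennreal (3 * exp (- (\<kappa> + 2) * x)) + indicator (C1_intensities - R) \<rho> \<partial>P)"
      by (intro nn_integral_mono inner)
    also have "\<dots> = ennreal (3 * exp (- (\<kappa> + 2) * x)) + emeasure P (C1_intensities - R)"
      unfolding spP[symmetric] by (subst nn_integral_add) (auto simp: P.emeasure_space_1)
    also have "\<dots> \<le> ennreal (3 * exp (- (\<kappa> + 2) * x)) + ennreal (exp (- (\<kappa> + 2) * x))"
      unfolding P.emeasure_eq_measure by (intro add_mono ennreal_leI Rmass) auto
    also have "\<dots> = ennreal (4 * exp (- (\<kappa> + 2) * x))" by (simp add: ennreal_plus[symmetric] del: ennreal_plus)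
    finally show "(\<integral>\<^sup>+y. F\<^sub>2 y \<partial>?O) \<le> ennreal (4 * exp (- (\<kappa> + 2) * x))" .
  next
    have inner: "(\<integral>\<^sup>+y. ennreal (1 / r y \<rho>) * indicator B \<rho> \<partial>?O) \<le> ennreal (exp (2 / c\<^sub>0 * x)) * indicator B \<rho>" if \<rho>: "\<rho> \<in> space P" for \<rho>
    proof (cases "\<rho> \<in> B")
      case True
      have "(\<integral>\<^sup>+y. ennreal (1 / r y \<rho>) * indicator B \<rho> \<partial>?O) = (\<integral>\<^sup>+y. ennreal (1 / r y \<rho>) \<partial>?O)" using True by simp
      also have "\<dots> = (\<integral>\<^sup>+\<omega>. \<integral>\<^sup>+N. ennreal (1 / likelihood_ratio n \<rho>\<^sub>0 N (Z \<omega>) \<rho>) \<partial>poisson_process_law n \<rho>\<^sub>0 (Z \<omega>) \<partial>M)"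
        using rm[of "\<lambda>y. y" "points_space \<Otimes>\<^sub>M M" "\<lambda>_. \<rho>"] \<rho> by (subst nn_integral_observation) (auto simp: r_def)
      also have "\<dots> \<le> (\<integral>\<^sup>+\<omega>. ennreal (exp (2 / c\<^sub>0 * (real n * e\<^sup>2))) \<partial>M)"
        using True sub(2) Bclose[OF True] e(3) by (intro nn_integral_mono expected_inverse_likelihood_ratio) auto
      also have "\<dots> = ennreal (exp (2 / c\<^sub>0 * x)) * indicator B \<rho>" using True by (simp add: emeasure_space_1 x_def)
      finally show ?thesis .
    qed simp
    have "(\<integral>\<^sup>+y. F\<^sub>3 y \<partial>?O) = (\<integral>\<^sup>+\<rho>. \<integral>\<^sup>+y. ennreal (1 / r y \<rho>) * indicator B \<rho> \<partial>?O \<partial>P)"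
      unfolding F\<^sub>3_def by (rule OP.Fubini'[OF m3])
    also have "\<dots> \<le> (\<integral>\<^sup>+\<rho>. ennreal (exp (2 / c\<^sub>0 * x)) * indicator B \<rho> \<partial>P)"
      by (intro nn_integral_mono inner)
    also have "\<dots> = ennreal (exp (2 / c\<^sub>0 * x) * m)"
      using B by (simp add: nn_integral_cmult P.emeasure_eq_measure m_def ennreal_mult)
    finally show "(\<integral>\<^sup>+y. F\<^sub>3 y \<partial>?O) \<le> ennreal (exp (2 / c\<^sub>0 * x) * m)" .
  qed auto
  also have "\<dots> = ennreal (exp (- x) + (t / 2 * (4 * exp (- (\<kappa> + 2) * x)) + 1 / (2 * t * m\<^sup>2) * (exp (2 / c\<^sub>0 * x) * m)))"
    using t0 m0 by (simp add: ennreal_mult[symmetric] ennreal_plus[symmetric] del: ennreal_plus)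
  also have "\<dots> \<le> ennreal (4 * exp (- x))"
  proof (rule ennreal_leI)
    have a: "t / 2 * (4 * exp (- (\<kappa> + 2) * x)) = 2 * exp (- x)"
      by (simp add: t_def exp_add[symmetric] algebra_simps)
    have "1 / (2 * t * m\<^sup>2) * (exp (2 / c\<^sub>0 * x) * m) = exp (2 / c\<^sub>0 * x) / (2 * t) * (1 / m)"
      using m0 t0 by (simp add: field_simps power2_eq_square)
    also have "\<dots> \<le> exp (2 / c\<^sub>0 * x) / (2 * t) * exp (L\<^sub>1 * x)"
    proof (rule mult_left_mono)
      have "1 / m \<le> 1 / exp (- L\<^sub>1 * x)" using Bmass m0 by (intro divide_left_mono) (auto simp: m_def)
      then show "1 / m \<le> exp (L\<^sub>1 * x)" by (simp add: exp_minus field_simps)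
    qed (use t0 in auto)
    also have "\<dots> = exp (\<kappa> * x - (\<kappa> + 1) * x) / 2"
    proof -
      have "exp (2 / c\<^sub>0 * x) * exp (L\<^sub>1 * x) / t = exp (\<kappa> * x - (\<kappa> + 1) * x)"
        by (simp only: t_def exp_diff \<kappa>_def exp_add[symmetric] distrib_right)
      then show ?thesis by simp
    qed
    also have "\<dots> = exp (- x) / 2" by (simp add: algebra_simps)
    finally show "exp (- x) + (t / 2 * (4 * exp (- (\<kappa> + 2) * x)) + 1 / (2 * t * m\<^sup>2) * (exp (2 / c\<^sub>0 * x) * m)) \<le> 4 * exp (- x)"
      unfolding a using exp_gt_zero[of "- x"] by linarith
  qed
  finally show ?thesis .
qed

end

section \<open>Posterior contraction\<close>

text \<open>The open set where a continuous function exceeds its essential supremum is null, hence empty in the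
  open cube; the boundary follows by density.\<close>

lemma Linf_norm_le_pointwise:
  fixes f :: "real ^ 'd \<Rightarrow> real"
  assumes c: "continuous_on unit_cube f" and le: "Linf_norm unit_cube f \<le> ereal e" and z: "z \<in> unit_cube"
  shows "\<bar>f z\<bar> \<le> e"
proof -
  have "AE z in restrict_space lborel unit_cube. ereal (norm (f z)) \<le> Linf_norm unit_cube f"
    unfolding Linf_norm_def by (rule esssup_AE)
  then have "AE z in restrict_space lborel unit_cube. ereal (norm (f z)) \<le> ereal e"
  proof eventually_elim
    case (elim z)
    then show ?case using le by (rule order_trans)
  qed
  then have ae: "AE z in lborel. z \<in> unit_cube \<longrightarrow> \<bar>f z\<bar> \<le> e"
    by (subst (asm) AE_restrict_space_iff) auto
  define U where "U = box 0 1 \<inter> (\<lambda>z. \<bar>f z\<bar>) -` {e<..}"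
  have U: "open U" unfolding U_def using c box_subset_cbox
    by (intro continuous_open_preimage continuous_intros) (auto intro: continuous_on_subset)
  have "AE z in lborel. z \<notin> U"
    using ae by eventually_elim (use box_subset_cbox in \<open>force simp: U_def\<close>)
  then have "U \<in> null_sets lborel" using U by (subst (asm) AE_iff_null_sets[symmetric]) auto
  then have "negligible U" by (simp add: negligible_iff_null_sets null_sets_completionI)
  then have "U = {}" using open_not_negligible[OF U] by blast
  then have box: "\<bar>f z\<bar> \<le> e" if "z \<in> box 0 1" for z using that by (force simp: U_def)
  have "box 0 (1 :: real ^ 'd) \<noteq> {}" by (simp add: interval_ne_empty_cart)
  then have cl: "closure (box 0 (1 :: real ^ 'd)) = unit_cube" by (rule closure_box)
  show ?thesis
    by (rule continuous_le_on_closure[where S="box 0 1"]) (use box z c cl in \<open>auto intro!: continuous_intros\<close>)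
qed

text \<open>The centres in the definition of the covering number are arbitrary integrable functions. Replacing
  each by a member of its ball that lies in \<open>R\<close> doubles the radius, and gives centres to which the
  \<open>C\<^sup>1\<close> bound of the sieve applies.\<close>

lemma covering_centres:
  fixes R :: "(real ^ 'd \<Rightarrow> real) set"
  assumes cov: "covering_number e R \<noteq> \<infinity>" and ln: "ln (real (the_enat (covering_number e R))) \<le> b"
    and R: "R \<subseteq> C1_intensities"
  obtains J where "finite J" "J \<subseteq> R" "real (card J) \<le> exp b"
    "\<And>\<rho>. \<rho> \<in> R \<Longrightarrow> \<exists>\<rho>'\<in>J. L1_dist lborel \<rho> \<rho>' \<le> 2 * e"
proof -
  let ?near = "\<lambda>f c. set_integrable lborel unit_cube f \<and> L1_dist lborel f c \<le> e"
  define S where "S = {C. finite C \<and> (\<forall>c\<in>C. set_integrable lborel unit_cube c) \<and> R \<subseteq> (\<Union>c\<in>C. {f. ?near f c})}"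
  have cn: "covering_number e R = Inf ((\<lambda>C. enat (card C)) ` S)" by (simp add: covering_number_def S_def)
  have "S \<noteq> {}"
  proof
    assume "S = {}"
    then have "covering_number e R = \<infinity>" by (simp add: cn top_enat_def)
    with cov show False by contradiction
  qed
  then obtain C\<^sub>0 where "C\<^sub>0 \<in> S" by blast
  then have "enat (card C\<^sub>0) \<in> (\<lambda>C. enat (card C)) ` S" by (rule imageI)
  then have "covering_number e R \<in> (\<lambda>C. enat (card C)) ` S"
    unfolding cn by (rule wellorder_InfI)
  then obtain C where C: "finite C" "\<And>c. c \<in> C \<Longrightarrow> set_integrable lborel unit_cube c"
      "R \<subseteq> (\<Union>c\<in>C. {f. ?near f c})" and card: "covering_number e R = enat (card C)"
    by (auto simp: S_def)
  define C' where "C' = {c \<in> C. \<exists>\<rho>\<in>R. ?near \<rho> c}"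
  define centre where "centre c = (SOME \<rho>. \<rho> \<in> R \<and> ?near \<rho> c)" for c
  have centre: "centre c \<in> R" "?near (centre c) c" if "c \<in> C'" for c
    using someI_ex[of "\<lambda>\<rho>. \<rho> \<in> R \<and> ?near \<rho> c"] that unfolding centre_def C'_def by blast+
  have fin: "finite C'" using C(1) by (simp add: C'_def)
  show ?thesis
  proof (rule that[of "centre ` C'"])
    show "finite (centre ` C')" using fin by simp
    show "centre ` C' \<subseteq> R" using centre by auto
    have "card (centre ` C') \<le> card C'" by (rule card_image_le[OF fin])
    also have "\<dots> \<le> card C" using C(1) by (intro card_mono) (auto simp: C'_def)
    finally have le: "card (centre ` C') \<le> card C" .
    have "real (card C) \<le> exp b"
    proof (cases "card C = 0")
      case False
      have "real (card C) = exp (ln (real (card C)))" using False by simp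
      also have "\<dots> \<le> exp b" using ln by (simp add: card)
      finally show ?thesis .
    qed simp
    then show "real (card (centre ` C')) \<le> exp b" using le by linarith
  next
    fix \<rho> assume \<rho>: "\<rho> \<in> R"
    then obtain c where c: "c \<in> C" and near: "?near \<rho> c" using C(3) by blast
    then have c': "c \<in> C'" using \<rho> by (auto simp: C'_def)
    let ?\<rho>' = "centre c"
    have i: "set_integrable lborel unit_cube \<rho>" "set_integrable lborel unit_cube c" "set_integrable lborel unit_cube ?\<rho>'"
      using near C(2)[OF c] centre(2)[OF c'] by auto
    note d = set_integrable_abs[OF set_integral_diff(1)[OF i(1) i(2)]] set_integrable_abs[OF set_integral_diff(1)[OF i(3) i(2)]]
      set_integrable_abs[OF set_integral_diff(1)[OF i(1) i(3)]]
    have "L1_dist lborel \<rho> ?\<rho>' \<le> (LINT z:unit_cube|lborel. \<bar>\<rho> z - c z\<bar> + \<bar>?\<rho>' z - c z\<bar>)"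
      unfolding L1_dist_def by (rule set_integral_mono[OF d(3) set_integral_add(1)[OF d(1) d(2)]]) linarith
    also have "\<dots> = L1_dist lborel \<rho> c + L1_dist lborel ?\<rho>' c"
      unfolding L1_dist_def by (rule set_integral_add(2)[OF d(1) d(2)])
    also have "\<dots> \<le> 2 * e" using near centre(2)[OF c'] by simp
    finally show "\<exists>\<rho>'\<in>centre ` C'. L1_dist lborel \<rho> \<rho>' \<le> 2 * e" using c' by blast
  qed
qed

lemma L1_dist_measurable:
  fixes \<nu> :: "(real ^ 'd) measure"
  assumes \<nu>: "sigma_finite_measure \<nu>" "sets \<nu> = sets borel" and \<rho>\<^sub>0: "\<rho>\<^sub>0 \<in> C1_intensities"
  shows "(\<lambda>\<rho>. L1_dist \<nu> \<rho> \<rho>\<^sub>0) \<in> borel_measurable intensity_borel"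
proof -
  interpret sigma_finite_measure \<nu> by (rule \<nu>)
  note [measurable_cong] = \<nu>(2)
  note [measurable] = C1_intensities_measurable[OF \<rho>\<^sub>0]
  have [measurable]: "(\<lambda>p. fst p (clamp 0 1 (snd p))) \<in> borel_measurable (intensity_borel \<Otimes>\<^sub>M \<nu>)"
    by (rule evaluation_measurable_compose) measurable
  have "(\<lambda>(\<rho>, z). indicator unit_cube z *\<^sub>R \<bar>\<rho> (clamp 0 1 z) - \<rho>\<^sub>0 z\<bar>) \<in> borel_measurable (intensity_borel \<Otimes>\<^sub>M \<nu>)"
    unfolding case_prod_unfold by measurable
  then have "(\<lambda>\<rho>. LINT z|\<nu>. indicator unit_cube z *\<^sub>R \<bar>\<rho> (clamp 0 1 z) - \<rho>\<^sub>0 z\<bar>) \<in> borel_measurable intensity_borel"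
    by (rule borel_measurable_lebesgue_integral)
  also have "(\<lambda>\<rho>. LINT z|\<nu>. indicator unit_cube z *\<^sub>R \<bar>\<rho> (clamp 0 1 z) - \<rho>\<^sub>0 z\<bar>) = (\<lambda>\<rho>. L1_dist \<nu> \<rho> \<rho>\<^sub>0)"
    unfolding L1_dist_def set_lebesgue_integral_def
    by (intro ext Bochner_Integration.integral_cong refl) (auto simp: indicator_def)
  finally show ?thesis .
qed

theorem theoremB1:
  fixes M :: "'w measure"
    and Z :: "'w \<Rightarrow> real ^ 'm \<Rightarrow> real ^ 'd"
    and \<nu> :: "(real ^ 'd) measure"
    and \<rho>\<^sub>0 :: "real ^ 'd \<Rightarrow> real"
    and P :: "nat \<Rightarrow> (real ^ 'd \<Rightarrow> real) measure"
    and \<epsilon> :: "nat \<Rightarrow> real"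
    and L\<^sub>1 :: real
  assumes field: "covariate_field M Z"
    and ergodic: "ergodic_covariates M Z \<nu>"
    and truth: "\<rho>\<^sub>0 \<in> C1_intensities"
    and truth_pos: "\<forall>z\<in>unit_cube. 0 < \<rho>\<^sub>0 z"
    and prior: "\<forall>n\<ge>1. prob_space (P n) \<and> sets (P n) = sets intensity_borel"
    and rate_pos: "\<forall>n\<ge>1. 0 < \<epsilon> n"
    and rate_lim: "\<epsilon> \<longlonglongrightarrow> 0"
    and rate_slow: "filterlim (\<lambda>n. real n * (\<epsilon> n)\<^sup>2) at_top sequentially"
    and L1_pos: "0 < L\<^sub>1"
    and prior_mass:
      "\<forall>n\<ge>1. measure (P n) {\<rho> \<in> C1_intensities. Linf_norm unit_cube (\<lambda>z. \<rho> z - \<rho>\<^sub>0 z) \<le> ereal (\<epsilon> n)}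
             \<ge> exp (- L\<^sub>1 * real n * (\<epsilon> n)\<^sup>2)"
    and sieves:
      "\<forall>L\<^sub>2>0. \<exists>R L\<^sub>3 L\<^sub>4. 0 < L\<^sub>3 \<and> 0 < L\<^sub>4 \<and> (\<forall>n\<ge>1.
          R n \<in> sets (P n) \<and>
          measure (P n) (C1_intensities - R n) \<le> exp (- L\<^sub>2 * real n * (\<epsilon> n)\<^sup>2) \<and>
          covering_number (\<epsilon> n) (R n) \<noteq> \<infinity> \<and>
          ln (real (the_enat (covering_number (\<epsilon> n) (R n)))) \<le> L\<^sub>3 * real n * (\<epsilon> n)\<^sup>2 \<and>
          (\<forall>\<rho>\<in>R n. C1_norm \<rho> \<le> L\<^sub>4))"
  shows "\<exists>K\<^sub>0>0. \<forall>K\<ge>K\<^sub>0.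
      (\<lambda>n. \<integral>\<^sup>+(N, \<omega>). posterior (P n) n N (Z \<omega>) {\<rho> \<in> C1_intensities. L1_dist \<nu> \<rho> \<rho>\<^sub>0 > K * \<epsilon> n}
              \<partial>observation_law M Z n \<rho>\<^sub>0) \<longlonglongrightarrow> 0"
proof -
  interpret prob_space M using field by (simp add: covariate_field_def)
  have jm: "(\<lambda>(\<omega>, x). Z \<omega> x) \<in> borel_measurable (M \<Otimes>\<^sub>M borel)" using field by (simp add: covariate_field_def)
  have Zc: "Z \<omega> x \<in> unit_cube" if "\<omega> \<in> space M" for \<omega> x using field that unfolding covariate_field_def by blast
  obtain z\<^sub>0 where z\<^sub>0: "z\<^sub>0 \<in> unit_cube" "\<And>z. z \<in> unit_cube \<Longrightarrow> \<rho>\<^sub>0 z\<^sub>0 \<le> \<rho>\<^sub>0 z"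
    using continuous_attains_inf[OF compact_cbox _ C1_intensities_continuous[OF truth]] clamp_cube by blast
  define c\<^sub>0 where "c\<^sub>0 = \<rho>\<^sub>0 z\<^sub>0"
  define B\<^sub>0 where "B\<^sub>0 = C1_norm \<rho>\<^sub>0"
  have c0: "0 < c\<^sub>0" using truth_pos z\<^sub>0 by (simp add: c\<^sub>0_def)
  have B0: "\<rho>\<^sub>0 z \<le> B\<^sub>0" if "z \<in> unit_cube" for z using C1_norm_bounds(1)[OF truth that] by (simp add: B\<^sub>0_def)
  have B0pos: "0 < B\<^sub>0" using B0[OF z\<^sub>0(1)] c0 by (simp add: c\<^sub>0_def)
  have model: "cox_model M Z n \<rho>\<^sub>0 c\<^sub>0 B\<^sub>0" if "n \<ge> 1" for n
    using that jm Zc truth c0 B0 z\<^sub>0(2) by unfold_locales (auto simp: c\<^sub>0_def)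
  obtain p C where p: "p \<in> borel_measurable borel" "\<And>z. 0 \<le> p z" "\<And>z. p z \<le> C"
      and \<nu>: "\<nu> = density lborel (\<lambda>z. ennreal (p z))"
    using ergodic unfolding ergodic_covariates_def by blast
  have C: "0 \<le> C" using p(2,3)[of 0] by linarith
  have \<nu>prob: "prob_space \<nu>"
  proof -
    have "(\<lambda>\<omega>. Z \<omega> 0) \<in> borel_measurable M"
      using measurable_compose[OF measurable_Pair[OF measurable_ident_sets[OF refl] measurable_const[of 0]] jm] by simp
    moreover have "distr M borel (\<lambda>\<omega>. Z \<omega> 0) = \<nu>" using ergodic by (simp add: ergodic_covariates_def)
    ultimately show ?thesis using prob_space_distr by metis
  qed
  have \<nu>sets: "sets \<nu> = sets borel" by (simp add: \<nu>)
  define \<kappa> where "\<kappa> = 2 / c\<^sub>0 + L\<^sub>1"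
  have \<kappa>: "0 < \<kappa>" using c0 L1_pos by (simp add: \<kappa>_def add_pos_pos)
  then have "0 < \<kappa> + 2" by simp
  from sieves[THEN spec, THEN mp, OF this] obtain R L\<^sub>3 L\<^sub>4 where RL: "0 < L\<^sub>3 \<and> 0 < L\<^sub>4 \<and> (\<forall>n\<ge>1.
          R n \<in> sets (P n) \<and>
          measure (P n) (C1_intensities - R n) \<le> exp (- (\<kappa> + 2) * real n * (\<epsilon> n)\<^sup>2) \<and>
          covering_number (\<epsilon> n) (R n) \<noteq> \<infinity> \<and>
          ln (real (the_enat (covering_number (\<epsilon> n) (R n)))) \<le> L\<^sub>3 * real n * (\<epsilon> n)\<^sup>2 \<and>
          (\<forall>\<rho>\<in>R n. C1_norm \<rho> \<le> L\<^sub>4))"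
    by (elim exE)
  then have L3: "0 < L\<^sub>3" and L4: "0 < L\<^sub>4" by simp_all
  have R: "R n \<in> sets (P n)"
      "measure (P n) (C1_intensities - R n) \<le> exp (- (\<kappa> + 2) * real n * (\<epsilon> n)\<^sup>2)"
      "covering_number (\<epsilon> n) (R n) \<noteq> \<infinity>"
      "ln (real (the_enat (covering_number (\<epsilon> n) (R n)))) \<le> L\<^sub>3 * real n * (\<epsilon> n)\<^sup>2"
      "\<And>\<rho>. \<rho> \<in> R n \<Longrightarrow> C1_norm \<rho> \<le> L\<^sub>4" if "n \<ge> 1" for n
    using RL that by blast+
  define L where "L = max L\<^sub>4 B\<^sub>0"
  have L: "0 \<le> L" "L\<^sub>4 \<le> L" "C1_norm \<rho>\<^sub>0 \<le> L" using L4 by (auto simp: L_def B\<^sub>0_def)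
  obtain K\<^sub>2 where K2: "K\<^sub>2 > 0" and conc: "\<And>\<rho> \<rho>' e t n. \<rho> \<in> C1_intensities \<Longrightarrow> \<rho>' \<in> C1_intensities \<Longrightarrow> C1_norm \<rho> \<le> L \<Longrightarrow> C1_norm \<rho>' \<le> L \<Longrightarrow>
      0 < e \<Longrightarrow> e \<le> 1 \<Longrightarrow> 0 < t \<Longrightarrow> n \<ge> 1 \<Longrightarrow>
      measure M {\<omega> \<in> space M. t + e < \<bar>path_L1_dist n (Z \<omega>) \<rho> \<rho>' - L1_dist \<nu> \<rho> \<rho>'\<bar>} \<le> exp (- K\<^sub>2 * (real n * t\<^sup>2))"
    using path_L1_dist_concentration[OF field ergodic L(1)] by blast
  \<comment> \<open>The first two terms make the error probabilities of the tests small enough, the third absorbs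
    the cover radius and the smoothing errors into \<open>K / 5\<close>, and the fourth, with the final \<open>1\<close> giving
    \<open>K \<le> K\<^sup>2\<close>, makes deviations of size \<open>K \<epsilon>\<^sub>n / 10\<close> unlikely enough.\<close>
  define K\<^sub>0 where "K\<^sub>0 = 4 * (L + \<kappa> + 2) + 4 * (B\<^sub>0 + L\<^sub>3 + 1) + 5 * (3 + 4 * C) + 100 * (\<kappa> + 2) / K\<^sub>2 + 1"
  have q: "0 \<le> 100 * (\<kappa> + 2) / K\<^sub>2" using \<kappa> K2 by simp
  have bound: "(\<integral>\<^sup>+(N, \<omega>). posterior (P n) n N (Z \<omega>) {\<rho> \<in> C1_intensities. L1_dist \<nu> \<rho> \<rho>\<^sub>0 > K * \<epsilon> n} \<partial>observation_law M Z n \<rho>\<^sub>0)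
      \<le> ennreal (4 * exp (- (real n * (\<epsilon> n)\<^sup>2)))"
    if K: "K \<ge> K\<^sub>0" and n: "n \<ge> 1" and e1: "\<epsilon> n \<le> 1" and e2: "\<epsilon> n \<le> c\<^sub>0 / 2" for K n
  proof -
    interpret cox_model M Z n \<rho>\<^sub>0 c\<^sub>0 B\<^sub>0 by (rule model[OF n])
    let ?x = "real n * (\<epsilon> n)\<^sup>2"
    have e: "0 < \<epsilon> n" using rate_pos n by simp
    have Kb: "L + \<kappa> + 2 \<le> K / 4" "B\<^sub>0 + L\<^sub>3 + 1 \<le> K / 4" "5 * (3 + 4 * C) \<le> K" "100 * (\<kappa> + 2) / K\<^sub>2 \<le> K" "1 \<le> K"
      using K L \<kappa> B0pos L3 C q by (auto simp: K\<^sub>0_def)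
    have Kc: "\<kappa> + 2 \<le> K\<^sub>2 * (K / 10)\<^sup>2"
    proof -
      have "100 * (\<kappa> + 2) / K\<^sub>2 \<le> K * K" using Kb(4,5) by (smt (verit) mult_le_cancel_left1)
      then show ?thesis using K2 by (simp add: field_simps power2_eq_square)
    qed
    have P: "prob_space (P n)" "sets (P n) = sets intensity_borel" using prior n by auto
    let ?A = "{\<rho> \<in> C1_intensities. L1_dist \<nu> \<rho> \<rho>\<^sub>0 > K * \<epsilon> n}"
    let ?B = "{\<rho> \<in> C1_intensities. Linf_norm unit_cube (\<lambda>z. \<rho> z - \<rho>\<^sub>0 z) \<le> ereal (\<epsilon> n)}"
    have RC: "R n \<subseteq> C1_intensities"
      using sets.sets_into_space[OF R(1)[OF n]] sets_eq_imp_space_eq[OF P(2)] by (simp add: space_intensity_borel)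
    have A: "?A \<in> sets (P n)"
    proof -
      interpret \<nu>: prob_space \<nu> by (rule \<nu>prob)
      have [measurable]: "(\<lambda>\<rho>. L1_dist \<nu> \<rho> \<rho>\<^sub>0) \<in> borel_measurable intensity_borel"
        by (rule L1_dist_measurable[OF _ \<nu>sets truth]) unfold_locales
      have "{\<rho> \<in> space intensity_borel. L1_dist \<nu> \<rho> \<rho>\<^sub>0 > K * \<epsilon> n} \<in> sets intensity_borel" by measurable
      then show ?thesis by (simp add: P(2) space_intensity_borel)
    qed
    have mass: "exp (- L\<^sub>1 * ?x) \<le> measure (P n) ?B" using prior_mass n by (simp add: mult.assoc)
    \<comment> \<open>A set of positive measure is measurable.\<close>
    have B: "?B \<in> sets (P n)"
      using mass measure_notin_sets[of ?B "P n"] exp_gt_zero[of "- L\<^sub>1 * ?x"] by linarith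
    obtain J where J: "finite J" "J \<subseteq> R n" "real (card J) \<le> exp (L\<^sub>3 * real n * (\<epsilon> n)\<^sup>2)"
        "\<And>\<rho>. \<rho> \<in> R n \<Longrightarrow> \<exists>\<rho>'\<in>J. L1_dist lborel \<rho> \<rho>' \<le> 2 * \<epsilon> n"
      using covering_centres[OF R(3,4)[OF n] RC] by blast
    have sep: "\<exists>\<rho>'\<in>J. measure M {\<omega> \<in> space M. path_L1_dist n (Z \<omega>) \<rho> \<rho>\<^sub>0 - 2 * path_L1_dist n (Z \<omega>) \<rho> \<rho>' < K / 2 * \<epsilon> n}
        \<le> 2 * exp (- (\<kappa> + 2) * ?x)" if \<rho>: "\<rho> \<in> R n \<inter> ?A" for \<rho>
    proof -
      obtain \<rho>' where \<rho>': "\<rho>' \<in> J" "L1_dist lborel \<rho> \<rho>' \<le> 2 * \<epsilon> n" using J(4) \<rho> by blast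
      have C1: "\<rho> \<in> C1_intensities" "\<rho>' \<in> C1_intensities" using \<rho> \<rho>' J(2) RC by auto
      have norm: "C1_norm \<rho> \<le> L" "C1_norm \<rho>' \<le> L" using R(5)[OF n] \<rho> \<rho>' J(2) L(2) by (auto intro: order_trans)
      have far: "K * \<epsilon> n < L1_dist \<nu> \<rho> \<rho>\<^sub>0" using \<rho> by simp
      have "L1_dist \<nu> \<rho> \<rho>' \<le> C * L1_dist lborel \<rho> \<rho>'"
      proof (rule L1_dist_density_le[OF \<nu> p C1_intensities_measurable[OF C1(1)] C1_intensities_measurable[OF C1(2)]])
        show "\<bar>\<rho> z - \<rho>' z\<bar> \<le> 2 * L" if "z \<in> unit_cube" for z
          using C1_norm_bounds(1)[OF C1(1) that] C1_norm_bounds(1)[OF C1(2) that] norm by linarith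
      qed
      also have "\<dots> \<le> C * (2 * \<epsilon> n)" using \<rho>'(2) C by (rule mult_left_mono)
      finally have near: "L1_dist \<nu> \<rho> \<rho>' \<le> C * (2 * \<epsilon> n)" .
      define t where "t = K / 10 * \<epsilon> n"
      have t: "0 < t" using e Kb(5) by (simp add: t_def)
      let ?E = "\<lambda>f. {\<omega> \<in> space M. t + \<epsilon> n < \<bar>path_L1_dist n (Z \<omega>) \<rho> f - L1_dist \<nu> \<rho> f\<bar>}"
      note [measurable] = path_L1_dist_measurable[OF C1(1) truth] path_L1_dist_measurable[OF C1]
      have Em: "?E \<rho>\<^sub>0 \<in> sets M" "?E \<rho>' \<in> sets M" by measurable
      have sub: "{\<omega> \<in> space M. path_L1_dist n (Z \<omega>) \<rho> \<rho>\<^sub>0 - 2 * path_L1_dist n (Z \<omega>) \<rho> \<rho>' < K / 2 * \<epsilon> n} \<subseteq> ?E \<rho>\<^sub>0 \<union> ?E \<rho>'"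
      proof (rule subsetI, rule ccontr)
        fix \<omega> assume \<omega>: "\<omega> \<in> {\<omega> \<in> space M. path_L1_dist n (Z \<omega>) \<rho> \<rho>\<^sub>0 - 2 * path_L1_dist n (Z \<omega>) \<rho> \<rho>' < K / 2 * \<epsilon> n}"
          and "\<omega> \<notin> ?E \<rho>\<^sub>0 \<union> ?E \<rho>'"
        then have "\<bar>path_L1_dist n (Z \<omega>) \<rho> \<rho>\<^sub>0 - L1_dist \<nu> \<rho> \<rho>\<^sub>0\<bar> \<le> t + \<epsilon> n" "\<bar>path_L1_dist n (Z \<omega>) \<rho> \<rho>' - L1_dist \<nu> \<rho> \<rho>'\<bar> \<le> t + \<epsilon> n" by auto
        then have "K * \<epsilon> n - 3 * t - (3 + 4 * C) * \<epsilon> n < path_L1_dist n (Z \<omega>) \<rho> \<rho>\<^sub>0 - 2 * path_L1_dist n (Z \<omega>) \<rho> \<rho>'"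
          using far near by (simp add: algebra_simps)
        moreover have "(3 + 4 * C) * \<epsilon> n \<le> K / 5 * \<epsilon> n" using Kb(3) e by (intro mult_right_mono) auto
        ultimately show False using \<omega> by (simp add: t_def)
      qed
      have "measure M {\<omega> \<in> space M. path_L1_dist n (Z \<omega>) \<rho> \<rho>\<^sub>0 - 2 * path_L1_dist n (Z \<omega>) \<rho> \<rho>' < K / 2 * \<epsilon> n} \<le> measure M (?E \<rho>\<^sub>0 \<union> ?E \<rho>')"
        using Em by (intro finite_measure_mono[OF sub]) auto
      also have "\<dots> \<le> measure M (?E \<rho>\<^sub>0) + measure M (?E \<rho>')" by (rule measure_Un_le[OF Em])
      also have "\<dots> \<le> exp (- K\<^sub>2 * (real n * t\<^sup>2)) + exp (- K\<^sub>2 * (real n * t\<^sup>2))"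
        by (intro add_mono conc C1 truth norm L(3) e e1 t n)
      also have "\<dots> \<le> 2 * exp (- (\<kappa> + 2) * ?x)"
      proof -
        have "(\<kappa> + 2) * ?x \<le> K\<^sub>2 * (K / 10)\<^sup>2 * ?x" using Kc by (rule mult_right_mono) simp
        also have "\<dots> = K\<^sub>2 * (real n * t\<^sup>2)" by (simp add: t_def power2_eq_square)
        finally have "exp (- K\<^sub>2 * (real n * t\<^sup>2)) \<le> exp (- (\<kappa> + 2) * ?x)"
          by (simp only: exp_le_cancel_iff mult_minus_left neg_le_iff_le)
        then show ?thesis by linarith
      qed
      finally show ?thesis using \<rho>'(1) by blast
    qed
    show ?thesis
    proof (rule expected_posterior_le[where B="?B" and R="R n" and J=J and L=L and L\<^sub>1=L\<^sub>1 and L\<^sub>3=L\<^sub>3 and K=K])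
      show "\<bar>\<rho> z - \<rho>\<^sub>0 z\<bar> \<le> \<epsilon> n" if "\<rho> \<in> ?B" "z \<in> unit_cube" for \<rho> z
        using that by (intro Linf_norm_le_pointwise[where f="\<lambda>z. \<rho> z - \<rho>\<^sub>0 z"])
          (auto intro!: continuous_on_diff C1_intensities_continuous[OF truth] intro: C1_intensities_continuous)
      show "measure (P n) (C1_intensities - R n) \<le> exp (- (2 / c\<^sub>0 + L\<^sub>1 + 2) * ?x)"
        using R(2)[OF n] by (simp add: \<kappa>_def mult.assoc)
      show "\<rho> z \<le> L" if "\<rho> \<in> R n" "z \<in> unit_cube" for \<rho> z
        using C1_norm_bounds(1)[OF subsetD[OF RC that(1)] that(2)] R(5)[OF n that(1)] L(2) by linarith
      show "real (card J) \<le> exp (L\<^sub>3 * ?x)" using J(3) by (simp add: mult.assoc)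
    qed (use P A B R(1)[OF n] mass J(1,2) RC L(1) sep Kb(1,2) e e1 e2 in \<open>auto simp: \<kappa>_def\<close>)
  qed
  have K0: "0 < K\<^sub>0" using L(1) \<kappa> B0pos L3 C q by (simp add: K\<^sub>0_def)
  show ?thesis
  proof (intro exI[of _ K\<^sub>0] conjI allI impI K0)
    fix K assume K: "K\<^sub>0 \<le> K"
    have "eventually (\<lambda>n. \<epsilon> n < min 1 (c\<^sub>0 / 2)) sequentially"
      using rate_lim c0 by (intro order_tendstoD) auto
    then have ev: "eventually (\<lambda>n. (\<integral>\<^sup>+(N, \<omega>). posterior (P n) n N (Z \<omega>) {\<rho> \<in> C1_intensities. L1_dist \<nu> \<rho> \<rho>\<^sub>0 > K * \<epsilon> n}
              \<partial>observation_law M Z n \<rho>\<^sub>0) \<le> ennreal (4 * exp (- (real n * (\<epsilon> n)\<^sup>2)))) sequentially"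
      using eventually_ge_at_top[of 1] by eventually_elim (intro bound K, auto)
    have "(\<lambda>n. exp (- (real n * (\<epsilon> n)\<^sup>2))) \<longlonglongrightarrow> 0"
      using rate_slow by (intro filterlim_compose[OF exp_at_bot]) (simp add: filterlim_uminus_at_bot)
    then have "(\<lambda>n. ennreal (4 * exp (- (real n * (\<epsilon> n)\<^sup>2)))) \<longlonglongrightarrow> ennreal (4 * 0)"
      by (intro tendsto_ennrealI tendsto_mult_left)
    then have lim: "(\<lambda>n. ennreal (4 * exp (- (real n * (\<epsilon> n)\<^sup>2)))) \<longlonglongrightarrow> 0" by simp
    show "(\<lambda>n. \<integral>\<^sup>+(N, \<omega>). posterior (P n) n N (Z \<omega>) {\<rho> \<in> C1_intensities. L1_dist \<nu> \<rho> \<rho>\<^sub>0 > K * \<epsilon> n}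
              \<partial>observation_law M Z n \<rho>\<^sub>0) \<longlonglongrightarrow> 0"
      by (rule tendsto_sandwich[OF _ ev tendsto_const lim]) simp
  qed
qed

end
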